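(* Let $a,b>0$ be constants with $a+b<\tfrac12$. There exists $\varepsilon_0>0$ such that for every fixed $0<\varepsilon<\varepsilon_0$ the following holds. Consider data $n,\boldsymbol{s},\boldsymbol{t},H$ with $n\to\infty$ such that, uniformly over $j$, $s_j-s$, $x_j$, $t_j-s$, $y_j$ are $O(n^{1/2+\varepsilon})$; $X=O(n^{1+2\varepsilon})$; and $\frac{(1-2\lambda)^2}{3A}\le a\log n$. Let $G$ be uniformly random in $\mathcal{D}(\boldsymbol{s},\boldsymbol{t})$ and $p=s/(n-1)$. Then (i) the probability that $G$ is arc-disjoint from $H$ is $(1-p)^X\,M$ and (ii) the probability that $G$ contains $H$ as a subdigraph (every arc of $H$ is an arc of $G$) is $p^X\,T$, where \begin{align*} M=\exp\Bigl(&\frac{\lambda X}{(1-\lambda)n}+\frac{\lambda X^2}{2(1-\lambda)n^2}-\frac{R_{1,1}+C_{1,1}}{(1-\lambda)n}-\frac{Y}{\lambda(1-\lambda)n^2}+\frac{\lambda(R_{0,2}+C_{0,2})}{2(1-\lambda)n}\\ &+\frac{\lambda(1-2\lambda)(R_{0,3}+C_{0,3})}{6(1-\lambda)^2n^2}-\frac{(1-2\lambda)(R_{1,2}+C_{1,2})}{2(1-\lambda)^2n^2}-\frac{R_{2,1}+C_{2,1}}{2(1-\lambda)^2n^2}+O(n^{-b})\Bigr), \end{align*} \begin{align*} T=\exp\Bigl(&\frac{(1-\lambda)X}{\lambda n}+\frac{(1-\lambda)X^2}{2\lambda n^2}+\frac{R_{1,1}+C_{1,1}}{\lambda n}-\frac{R_{2,1}+C_{2,1}}{2\lambda^2n^2}-\frac{(1+\lambda)(R_{0,2}+C_{0,2})}{2\lambda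 n}\\ &+\frac{(1+2\lambda)(R_{1,2}+C_{1,2})}{2\lambda^2n^2}-\frac{(1+\lambda)(1+2\lambda)(R_{0,3}+C_{0,3})}{6\lambda^2n^2}-\frac{Y-Y_{0,1}-Y_{1,0}+Y_{1,1}}{\lambda(1-\lambda)n^2}+O(n^{-b})\Bigr). \end{align*}
   Context: A simple digraph has no loops and no multiple arcs. $\boldsymbol{s}=(s_1,\dots,s_n)$, $\boldsymbol{t}=(t_1,\dots,t_n)$ are vectors of positive integers with equal sums; $\mathcal{D}(\boldsymbol{s},\boldsymbol{t})$ is the set of simple digraphs on $\{w_1,\dots,w_n\}$ with out-degrees $s_j$ and in-degrees $t_j$. $H$ is a fixed simple digraph on the same vertices with out-degrees $x_j$ and in-degrees $y_j$. $s=n^{-1}\sum_js_j$, $\lambda=s/n$, $A=\tfrac12\lambda(1-\lambda)$, $\delta_j=s_j-s+\lambda x_j$, $\eta_j=t_j-s+\lambda y_j$, $X=\sum_jx_j$ (number of arcs of $H$). For nonnegative integers $h,\ell$: $R_{h,\ell}=\sum_{j=1}^n\delta_j^hx_j^\ell$, $C_{h,\ell}=\sum_{j=1}^n\eta_j^hy_j^\ell$. Sums over arcs $w_jw_k$ (from $w_j$ to $w_k$) of $H$: $Y=\sum\delta_j\eta_k$, $Y_{1,1}=\sum x_jy_k$, $Y_{0,1}=\sum\delta_jy_k$, $Y_{1,0}=\sum x_j\eta_k$. Asymptotic notation refers to $n\to\infty$. *)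

theory Defs
  imports Complex_Main
begin

text \<open>Vertices w_1..w_n are represented by 0..n-1. A simple digraph is a set of
  arcs (j,k) (arc from j to k) with j,k < n and j \<noteq> k.\<close>

definition arcs :: "nat \<Rightarrow> (nat \<times> nat) set" where
  "arcs n = {(j,k). j < n \<and> k < n \<and> j \<noteq> k}"

definition outdeg :: "(nat \<times> nat) set \<Rightarrow> nat \<Rightarrow> nat" where
  "outdeg G j = card {k. (j,k) \<in> G}"

definition indeg :: "(nat \<times> nat) set \<Rightarrow> nat \<Rightarrow> nat" where
  "indeg G k = card {j. (j,k) \<in> G}"

definition digraphs_deg :: "nat \<Rightarrow> (nat \<Rightarrow> nat) \<Rightarrow> (nat \<Rightarrow> nat) \<Rightarrow> (nat \<times> nat) set set" where
  "digraphs_deg n s t = {G. G \<subseteq> arcs n \<and> (\<forall>j<n. outdeg G j = s j \<and> indeg G j = t j)}"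

definition prob_D :: "nat \<Rightarrow> (nat \<Rightarrow> nat) \<Rightarrow> (nat \<Rightarrow> nat) \<Rightarrow> ((nat \<times> nat) set \<Rightarrow> bool) \<Rightarrow> real" where
  "prob_D n s t P = real (card {G \<in> digraphs_deg n s t. P G}) / real (card (digraphs_deg n s t))"

definition sbar :: "nat \<Rightarrow> (nat \<Rightarrow> nat) \<Rightarrow> real" where
  "sbar n s = (\<Sum>j<n. real (s j)) / real n"

definition lam :: "nat \<Rightarrow> (nat \<Rightarrow> nat) \<Rightarrow> real" where
  "lam n s = sbar n s / real n"

definition Acst :: "nat \<Rightarrow> (nat \<Rightarrow> nat) \<Rightarrow> real" where
  "Acst n s = lam n s * (1 - lam n s) / 2"

definition dlt :: "nat \<Rightarrow> (nat \<Rightarrow> nat) \<Rightarrow> (nat \<times> nat) set \<Rightarrow> nat \<Rightarrow> real" where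
  "dlt n s H j = real (s j) - sbar n s + lam n s * real (outdeg H j)"

definition eta :: "nat \<Rightarrow> (nat \<Rightarrow> nat) \<Rightarrow> (nat \<Rightarrow> nat) \<Rightarrow> (nat \<times> nat) set \<Rightarrow> nat \<Rightarrow> real" where
  "eta n s t H j = real (t j) - sbar n s + lam n s * real (indeg H j)"

definition Xarcs :: "nat \<Rightarrow> (nat \<times> nat) set \<Rightarrow> real" where
  "Xarcs n H = (\<Sum>j<n. real (outdeg H j))"

definition Rs :: "nat \<Rightarrow> (nat \<Rightarrow> nat) \<Rightarrow> (nat \<times> nat) set \<Rightarrow> nat \<Rightarrow> nat \<Rightarrow> real" where
  "Rs n s H h l = (\<Sum>j<n. dlt n s H j ^ h * real (outdeg H j) ^ l)"

definition Cs :: "nat \<Rightarrow> (nat \<Rightarrow> nat) \<Rightarrow> (nat \<Rightarrow> nat) \<Rightarrow> (nat \<times> nat) set \<Rightarrow> nat \<Rightarrow> nat \<Rightarrow> real" where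
  "Cs n s t H h l = (\<Sum>j<n. eta n s t H j ^ h * real (indeg H j) ^ l)"

definition Ysum :: "nat \<Rightarrow> (nat \<Rightarrow> nat) \<Rightarrow> (nat \<Rightarrow> nat) \<Rightarrow> (nat \<times> nat) set \<Rightarrow> real" where
  "Ysum n s t H = (\<Sum>(j,k)\<in>H. dlt n s H j * eta n s t H k)"

definition Y11 :: "(nat \<times> nat) set \<Rightarrow> real" where
  "Y11 H = (\<Sum>(j,k)\<in>H. real (outdeg H j) * real (indeg H k))"

definition Y01 :: "nat \<Rightarrow> (nat \<Rightarrow> nat) \<Rightarrow> (nat \<times> nat) set \<Rightarrow> real" where
  "Y01 n s H = (\<Sum>(j,k)\<in>H. dlt n s H j * real (indeg H k))"

definition Y10 :: "nat \<Rightarrow> (nat \<Rightarrow> nat) \<Rightarrow> (nat \<Rightarrow> nat) \<Rightarrow> (nat \<times> nat) set \<Rightarrow> real" where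
  "Y10 n s t H = (\<Sum>(j,k)\<in>H. real (outdeg H j) * eta n s t H k)"

definition Mexp :: "nat \<Rightarrow> (nat \<Rightarrow> nat) \<Rightarrow> (nat \<Rightarrow> nat) \<Rightarrow> (nat \<times> nat) set \<Rightarrow> real" where
  "Mexp n s t H = (let l = lam n s; N = real n; X = Xarcs n H;
      R = Rs n s H; C = Cs n s t H in
      l * X / ((1 - l) * N) + l * X^2 / (2 * (1 - l) * N^2)
      - (R 1 1 + C 1 1) / ((1 - l) * N)
      - Ysum n s t H / (l * (1 - l) * N^2)
      + l * (R 0 2 + C 0 2) / (2 * (1 - l) * N)
      + l * (1 - 2*l) * (R 0 3 + C 0 3) / (6 * (1 - l)^2 * N^2)
      - (1 - 2*l) * (R 1 2 + C 1 2) / (2 * (1 - l)^2 * N^2)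
      - (R 2 1 + C 2 1) / (2 * (1 - l)^2 * N^2))"

definition Texp :: "nat \<Rightarrow> (nat \<Rightarrow> nat) \<Rightarrow> (nat \<Rightarrow> nat) \<Rightarrow> (nat \<times> nat) set \<Rightarrow> real" where
  "Texp n s t H = (let l = lam n s; N = real n; X = Xarcs n H;
      R = Rs n s H; C = Cs n s t H in
      (1 - l) * X / (l * N) + (1 - l) * X^2 / (2 * l * N^2)
      + (R 1 1 + C 1 1) / (l * N)
      - (R 2 1 + C 2 1) / (2 * l^2 * N^2)
      - (1 + l) * (R 0 2 + C 0 2) / (2 * l * N)
      + (1 + 2*l) * (R 1 2 + C 1 2) / (2 * l^2 * N^2)
      - (1 + l) * (1 + 2*l) * (R 0 3 + C 0 3) / (6 * l^2 * N^2)
      - (Ysum n s t H - Y01 n s H - Y10 n s t H + Y11 H) / (l * (1 - l) * N^2))"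

end

theory Submission
  imports Defs
begin

text \<open>Revealing the arcs of \<open>H\<close> one at a time, the probability of avoiding \<open>H\<close> is a product of factors
  \<open>1 - P\<close>, where \<open>P\<close> is the probability of a single arc in a random digraph with given degrees that
  avoids the arcs already revealed; hence it suffices to know such a probability up to an error of
  order \<open>n powr (-3/2)\<close>, apart from small powers of \<open>n\<close>.

  Take two rows \<open>a\<close>, \<open>b\<close> of the adjacency matrix and let \<open>\<alpha>\<close> and \<open>\<beta>\<close> count the free columns in which
  only row \<open>a\<close>, respectively only row \<open>b\<close>, has an entry 1. Given everything except how these columns
  are shared out between the two rows, all ways of sharing them out are equally likely. Therefore
  \<open>P(a,v) - P(b,v)\<close> is exactly the mean of \<open>(\<alpha> - \<beta>) / (\<alpha> + \<beta>)\<close> over the event that column \<open>v\<close> is one of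
  them. Here \<open>\<alpha> - \<beta>\<close> is of order \<open>n powr (1/2)\<close>, and \<open>\<alpha> + \<beta>\<close> is concentrated because the codegree of two
  rows has a small fourth central moment. Averaging over \<open>b\<close> gives \<open>P(a,v)\<close> to leading order; since
  conditioning on a bounded number of entries leads to measures of the same kind, inserting an
  estimate on the right-hand side yields a better one, and two such rounds reach the required order.

  The exponent of the theorem, as a function of \<open>H\<close>, changes by \<open>ln ((1 - P) / (1 - p))\<close>, up to this
  error, when an arc is added to \<open>H\<close>. Containing \<open>H\<close> means avoiding \<open>H\<close> in the complementary digraph.\<close>

subsection \<open>Averages and error terms\<close>

text \<open>The set \<open>H\<close> may have about \<open>n powr (1 + 2 * \<epsilon>)\<close> arcs
  and the errors of the single steps add up, so an error \<open>n powr (-3/2)\<close> per arc leaves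
  about \<open>n powr (-1/2)\<close> in total; hence \<open>b < 1/2\<close>. The obstacle is the
  random denominator \<open>\<alpha> + \<beta>\<close>, which fluctuates by the order of the square
  root of \<open>n\<close>. Expanding the ratio about a centre \<open>D1\<close> leaves a linear
  term, the mean of \<open>(\<alpha> - \<beta>) * (D1 - \<alpha> - \<beta>)\<close>, and in the
  second round absolute values are too crude for it. There \<open>D1\<close> agrees with the mean of
  \<open>\<alpha> + \<beta>\<close> very closely, and \<open>\<alpha> - \<beta>\<close> is a
  constant plus few indicators of frozen columns; since conditioning on one more cell barely moves
  the mean of \<open>\<alpha> + \<beta>\<close>, a square root of \<open>n\<close> is gained.

  Differences between rows leave one unknown per column, which the fixed column sum supplies. All of
  this needs at least one digraph with the given degrees. Its existence follows from the same
  concentration, by walking from a balanced degree sequence to the given one.\<close>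

definition avg :: "'b set \<Rightarrow> ('b \<Rightarrow> real) \<Rightarrow> real" where
  "avg S f = (\<Sum>x\<in>S. f x) / real (card S)"

lemma avg_cong: "(\<And>x. x \<in> S \<Longrightarrow> f x = g x) \<Longrightarrow> avg S f = avg S g"
  by (simp add: avg_def)

lemma avg_add: "avg S (\<lambda>x. f x + g x) = avg S f + avg S g"
  by (simp add: avg_def sum.distrib add_divide_distrib)

lemma avg_diff: "avg S (\<lambda>x. f x - g x) = avg S f - avg S g"
  by (simp add: avg_def sum_subtractf diff_divide_distrib)

lemma avg_cmult: "avg S (\<lambda>x. c * f x) = c * avg S f"
  by (simp add: avg_def sum_distrib_left)

lemma avg_const: "finite S \<Longrightarrow> S \<noteq> {} \<Longrightarrow> avg S (\<lambda>x. c) = c"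
  by (simp add: avg_def)

lemma avg_sum: "avg S (\<lambda>x. \<Sum>i\<in>I. f i x) = (\<Sum>i\<in>I. avg S (f i))"
  unfolding avg_def by (subst sum.swap) (simp add: sum_divide_distrib)

lemma avg_mono: "(\<And>x. x \<in> S \<Longrightarrow> f x \<le> g x) \<Longrightarrow> avg S f \<le> avg S g"
  by (simp add: avg_def sum_mono divide_right_mono)

lemma avg_nonneg: "(\<And>x. x \<in> S \<Longrightarrow> 0 \<le> f x) \<Longrightarrow> 0 \<le> avg S f"
  by (simp add: avg_def sum_nonneg)

lemma avg_abs: "\<bar>avg S f\<bar> \<le> avg S (\<lambda>x. \<bar>f x\<bar>)"
  by (simp add: avg_def divide_right_mono)

lemma avg_restrict:
  assumes "finite S" "T \<subseteq> S"
  shows "avg S (\<lambda>x. of_bool (x \<in> T) * f x) = avg S (\<lambda>x. of_bool (x \<in> T)) * avg T f"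
proof -
  have fT: "finite T" using assms finite_subset by blast
  have 1: "(\<Sum>x\<in>S. of_bool (x \<in> T) * f x) = (\<Sum>x\<in>T. f x)"
    using assms by (intro sum.mono_neutral_cong_right) auto
  have 2: "(\<Sum>x\<in>S. of_bool (x \<in> T) :: real) = real (card T)"
  proof -
    have "(\<Sum>x\<in>S. of_bool (x \<in> T) :: real) = (\<Sum>x\<in>T. 1)"
      using assms by (intro sum.mono_neutral_cong_right) auto
    then show ?thesis by simp
  qed
  show ?thesis
  proof (cases "T = {}")
    case True then show ?thesis by (simp add: avg_def)
  next
    case False
    then have "card T > 0" using fT by (simp add: card_gt_0_iff)
    then show ?thesis by (simp add: avg_def 1 2)
  qed
qed

text \<open>The scale of all error terms: \<open>r\<close> stands for the square root of \<open>n\<close>, and \<open>\<theta>\<close> for a small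
  power of \<open>n\<close> that absorbs constants, logarithms and the factors \<open>n powr \<epsilon>\<close> of the hypotheses.\<close>

locale scale =
  fixes \<theta> r :: real
  assumes theta_ge: "\<theta> \<ge> 100" and r_ge: "r \<ge> \<theta> ^ 100"
begin

lemma theta_pos: "\<theta> > 0" "\<theta> \<ge> 1" "\<theta> \<noteq> 0" using theta_ge by auto

lemma r_pos: "r > 0" "r \<ge> 1" "r \<noteq> 0"
proof -
  have "\<theta> ^ 100 \<ge> 1" using theta_ge by (intro one_le_power) auto
  then show "r > 0" "r \<ge> 1" "r \<noteq> 0" using r_ge by linarith+
qed

text \<open>The exponent \<open>j\<close> counts powers of the square root of \<open>n\<close>, so
  \<open>j = -3\<close> is the accuracy \<open>n powr (-3/2)\<close>. The exponent \<open>k\<close>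
  counts the factors \<open>\<theta>\<close> lost on the way; a constant up to 100 costs one of
  them.\<close>

definition bd :: "nat \<Rightarrow> int \<Rightarrow> real \<Rightarrow> bool" where
  "bd k j x \<longleftrightarrow> \<bar>x\<bar> \<le> \<theta> ^ k * r powi j"

lemma bdI: "\<bar>x\<bar> \<le> \<theta> ^ k * r powi j \<Longrightarrow> bd k j x" by (simp add: bd_def)

lemma bdD: "bd k j x \<Longrightarrow> \<bar>x\<bar> \<le> \<theta> ^ k * r powi j" by (simp add: bd_def)

lemma bd_weaken:
  assumes "bd k j x" "k \<le> k'" "j \<le> j'"
  shows "bd k' j' x"
proof -
  have "\<theta> ^ k \<le> \<theta> ^ k'" using assms theta_pos by (intro power_increasing) auto
  moreover have "r powi j \<le> r powi j'"
    using assms r_pos by (intro power_int_increasing) auto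
  ultimately have "\<theta> ^ k * r powi j \<le> \<theta> ^ k' * r powi j'"
    using theta_pos r_pos by (intro mult_mono) auto
  then show ?thesis using assms by (simp add: bd_def)
qed

text \<open>One spare power of \<open>r\<close> pays for up to 100 powers of
  \<open>\<theta>\<close>, by \<open>r_ge\<close>; in this way terms of lower order stop
  contributing to the exponent of \<open>\<theta>\<close>.\<close>

lemma bd_absorb:
  assumes "bd k j x" "k \<le> k' + 100" "j + 1 \<le> j'"
  shows "bd k' j' x"
proof -
  have "\<theta> ^ k * r powi j \<le> \<theta> ^ (k' + 100) * r powi (j' - 1)"
    using bd_weaken[of k j "\<theta> ^ k * r powi j" "k' + 100" "j' - 1"] assms theta_pos r_pos
    by (simp add: bd_def)
  also have "\<dots> = \<theta> ^ k' * (\<theta> ^ 100 * r powi (j' - 1))" by (simp add: power_add)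
  also have "\<dots> \<le> \<theta> ^ k' * (r * r powi (j' - 1))"
    using r_ge theta_pos r_pos by (intro mult_left_mono mult_right_mono) auto
  also have "r * r powi (j' - 1) = r powi j'"
    using r_pos by (simp add: power_int_diff)
  finally show ?thesis using assms by (simp add: bd_def)
qed

lemma bd_mult: "bd k j x \<Longrightarrow> bd k' j' y \<Longrightarrow> bd (k + k') (j + j') (x * y)"
  using mult_mono[of "\<bar>x\<bar>" "\<theta> ^ k * r powi j" "\<bar>y\<bar>" "\<theta> ^ k' * r powi j'"] theta_pos r_pos
  by (simp add: bd_def abs_mult power_add power_int_add mult_ac)

lemma bd_add: 
  assumes "bd k j x" "bd k j y" shows "bd (Suc k) j (x + y)"
proof -
  have "\<bar>x + y\<bar> \<le> 2 * (\<theta> ^ k * r powi j)" using assms unfolding bd_def by linarith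
  also have "\<dots> \<le> \<theta> * (\<theta> ^ k * r powi j)"
    using theta_ge r_pos by (intro mult_right_mono) auto
  finally show ?thesis by (simp add: bd_def mult_ac)
qed

lemma bd_minus: "bd k j x \<Longrightarrow> bd k j (- x)" by (simp add: bd_def)

lemma bd_abs: "bd k j x \<Longrightarrow> bd k j \<bar>x\<bar>" by (simp add: bd_def)

lemma bd_le: "bd k j x \<Longrightarrow> \<bar>y\<bar> \<le> x \<Longrightarrow> bd k j y" by (auto simp add: bd_def)

lemma bd_power: "bd k j x \<Longrightarrow> bd (k * m) (j * int m) (x ^ m)"
proof (induction m)
  case 0 then show ?case by (simp add: bd_def)
next
  case (Suc m)
  show ?case using bd_mult[OF Suc.prems Suc.IH[OF Suc.prems]] by (simp add: algebra_simps)
qed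

lemma bd_multI: "bd k1 j1 x \<Longrightarrow> bd k2 j2 y \<Longrightarrow> k1 + k2 \<le> k \<Longrightarrow> j1 + j2 \<le> j \<Longrightarrow> bd k j (x * y)"
  by (rule bd_weaken[OF bd_mult])

text \<open>The strict inequalities leave the factor \<open>\<theta>\<close> that absorbs the 2 from
  adding two bounds.\<close>

lemma bd_addI: "bd k1 j1 x \<Longrightarrow> bd k2 j2 y \<Longrightarrow> k1 < k \<Longrightarrow> k2 < k \<Longrightarrow> j1 \<le> j \<Longrightarrow> j2 \<le> j \<Longrightarrow> bd k j (x + y)"
  using bd_add[of "k - 1" j x y] bd_weaken[of k1 j1 x "k - 1" j] bd_weaken[of k2 j2 y "k - 1" j] by simp

lemma bd_diffI: "bd k1 j1 x \<Longrightarrow> bd k2 j2 y \<Longrightarrow> k1 < k \<Longrightarrow> k2 < k \<Longrightarrow> j1 \<le> j \<Longrightarrow> j2 \<le> j \<Longrightarrow> bd k j (x - y)"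
  using bd_addI[of k1 j1 x k2 j2 "- y"] bd_minus[of k2 j2 y] by simp

lemma bd_const: "\<bar>c\<bar> \<le> 100 \<Longrightarrow> bd 1 0 c" using theta_ge by (simp add: bd_def)
lemma bd_one: "\<bar>c\<bar> \<le> 1 \<Longrightarrow> bd 0 0 c" by (simp add: bd_def)
lemma bd_0: "bd k j 0" using theta_pos r_pos by (simp add: bd_def)
lemma bd_theta: "bd 1 0 \<theta>" using theta_ge by (simp add: bd_def)
lemma bd_r: "bd 0 1 r" using r_pos by (simp add: bd_def)

lemma bd_sum:
  assumes "\<And>i. i \<in> I \<Longrightarrow> bd k j (f i)" "bd k' j' (real (card I))"
  shows "bd (k + k') (j + j') (\<Sum>i\<in>I. f i)"
proof -
  have "\<bar>\<Sum>i\<in>I. f i\<bar> \<le> (\<Sum>i\<in>I. \<bar>f i\<bar>)" by (rule sum_abs)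
  also have "\<dots> \<le> (\<Sum>i\<in>I. \<theta> ^ k * r powi j)" using assms(1) by (intro sum_mono) (simp add: bd_def)
  also have "\<dots> = (\<theta> ^ k * r powi j) * real (card I)" by simp
  also have "\<dots> \<le> (\<theta> ^ k * r powi j) * (\<theta> ^ k' * r powi j')"
    using assms(2) theta_pos r_pos by (intro mult_left_mono) (auto simp: bd_def)
  also have "\<dots> = \<theta> ^ (k + k') * r powi (j + j')"
    using r_pos by (simp add: power_add power_int_add mult_ac)
  finally show ?thesis by (simp add: bd_def)
qed

end

subsection \<open>Switchings in two rows\<close>

text \<open>A digraph is read as a 0-1 matrix, \<open>rw\<close> and \<open>cl\<close> being the supports of its rows and columns.
  \<open>Om n s t F Q\<close> consists of the matrices with the given row and column sums whose entries in the
  frozen cells \<open>F\<close> are prescribed, namely 1 exactly on \<open>Q\<close>. Conditioning on the value of a cell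
  amounts to freezing it.\<close>

definition rw :: "(nat \<times> nat) set \<Rightarrow> nat \<Rightarrow> nat set" where "rw G a = {v. (a,v) \<in> G}"
definition cl :: "(nat \<times> nat) set \<Rightarrow> nat \<Rightarrow> nat set" where "cl G v = {a. (a,v) \<in> G}"

lemma mem_rw [simp]: "v \<in> rw G a \<longleftrightarrow> (a,v) \<in> G" by (simp add: rw_def)
lemma mem_cl [simp]: "a \<in> cl G v \<longleftrightarrow> (a,v) \<in> G" by (simp add: cl_def)

definition Om :: "nat \<Rightarrow> (nat \<Rightarrow> nat) \<Rightarrow> (nat \<Rightarrow> nat) \<Rightarrow> (nat \<times> nat) set \<Rightarrow> (nat \<times> nat) set \<Rightarrow> (nat \<times> nat) set set"
  where "Om n s t F Q = {G. G \<subseteq> {..<n} \<times> {..<n} \<and> G \<inter> F = Q \<and>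
     (\<forall>a<n. card (rw G a) = s a) \<and> (\<forall>v<n. card (cl G v) = t v)}"

lemma rw_subset: "G \<subseteq> {..<n} \<times> {..<n} \<Longrightarrow> rw G a \<subseteq> {..<n}" by (auto simp: rw_def)
lemma cl_subset: "G \<subseteq> {..<n} \<times> {..<n} \<Longrightarrow> cl G a \<subseteq> {..<n}" by (auto simp: cl_def)

lemma finite_rw: "G \<subseteq> {..<n} \<times> {..<n} \<Longrightarrow> finite (rw G a)" 
  by (rule finite_subset[OF rw_subset]) auto
lemma finite_cl: "G \<subseteq> {..<n} \<times> {..<n} \<Longrightarrow> finite (cl G a)" 
  by (rule finite_subset[OF cl_subset]) auto

lemma finite_Om: "finite (Om n s t F Q)"
  by (rule finite_subset[of _ "Pow ({..<n} \<times> {..<n})"]) (auto simp: Om_def)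

lemma Om_incl:
  assumes "e \<notin> F" "Q \<subseteq> F"
  shows "Om n s t (insert e F) (insert e Q) = {G \<in> Om n s t F Q. e \<in> G}"
proof -
  have *: "G \<inter> insert e F = insert e Q \<longleftrightarrow> G \<inter> F = Q \<and> e \<in> G" for G
  proof
    assume h: "G \<inter> insert e F = insert e Q"
    then have "e \<in> G" by blast
    moreover have "G \<inter> F = (G \<inter> insert e F) - {e}" using assms by blast
    ultimately show "G \<inter> F = Q \<and> e \<in> G" using h assms by auto
  qed auto
  show ?thesis unfolding Om_def mem_Collect_eq by (rule Collect_cong) (simp add: * conj_commute conj_left_commute)
qed

lemma Om_excl:
  assumes "e \<notin> F" "Q \<subseteq> F"
  shows "Om n s t (insert e F) Q = {G \<in> Om n s t F Q. e \<notin> G}"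
proof -
  have *: "G \<inter> insert e F = Q \<longleftrightarrow> G \<inter> F = Q \<and> e \<notin> G" for G
  proof
    assume h: "G \<inter> insert e F = Q"
    then have "e \<notin> G" using assms by blast
    then show "G \<inter> F = Q \<and> e \<notin> G" using h by auto
  qed auto
  show ?thesis unfolding Om_def mem_Collect_eq by (rule Collect_cong) (simp add: * conj_commute conj_left_commute)
qed

definition free2 :: "nat \<Rightarrow> (nat \<times> nat) set \<Rightarrow> nat \<Rightarrow> nat \<Rightarrow> nat set" where
  "free2 n F a b = {v. v < n \<and> (a,v) \<notin> F \<and> (b,v) \<notin> F}"

definition only :: "nat \<Rightarrow> (nat \<times> nat) set \<Rightarrow> nat \<Rightarrow> nat \<Rightarrow> (nat \<times> nat) set \<Rightarrow> nat set" where
  "only n F a b G = {v \<in> free2 n F a b. (a,v) \<in> G \<and> (b,v) \<notin> G}"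

definition switch :: "nat \<Rightarrow> nat \<Rightarrow> (nat \<times> nat) set \<Rightarrow> nat \<Rightarrow> nat \<Rightarrow> (nat \<times> nat) set" where
  "switch a b G v w = (G - {(a,v),(b,w)}) \<union> {(b,v),(a,w)}"

lemma finite_free2 [simp]: "finite (free2 n F a b)" by (simp add: free2_def)
lemma finite_only [simp]: "finite (only n F a b G)" by (simp add: only_def)

lemma only_switch:
  assumes "a \<noteq> b" "v \<in> only n F a b G" "w \<in> only n F b a G"
  shows "only n F a b (switch a b G v w) = insert w (only n F a b G - {v})"
    "only n F b a (switch a b G v w) = insert v (only n F b a G - {w})"
proof -
  have h: "v < n" "w < n" "v \<noteq> w" "(a,v) \<in> G" "(b,v) \<notin> G" "(b,w) \<in> G" "(a,w) \<notin> G"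
    "(a,v) \<notin> F" "(b,v) \<notin> F" "(a,w) \<notin> F" "(b,w) \<notin> F"
    using assms(2,3) by (auto simp: only_def free2_def)
  show "only n F a b (switch a b G v w) = insert w (only n F a b G - {v})"
    using h assms(1) by (auto simp: only_def free2_def switch_def)
  show "only n F b a (switch a b G v w) = insert v (only n F b a G - {w})"
    using h assms(1) by (auto simp: only_def free2_def switch_def)
qed

lemma card_only_switch:
  assumes "a \<noteq> b" "v \<in> only n F a b G" "w \<in> only n F b a G"
  shows "card (only n F a b (switch a b G v w)) = card (only n F a b G)"
    "card (only n F b a (switch a b G v w)) = card (only n F b a G)"
proof -
  have *: "card (insert y (A - {x})) = card A" if "x \<in> A" "y \<notin> A" "finite A" for x y :: nat and A
    using that card_Suc_Diff1[of A x] by (simp add: card.insert_remove)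
  have "w \<notin> only n F a b G" "v \<notin> only n F b a G" using assms(2,3) by (auto simp: only_def)
  then show "card (only n F a b (switch a b G v w)) = card (only n F a b G)"
    "card (only n F b a (switch a b G v w)) = card (only n F b a G)"
    unfolding only_switch[OF assms] using assms(2,3) by (blast intro: * finite_only)+
qed

lemma switch_Om:
  assumes ab: "a \<noteq> b" "a < n" "b < n" and G: "G \<in> Om n s t F Q"
    and v: "v \<in> only n F a b G" and w: "w \<in> only n F b a G"
  shows "switch a b G v w \<in> Om n s t F Q"
proof -
  let ?G = "switch a b G v w"
  have vw: "v < n" "w < n" "v \<noteq> w" "(a,v) \<in> G" "(b,v) \<notin> G" "(b,w) \<in> G" "(a,w) \<notin> G"
    "(a,v) \<notin> F" "(b,v) \<notin> F" "(a,w) \<notin> F" "(b,w) \<notin> F"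
    using v w by (auto simp: only_def free2_def)
  have sub: "G \<subseteq> {..<n} \<times> {..<n}" using G by (simp add: Om_def)
  have r1: "rw ?G a = insert w (rw G a - {v})" "rw ?G b = insert v (rw G b - {w})"
    using vw ab by (auto simp: switch_def rw_def)
  have r2: "c \<noteq> a \<Longrightarrow> c \<noteq> b \<Longrightarrow> rw ?G c = rw G c" for c
    by (auto simp: switch_def rw_def)
  have c1: "cl ?G v = insert b (cl G v - {a})" "cl ?G w = insert a (cl G w - {b})"
    using vw ab by (auto simp: switch_def cl_def)
  have c2: "c \<noteq> v \<Longrightarrow> c \<noteq> w \<Longrightarrow> cl ?G c = cl G c" for c
    by (auto simp: switch_def cl_def)
  have *: "card (insert y (A - {x})) = card A" if "x \<in> A" "y \<notin> A" "finite A" for x y :: nat and A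
    using that card_Suc_Diff1[of A x] by (simp add: card.insert_remove)
  have "card (rw ?G c) = card (rw G c)" for c
    using r1 r2[of c] *[of v "rw G a" w] *[of w "rw G b" v] vw finite_rw[OF sub]
    by (cases "c = a"; cases "c = b") auto
  moreover have "card (cl ?G c) = card (cl G c)" for c
    using c1 c2[of c] *[of a "cl G v" b] *[of b "cl G w" a] vw finite_cl[OF sub]
    by (cases "c = v"; cases "c = w") auto
  moreover have "?G \<subseteq> {..<n} \<times> {..<n}" using sub vw ab by (auto simp: switch_def)
  moreover have "?G \<inter> F = G \<inter> F" using vw by (auto simp: switch_def)
  ultimately show ?thesis using G by (simp add: Om_def)
qed

lemma switch_switch:
  assumes "a \<noteq> b" "v \<in> only n F a b G" "w \<in> only n F b a G"
  shows "switch a b (switch a b G v w) w v = G"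
  using assms by (auto simp: only_def switch_def)

text \<open>The triple \<open>(G, v, w)\<close> goes to \<open>(switch a b G v w, w, v)\<close>.
  This is an involution of the set of all triples, so the sum may be reindexed by it.\<close>

lemma switch_sum:
  fixes f :: "(nat \<times> nat) set \<Rightarrow> nat \<Rightarrow> nat \<Rightarrow> real"
  assumes ab: "a \<noteq> b" "a < n" "b < n"
  shows "(\<Sum>G\<in>Om n s t F Q. \<Sum>v\<in>only n F a b G. \<Sum>w\<in>only n F b a G. f G v w)
    = (\<Sum>G\<in>Om n s t F Q. \<Sum>v\<in>only n F a b G. \<Sum>w\<in>only n F b a G. f (switch a b G v w) w v)"
proof -
  let ?T = "SIGMA G:Om n s t F Q. only n F a b G \<times> only n F b a G"
  have *: "(\<Sum>G\<in>Om n s t F Q. \<Sum>v\<in>only n F a b G. \<Sum>w\<in>only n F b a G. g G v w)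
     = (\<Sum>(G,v,w)\<in>?T. g G v w)" for g :: "(nat \<times> nat) set \<Rightarrow> nat \<Rightarrow> nat \<Rightarrow> real"
    by (subst sum.Sigma[symmetric]) (auto simp: finite_Om sum.cartesian_product)
  define h where "h = (\<lambda>(G,v,w). (switch a b G v w, w, v))"
  have hT: "h x \<in> ?T" if "x \<in> ?T" for x
    using that ab switch_Om[OF ab] only_switch[of a b]
    by (auto simp: h_def)
  have hh: "h (h x) = x" if "x \<in> ?T" for x
    using that ab switch_switch[of a b] by (auto simp: h_def)
  have "(\<Sum>(G,v,w)\<in>?T. f G v w) = (\<Sum>(G,v,w)\<in>?T. f (switch a b G v w) w v)"
    by (rule sum.reindex_bij_witness[of _ h h]) (use hT hh in \<open>auto simp: h_def\<close>)
  then show ?thesis by (simp only: *)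
qed

text \<open>Given everything but the way in which the symmetric difference of the rows \<open>a\<close> and \<open>b\<close> is
  shared out, all ways of sharing it out are equally likely.\<close>

lemma avg_row_difference:
  assumes ab: "a \<noteq> b" "a < n" "b < n" and v: "v < n" "(a,v) \<notin> F" "(b,v) \<notin> F"
  shows "avg (Om n s t F Q) (\<lambda>G. of_bool ((a,v) \<in> G)) - avg (Om n s t F Q) (\<lambda>G. of_bool ((b,v) \<in> G))
    = avg (Om n s t F Q) (\<lambda>G. of_bool (((a,v) \<in> G) \<noteq> ((b,v) \<in> G)) *
        ((real (card (only n F a b G)) - real (card (only n F b a G))) /
         (real (card (only n F a b G)) + real (card (only n F b a G)))))"
proof -
  define A B where "A G = only n F a b G" and "B G = only n F b a G" for G
  define D where "D G = real (card (A G)) + real (card (B G))" for G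
  define S where "S = Om n s t F Q"
  have inA: "v \<in> A G \<longleftrightarrow> (a,v) \<in> G \<and> (b,v) \<notin> G" for G 
    using v by (auto simp: A_def only_def free2_def)
  have inB: "v \<in> B G \<longleftrightarrow> (b,v) \<in> G \<and> (a,v) \<notin> G" for G 
    using v by (auto simp: B_def only_def free2_def)
  have finA: "finite (A G)" "finite (B G)" for G by (simp_all add: A_def B_def)
  \<comment> \<open>Switches that take column \<open>v\<close> out of \<open>A\<close> are matched
    with those that take it out of \<open>B\<close>. The weight \<open>1 / D\<close> is constant
    along a switch, so the two weighted counts agree.\<close>
  have "(\<Sum>G\<in>S. \<Sum>x\<in>A G. \<Sum>w\<in>B G. of_bool (x = v) / D G)
    = (\<Sum>G\<in>S. \<Sum>x\<in>A G. \<Sum>w\<in>B G. of_bool (w = v) / D (switch a b G x w))"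
    unfolding A_def B_def S_def by (rule switch_sum[OF ab])
  also have "\<dots> = (\<Sum>G\<in>S. \<Sum>x\<in>A G. \<Sum>w\<in>B G. of_bool (w = v) / D G)"
    using ab by (intro sum.cong refl) (simp add: D_def A_def B_def card_only_switch)
  finally have 0: "(\<Sum>G\<in>S. \<Sum>x\<in>A G. \<Sum>w\<in>B G. of_bool (x = v) / D G)
    = (\<Sum>G\<in>S. \<Sum>x\<in>A G. \<Sum>w\<in>B G. of_bool (w = v) / D G)" .
  have ob: "(\<Sum>x\<in>C. of_bool (x = v) * c) = of_bool (v \<in> C) * c" if "finite C" for C and c :: real
    using that by (simp add: of_bool_def if_distrib[of "\<lambda>x. x * c"] cong: if_cong)
  have "(\<Sum>x\<in>A G. \<Sum>w\<in>B G. of_bool (x = v) / D G) = of_bool (v \<in> A G) * real (card (B G)) / D G" for G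
  proof -
    have "(\<Sum>x\<in>A G. \<Sum>w\<in>B G. of_bool (x = v) / D G) = (\<Sum>x\<in>A G. of_bool (x = v) * (real (card (B G)) / D G))"
      by (intro sum.cong) auto
    also have "\<dots> = of_bool (v \<in> A G) * (real (card (B G)) / D G)" by (rule ob[OF finA(1)])
    finally show ?thesis by (simp only: times_divide_eq_right)
  qed
  moreover have "(\<Sum>x\<in>A G. \<Sum>w\<in>B G. of_bool (w = v) / D G) = of_bool (v \<in> B G) * real (card (A G)) / D G" for G
  proof -
    have "(\<Sum>x\<in>A G. \<Sum>w\<in>B G. of_bool (w = v) / D G) = (\<Sum>x\<in>A G. of_bool (v \<in> B G) / D G)"
    proof (intro sum.cong refl)
      fix x
      have "(\<Sum>w\<in>B G. of_bool (w = v) / D G) = (\<Sum>w\<in>B G. of_bool (w = v) * (1 / D G))" by simp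
      also have "\<dots> = of_bool (v \<in> B G) * (1 / D G)" by (rule ob[OF finA(2)])
      finally show "(\<Sum>w\<in>B G. of_bool (w = v) / D G) = of_bool (v \<in> B G) / D G" by simp
    qed
    then show ?thesis by simp
  qed
  ultimately have 1: "(\<Sum>G\<in>S. of_bool (v \<in> A G) * real (card (B G)) / D G) = (\<Sum>G\<in>S. of_bool (v \<in> B G) * real (card (A G)) / D G)"
    using 0 by simp
  have "(\<Sum>G\<in>S. of_bool ((a,v) \<in> G)) - (\<Sum>G\<in>S. of_bool ((b,v) \<in> G))
    = (\<Sum>G\<in>S. of_bool (v \<in> A G) - of_bool (v \<in> B G) :: real)"
    unfolding sum_subtractf[symmetric] by (intro sum.cong refl) (auto simp: inA inB)
  \<comment> \<open>For \<open>v\<close> in \<open>A G\<close> this reads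
    \<open>1 = (\<alpha> - \<beta>) / D + 2 * \<beta> / D\<close>, and similarly for
    \<open>v\<close> in \<open>B G\<close>. The doubled part has sum zero by the balance just
    shown.\<close>
  also have "\<dots> = (\<Sum>G\<in>S. of_bool (((a,v) \<in> G) \<noteq> ((b,v) \<in> G)) * ((real (card (A G)) - real (card (B G))) / D G)
      + 2 * (of_bool (v \<in> A G) * real (card (B G)) / D G - of_bool (v \<in> B G) * real (card (A G)) / D G))"
  proof (intro sum.cong refl)
    fix G
    have "D G \<noteq> 0" if "v \<in> A G \<or> v \<in> B G"
    proof -
      have "card (A G) > 0 \<or> card (B G) > 0" using that finA by (auto simp: card_gt_0_iff)
      then show ?thesis by (auto simp: D_def)
    qed
    then show "of_bool (v \<in> A G) - of_bool (v \<in> B G) = of_bool (((a,v) \<in> G) \<noteq> ((b,v) \<in> G)) * ((real (card (A G)) - real (card (B G))) / D G)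
      + 2 * (of_bool (v \<in> A G) * real (card (B G)) / D G - of_bool (v \<in> B G) * real (card (A G)) / D G)"
      by (cases "(a,v) \<in> G"; cases "(b,v) \<in> G") (simp_all add: inA inB divide_simps, simp_all add: D_def)
  qed
  also have "\<dots> = (\<Sum>G\<in>S. of_bool (((a,v) \<in> G) \<noteq> ((b,v) \<in> G)) * ((real (card (A G)) - real (card (B G))) / D G))"
    by (simp only: sum.distrib sum_subtractf sum_distrib_left[symmetric] 1) simp
  finally show ?thesis
    unfolding avg_def S_def[symmetric] diff_divide_distrib[symmetric] A_def B_def D_def by simp
qed

section \<open>Counting the entries of two rows\<close>

abbreviation cod :: "(nat \<times> nat) set \<Rightarrow> nat \<Rightarrow> nat \<Rightarrow> real" where
  "cod G a b \<equiv> real (card (rw G a \<inter> rw G b))"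

abbreviation frozen2 :: "(nat \<times> nat) set \<Rightarrow> nat \<Rightarrow> nat \<Rightarrow> nat set" where
  "frozen2 F a b \<equiv> rw F a \<union> rw F b"

lemma only_subset: "only n F a b G \<subseteq> {..<n}" by (auto simp: only_def free2_def)

lemma card_split_frozen:
  assumes "X \<subseteq> {..<n}"
  shows "real (card X) = real (card (X \<inter> free2 n F a b)) + real (card (X \<inter> frozen2 F a b))"
proof -
  have "X = (X \<inter> free2 n F a b) \<union> (X \<inter> frozen2 F a b)" using assms by (auto simp: free2_def)
  moreover have "card \<dots> = card (X \<inter> free2 n F a b) + card (X \<inter> frozen2 F a b)"
    using assms finite_subset[OF assms] by (intro card_Un_disjoint) (auto simp: free2_def)
  ultimately show ?thesis by simp
qed

lemma card_only_Int:
  assumes "G \<subseteq> {..<n} \<times> {..<n}"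
  shows "real (card (only n F a b G \<inter> C)) + real (card (rw G a \<inter> rw G b \<inter> C \<inter> free2 n F a b))
     = real (card (rw G a \<inter> C \<inter> free2 n F a b))"
proof -
  have "rw G a \<inter> C \<inter> free2 n F a b = (only n F a b G \<inter> C) \<union> (rw G a \<inter> rw G b \<inter> C \<inter> free2 n F a b)"
    by (auto simp: only_def)
  moreover have "card \<dots> = card (only n F a b G \<inter> C) + card (rw G a \<inter> rw G b \<inter> C \<inter> free2 n F a b)"
    using finite_rw[OF assms] by (intro card_Un_disjoint) (auto simp: only_def)
  ultimately show ?thesis by simp
qed

text \<open>Two frozen sets occur: \<open>F'\<close> belongs to the measure, \<open>F\<close>
  defines the free columns. After conditioning the measure has more frozen cells, while the counts
  still refer to the original ones.\<close>

lemma card_only: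
  assumes "G \<in> Om n s t F' Q'" "a < n"
  shows "real (card (only n F a b G)) = real (s a) - real (card (rw G a \<inter> frozen2 F a b))
     - real (card (rw G a \<inter> rw G b \<inter> free2 n F a b))"
proof -
  have G: "G \<subseteq> {..<n} \<times> {..<n}" and sa: "card (rw G a) = s a" using assms by (auto simp: Om_def)
  show ?thesis
    using card_only_Int[OF G, of F a b UNIV] card_split_frozen[OF rw_subset[OF G], of a F a b] sa by simp
qed

lemma only_sum_le:
  assumes "G \<in> Om n s t F Q"
  shows "card (only n F a b G) + card (only n F b a G) \<le> n"
proof -
  have "card (only n F a b G) + card (only n F b a G) = card (only n F a b G \<union> only n F b a G)"
    by (intro card_Un_disjoint[symmetric]) (auto simp: only_def)
  also have "\<dots> \<le> card {..<n}" using only_subset by (intro card_mono) auto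
  finally show ?thesis by simp
qed

text \<open>The common entries of the two rows cancel in the difference. It is therefore controlled
  by degrees and frozen columns for every single matrix, before any concentration is known.\<close>

lemma only_diff_le:
  assumes "G \<in> Om n s t F Q" "a < n" "b < n" "finite F"
  shows "\<bar>real (card (only n F a b G)) - real (card (only n F b a G))\<bar>
    \<le> \<bar>real (s a) - real (s b)\<bar> + real (card (frozen2 F a b))"
proof -
  have fin: "finite (frozen2 F a b)"
    using assms(4) finite_subset[of "frozen2 F a b" "snd ` F"] by (force simp: rw_def image_iff)
  have "card (rw G a \<inter> frozen2 F a b) \<le> card (frozen2 F a b)"
    "card (rw G b \<inter> frozen2 F a b) \<le> card (frozen2 F a b)"
    using fin by (auto intro: card_mono)
  moreover have "rw G b \<inter> frozen2 F b a = rw G b \<inter> frozen2 F a b"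
    "rw G b \<inter> rw G a \<inter> free2 n F b a = rw G a \<inter> rw G b \<inter> free2 n F a b"
    by (auto simp: free2_def)
  ultimately show ?thesis
    using card_only[OF assms(1,2), of F b] card_only[OF assms(1,3), of F a] by auto
qed

text \<open>A column in which the rows \<open>a\<close> and \<open>b\<close> agree contributes
  equally to both codegrees with \<open>c\<close>, so only switchable and frozen columns
  remain.\<close>

lemma cod_diff_le:
  assumes "G \<in> Om n s t F Q" "finite F"
  shows "\<bar>(cod G a c - cod G b c) - (real (card (only n F a b G \<inter> rw G c)) - real (card (only n F b a G \<inter> rw G c)))\<bar>
    \<le> real (card (frozen2 F a b))"
proof -
  have G: "G \<subseteq> {..<n} \<times> {..<n}" using assms by (auto simp: Om_def)
  have fin: "finite (frozen2 F a b)"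
    using assms(2) finite_subset[of "frozen2 F a b" "snd ` F"] by (force simp: rw_def image_iff)
  have le: "card (X \<inter> frozen2 F a b) \<le> card (frozen2 F a b)" for X
    using fin by (auto intro: card_mono)
  have sub: "rw G a \<inter> rw G c \<subseteq> {..<n}" "rw G b \<inter> rw G c \<subseteq> {..<n}"
    using rw_subset[OF G] by auto
  have eq: "rw G b \<inter> rw G a \<inter> rw G c \<inter> free2 n F b a = rw G a \<inter> rw G b \<inter> rw G c \<inter> free2 n F a b"
    "rw G b \<inter> rw G c \<inter> free2 n F b a = rw G b \<inter> rw G c \<inter> free2 n F a b"
    by (auto simp: free2_def)
  show ?thesis
    using card_only_Int[OF G, of F a b "rw G c"] card_only_Int[OF G, of F b a "rw G c"]
      card_split_frozen[OF sub(1), of F a b] card_split_frozen[OF sub(2), of F a b]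
      le[of "rw G a \<inter> rw G c"] le[of "rw G b \<inter> rw G c"]
    unfolding eq by linarith
qed

lemma young_3_1:
  fixes x u :: real
  assumes "x \<ge> 0" "u \<ge> 0"
  shows "x * u ^ 3 \<le> u ^ 4 / 4 + 7 * x ^ 4"
proof -
  \<comment> \<open>The minimum of \<open>u ^ 4 / 4 - x * u ^ 3\<close> is attained at
    \<open>u = 3 * x\<close> and equals \<open>- 27 / 4 * x ^ 4\<close>; the constant is then
    rounded up to 7.\<close>
  have "u ^ 4 / 4 + 27 / 4 * x ^ 4 - x * u ^ 3 = (u - 3 * x)\<^sup>2 * ((u + x)\<^sup>2 + 2 * x\<^sup>2) / 4"
    by (simp add: power2_eq_square power3_eq_cube power4_eq_xxxx algebra_simps) 
  moreover have "\<dots> \<ge> 0" by simp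
  moreover have "x ^ 4 \<ge> 0" by simp
  ultimately show ?thesis by linarith
qed

text \<open>The function \<open>(U - U') * (U^3 + U'^3)\<close> is antisymmetric under the switch, so it has mean zero;
  its mean over the switches of one matrix is about \<open>4 * U^4\<close>, up to terms of order \<open>n * U^2\<close>.\<close>

lemma fourth_moment:
  assumes ab: "a \<noteq> b" "a < n" "b < n" and c: "c \<noteq> a" "c \<noteq> b"
    and ne: "Om n s t F Q \<noteq> {}"
    and N: "\<And>G. G \<in> Om n s t F Q \<Longrightarrow> \<bar>real (card (only n F a b G)) - real (card (only n F b a G))\<bar> \<le> N"
  shows "avg (Om n s t F Q) (\<lambda>G. (real (card (only n F a b G \<inter> rw G c)) - real (card (only n F b a G \<inter> rw G c))) ^ 4)
    \<le> 14 * N ^ 4 + 25 * real n ^ 2"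
proof -
  define A B where "A G = only n F a b G" and "B G = only n F b a G" for G
  define S where "S = Om n s t F Q"
  define C where "C G = rw G c" for G
  define p q where "p G = real (card (A G \<inter> C G))" and "q G = real (card (B G \<inter> C G))" for G
  define U where "U G = p G - q G" for G
  \<comment> \<open>This factor normalises the sum over the switches of one matrix, so that the
    drift computed below is \<open>U\<close> itself up to an error \<open>N\<close>; it is constant
    along a switch.\<close>
  define h where "h G = 2 / (real (card (A G)) + real (card (B G)))" for G
  define x where "x G v w = (of_bool (v \<in> C G) - of_bool (w \<in> C G) :: real)" for G v w
  define f where "f G v w = h G * ((U G - U (switch a b G v w)) * (U G ^ 3 + U (switch a b G v w) ^ 3))" for G v w
  have fin: "finite (A G)" "finite (B G)" for G by (simp_all add: A_def B_def)
  have N0: "N \<ge> 0" using ne N by fastforce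
  have n1: "real n \<ge> 1" using ab by simp
  have Usw: "U (switch a b G v w) = U G - 2 * x G v w" if v: "v \<in> A G" and w: "w \<in> B G" for G v w
  proof -
    have C: "C (switch a b G v w) = C G" using c by (auto simp: C_def switch_def rw_def)
    have vw: "v \<notin> B G" "w \<notin> A G" using v w by (auto simp: A_def B_def only_def)
    have AB: "A (switch a b G v w) = insert w (A G - {v})" "B (switch a b G v w) = insert v (B G - {w})"
      using only_switch[OF ab(1)] v w unfolding A_def B_def by auto
    have *: "real (card (insert z (Y - {y}) \<inter> X)) = real (card (Y \<inter> X)) - of_bool (y \<in> X) + of_bool (z \<in> X)"
      if "y \<in> Y" "z \<notin> Y" "finite Y" for y z :: nat and X Y
    proof -
      have 1: "insert z (Y - {y}) \<inter> X = (if z \<in> X then insert z ((Y \<inter> X) - {y}) else (Y \<inter> X) - {y})"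
        by auto
      have 2: "real (card ((Y \<inter> X) - {y})) = real (card (Y \<inter> X)) - of_bool (y \<in> X)"
        using that card_Suc_Diff1[of "Y \<inter> X" y] by (cases "y \<in> X") auto
      show ?thesis unfolding 1 using 2 that by auto
    qed
    show ?thesis
      unfolding U_def p_def q_def C AB using *[OF v vw(2) fin(1), of "C G"] *[OF w vw(1) fin(2), of "C G"]
      by (simp add: x_def)
  qed
  have "(\<Sum>G\<in>S. \<Sum>v\<in>A G. \<Sum>w\<in>B G. f G v w) = (\<Sum>G\<in>S. \<Sum>v\<in>A G. \<Sum>w\<in>B G. f (switch a b G v w) w v)"
    unfolding S_def A_def B_def by (rule switch_sum[OF ab])
  also have "\<dots> = (\<Sum>G\<in>S. \<Sum>v\<in>A G. \<Sum>w\<in>B G. - f G v w)"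
  proof (intro sum.cong refl)
    fix G v w assume vw: "v \<in> A G" "w \<in> B G"
    have "h (switch a b G v w) = h G"
      using card_only_switch[OF ab(1)] vw unfolding h_def A_def B_def by simp
    moreover have "switch a b (switch a b G v w) w v = G"
      using switch_switch[OF ab(1)] vw unfolding A_def B_def by simp
    ultimately show "f (switch a b G v w) w v = - f G v w"
      unfolding f_def by (simp add: algebra_simps)
  qed
  finally have f0: "(\<Sum>G\<in>S. \<Sum>v\<in>A G. \<Sum>w\<in>B G. f G v w) = 0" by (simp add: sum_negf)
  have pt: "2 * U G ^ 4 - 28 * N ^ 4 - 50 * real n ^ 2 \<le> (\<Sum>v\<in>A G. \<Sum>w\<in>B G. f G v w)" if G: "G \<in> S" for G
  proof -
    define \<alpha> \<beta> where "\<alpha> = real (card (A G))" and "\<beta> = real (card (B G))"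
    have h0: "h G \<ge> 0" by (simp add: h_def)
    have pq: "p G \<ge> 0" "q G \<ge> 0" "p G \<le> \<alpha>" "q G \<le> \<beta>"
      using fin by (auto simp: p_def q_def \<alpha>_def \<beta>_def card_mono)
    have abn: "\<alpha> + \<beta> \<le> real n" "\<alpha> \<ge> 0" "\<beta> \<ge> 0"
      using only_sum_le[of G n s t F Q a b] G by (auto simp: \<alpha>_def \<beta>_def A_def B_def S_def)
    have f_ge: "h G * (4 * U G ^ 3 * x G v w - (24 * U G ^ 2 + 28)) \<le> f G v w" if vw: "v \<in> A G" "w \<in> B G" for v w
    proof -
      \<comment> \<open>For \<open>y = 1\<close> and \<open>y = -1\<close> the right-hand side
        exceeds the left by \<open>12 * (u + 1)^2\<close> and \<open>12 * (u - 1)^2\<close>.\<close>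
      have "4 * u ^ 3 * y - (24 * u ^ 2 + 28) \<le> (u - (u - 2 * y)) * (u ^ 3 + (u - 2 * y) ^ 3)"
        if "y = 1 \<or> y = 0 \<or> y = -1" for u y :: real
      proof -
        have "12 * (u - 1)\<^sup>2 \<ge> 0" "12 * (u + 1)\<^sup>2 \<ge> 0" by simp_all
        then show ?thesis using that
          by (auto simp: power2_eq_square power3_eq_cube algebra_simps)
      qed
      moreover have "x G v w = 1 \<or> x G v w = 0 \<or> x G v w = -1" by (auto simp: x_def)
      ultimately show ?thesis unfolding f_def Usw[OF vw] using h0 by (intro mult_left_mono) auto
    qed
    have sx: "(\<Sum>v\<in>A G. \<Sum>w\<in>B G. x G v w) = \<beta> * p G - \<alpha> * q G"
    proof -
      have 1: "(\<Sum>v\<in>Y. of_bool (v \<in> C G)) = real (card (Y \<inter> C G))" if "finite Y" for Y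
        using that by (simp add: of_bool_def sum.If_cases Int_def)
      show ?thesis
        using fin by (simp add: x_def sum_subtractf 1 sum_distrib_left[symmetric] \<alpha>_def \<beta>_def p_def q_def)
    qed
    have "(\<Sum>v\<in>A G. \<Sum>w\<in>B G. h G * (4 * U G ^ 3 * x G v w - (24 * U G ^ 2 + 28)))
       = h G * (4 * U G ^ 3 * (\<beta> * p G - \<alpha> * q G) - \<alpha> * \<beta> * (24 * U G ^ 2 + 28))"
      unfolding sx[symmetric] by (simp add: sum_distrib_left sum_distrib_right sum_subtractf \<alpha>_def \<beta>_def algebra_simps)
    then have 2: "h G * (4 * U G ^ 3 * (\<beta> * p G - \<alpha> * q G) - \<alpha> * \<beta> * (24 * U G ^ 2 + 28)) 
       \<le> (\<Sum>v\<in>A G. \<Sum>w\<in>B G. f G v w)"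
      using sum_mono[of "A G" "\<lambda>v. \<Sum>w\<in>B G. h G * (4 * U G ^ 3 * x G v w - (24 * U G ^ 2 + 28))" "\<lambda>v. \<Sum>w\<in>B G. f G v w"]
        f_ge by (simp add: sum_mono)
    \<comment> \<open>A switch lowers \<open>U\<close> by \<open>2 * x\<close>, and the normalised
      sum of \<open>x\<close> over all switches is \<open>U\<close> minus a term \<open>y\<close>
      due to the different sizes of \<open>A\<close> and \<open>B\<close>. So \<open>U\<close> is
      pulled towards 0, which is the source of the concentration.\<close>
    have 3: "U G ^ 4 - N * \<bar>U G\<bar> ^ 3 \<le> U G ^ 3 * (h G * (\<beta> * p G - \<alpha> * q G))"
    proof (cases "\<alpha> + \<beta> = 0")
      case True
      then have "U G = 0" using pq abn by (auto simp: U_def)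
      then show ?thesis by simp
    next
      case False
      then have pos: "\<alpha> + \<beta> > 0" using abn by auto
      define y where "y = (\<alpha> - \<beta>) * ((p G + q G) / (\<alpha> + \<beta>))"
      have hy: "h G * (\<beta> * p G - \<alpha> * q G) = U G - y"
        using pos by (simp add: h_def \<alpha>_def[symmetric] \<beta>_def[symmetric] y_def U_def field_simps)
      have "\<bar>y\<bar> \<le> N"
      proof -
        have "\<bar>\<alpha> - \<beta>\<bar> \<le> N" using N[of G] G by (simp add: \<alpha>_def \<beta>_def A_def B_def S_def)
        moreover have "\<bar>(p G + q G) / (\<alpha> + \<beta>)\<bar> \<le> 1" using pq pos by (simp add: abs_divide)
        ultimately have "\<bar>\<alpha> - \<beta>\<bar> * \<bar>(p G + q G) / (\<alpha> + \<beta>)\<bar> \<le> N * 1" using N0 by (intro mult_mono) auto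
        then show ?thesis by (simp add: y_def abs_mult)
      qed
      have "U G ^ 3 * y \<le> N * \<bar>U G\<bar> ^ 3"
      proof -
        have "U G ^ 3 * y \<le> \<bar>U G\<bar> ^ 3 * \<bar>y\<bar>" by (metis abs_ge_self abs_mult power_abs)
        also have "\<dots> \<le> \<bar>U G\<bar> ^ 3 * N" using \<open>\<bar>y\<bar> \<le> N\<close> by (intro mult_left_mono) auto
        finally show ?thesis by (simp add: mult.commute)
      qed
      moreover have "U G ^ 3 * U G = U G ^ 4" by (simp add: power4_eq_xxxx power3_eq_cube)
      ultimately show ?thesis by (simp only: hy) (simp add: right_diff_distrib)
    qed
    have 4: "h G * (\<alpha> * \<beta>) \<le> real n / 2"
    proof (cases "\<alpha> + \<beta> = 0")
      case True then show ?thesis by (simp add: h_def \<alpha>_def[symmetric] \<beta>_def[symmetric])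
    next
      case False
      then have pos: "\<alpha> + \<beta> > 0" using abn by auto
      have "4 * (\<alpha> * \<beta>) \<le> (\<alpha> + \<beta>) * (\<alpha> + \<beta>)" using sum_squares_bound[of \<alpha> \<beta>] by (simp add: power2_eq_square algebra_simps)
      also have "\<dots> \<le> real n * (\<alpha> + \<beta>)" using abn by (intro mult_right_mono) auto
      finally show ?thesis using pos by (simp add: h_def \<alpha>_def[symmetric] \<beta>_def[symmetric] field_simps)
    qed
    have 5: "N * \<bar>U G\<bar> ^ 3 \<le> U G ^ 4 / 4 + 7 * N ^ 4" 
      using young_3_1[OF N0, of "\<bar>U G\<bar>"] by simp
    have 6: "12 * real n * U G ^ 2 \<le> U G ^ 4 + 36 * real n ^ 2"
      using zero_le_power2[of "U G ^ 2 - 6 * real n"] by (simp add: power2_eq_square power4_eq_xxxx algebra_simps)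
    have 7: "h G * (\<alpha> * \<beta>) * (24 * U G ^ 2 + 28) \<le> real n / 2 * (24 * U G ^ 2 + 28)"
      using 4 by (intro mult_right_mono) auto
    have 8: "real n \<le> real n ^ 2" using n1 by (simp add: power2_eq_square)
    have "h G * (4 * U G ^ 3 * (\<beta> * p G - \<alpha> * q G) - \<alpha> * \<beta> * (24 * U G ^ 2 + 28))
      = 4 * (U G ^ 3 * (h G * (\<beta> * p G - \<alpha> * q G))) - h G * (\<alpha> * \<beta>) * (24 * U G ^ 2 + 28)"
      by (simp add: algebra_simps)
    also have "\<dots> \<ge> 4 * (U G ^ 4 - N * \<bar>U G\<bar> ^ 3) - real n / 2 * (24 * U G ^ 2 + 28)"
      by (intro diff_mono mult_left_mono 3 7) auto
    finally have "4 * (U G ^ 4 - N * \<bar>U G\<bar> ^ 3) - real n / 2 * (24 * U G ^ 2 + 28) \<le> (\<Sum>v\<in>A G. \<Sum>w\<in>B G. f G v w)"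
      using 2 by linarith
    moreover have "real n / 2 * (24 * U G ^ 2 + 28) = 12 * real n * U G ^ 2 + 14 * real n" by (simp add: algebra_simps)
    moreover have "2 * u4 - 28 * N4 - 50 * n2 \<le> S1"
      if "4 * (u4 - nu) - m \<le> S1" "m = nu2 + 14 * nn" "nu \<le> u4 / 4 + 7 * N4" "nu2 \<le> u4 + 36 * n2" "nn \<le> n2"
      for u4 N4 n2 S1 nu m nu2 nn :: real
      using that by argo
    ultimately show ?thesis using 5 6 8 by blast
  qed
  have "(\<Sum>G\<in>S. 2 * U G ^ 4 - 28 * N ^ 4 - 50 * real n ^ 2) \<le> (\<Sum>G\<in>S. \<Sum>v\<in>A G. \<Sum>w\<in>B G. f G v w)"
    by (rule sum_mono) (rule pt)
  then have "(\<Sum>G\<in>S. 2 * U G ^ 4 - 28 * N ^ 4 - 50 * real n ^ 2) \<le> 0" using f0 by simp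
  then have "avg S (\<lambda>G. 2 * U G ^ 4 - 28 * N ^ 4 - 50 * real n ^ 2) \<le> 0" by (simp add: avg_def divide_nonpos_nonneg)
  moreover have "finite S" "S \<noteq> {}" using ne by (auto simp: S_def finite_Om)
  ultimately have "2 * avg S (\<lambda>G. U G ^ 4) - 28 * N ^ 4 - 50 * real n ^ 2 \<le> 0"
    by (simp add: avg_diff avg_cmult avg_const)
  then show ?thesis unfolding U_def p_def q_def A_def B_def C_def S_def by simp
qed

subsection \<open>Concentration of codegrees\<close>

lemma sum_power2_le:
  fixes z :: "'i \<Rightarrow> real"
  assumes "finite I"
  shows "(\<Sum>i\<in>I. z i) ^ 2 \<le> real (card I) * (\<Sum>i\<in>I. z i ^ 2)"
proof (cases "I = {}")
  case False
  define c T where "c = real (card I)" and "T = (\<Sum>i\<in>I. z i)"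
  have c: "c > 0" using assms False by (simp add: c_def card_gt_0_iff)
  have "0 \<le> (\<Sum>i\<in>I. (c * z i - T)\<^sup>2)" by (simp add: sum_nonneg)
  also have "\<dots> = (\<Sum>i\<in>I. c\<^sup>2 * (z i)\<^sup>2 - 2 * c * T * z i + T\<^sup>2)"
    by (simp add: power2_eq_square algebra_simps)
  also have "\<dots> = c\<^sup>2 * (\<Sum>i\<in>I. (z i)\<^sup>2) - 2 * c * T * T + c * T\<^sup>2"
    by (simp add: sum.distrib sum_subtractf sum_distrib_left[symmetric] c_def T_def)
  finally have "0 \<le> c * (c * (\<Sum>i\<in>I. (z i)\<^sup>2) - T\<^sup>2)" by (simp add: power2_eq_square algebra_simps)
  then show ?thesis using c by (simp add: zero_le_mult_iff c_def T_def)
qed simp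

lemma sum_power4_le:
  fixes z :: "'i \<Rightarrow> real"
  assumes "finite I"
  shows "(\<Sum>i\<in>I. z i) ^ 4 \<le> real (card I) ^ 3 * (\<Sum>i\<in>I. z i ^ 4)"
proof -
  have "(\<Sum>i\<in>I. z i) ^ 4 = ((\<Sum>i\<in>I. z i) ^ 2) ^ 2" by simp
  also have "\<dots> \<le> (real (card I) * (\<Sum>i\<in>I. z i ^ 2)) ^ 2"
    using sum_power2_le[OF assms] by (intro power_mono) auto
  also have "\<dots> = real (card I) ^ 2 * (\<Sum>i\<in>I. z i ^ 2) ^ 2" by (simp add: power_mult_distrib)
  also have "\<dots> \<le> real (card I) ^ 2 * (real (card I) * (\<Sum>i\<in>I. (z i ^ 2) ^ 2))"
    by (intro mult_left_mono sum_power2_le[OF assms]) auto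
  finally show ?thesis by (simp add: power2_eq_square power3_eq_cube power4_eq_xxxx mult_ac)
qed

lemma power4_add_le: "(x + y) ^ 4 \<le> 8 * x ^ 4 + 8 * (y::real) ^ 4"
proof -
  have 1: "(x + y)\<^sup>2 \<le> 2 * (x\<^sup>2 + y\<^sup>2)" using sum_squares_bound[of x y] by (simp add: power2_sum)
  have "(x + y) ^ 4 = ((x + y)\<^sup>2)\<^sup>2" by simp
  also have "\<dots> \<le> (2 * (x\<^sup>2 + y\<^sup>2))\<^sup>2" using 1 by (intro power_mono) auto
  also have "\<dots> = 4 * (x\<^sup>2 + y\<^sup>2)\<^sup>2" by (simp add: power2_eq_square algebra_simps)
  also have "\<dots> \<le> 4 * (2 * ((x\<^sup>2)\<^sup>2 + (y\<^sup>2)\<^sup>2))"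
    using sum_squares_bound[of "x\<^sup>2" "y\<^sup>2"] by (simp add: power2_sum)
  finally show ?thesis by simp
qed

lemma power4_le_of_abs:
  fixes x y z :: real
  assumes "\<bar>x\<bar> \<le> y + \<bar>z\<bar>" shows "x ^ 4 \<le> 8 * y ^ 4 + 8 * z ^ 4"
proof -
  have "x ^ 4 = \<bar>x\<bar> ^ 4" by simp
  also have "\<dots> \<le> (y + \<bar>z\<bar>) ^ 4" using assms by (intro power_mono) auto
  also have "\<dots> \<le> 8 * y ^ 4 + 8 * \<bar>z\<bar> ^ 4" by (rule power4_add_le)
  finally show ?thesis by simp
qed

text \<open>If \<open>\<alpha> + \<beta>\<close> falls below \<open>D0 / 2\<close>, the ratio is
  still at most 1, and the fourth-power term is then at least 1. Hence a fourth moment of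
  \<open>\<alpha> + \<beta>\<close> controls the exceptional matrices without a case distinction
  under the average.\<close>

lemma ratio_le:
  fixes \<alpha> \<beta> B D0 :: real
  assumes "\<alpha> \<ge> 0" "\<beta> \<ge> 0" "\<bar>\<alpha> - \<beta>\<bar> \<le> B" "D0 > 0"
  shows "\<bar>(\<alpha> - \<beta>) / (\<alpha> + \<beta>)\<bar> \<le> 2 * B / D0 + 16 * (\<alpha> + \<beta> - D0) ^ 4 / D0 ^ 4"
proof (cases "\<alpha> + \<beta> \<ge> D0 / 2")
  case True
  have "\<bar>(\<alpha> - \<beta>) / (\<alpha> + \<beta>)\<bar> = \<bar>\<alpha> - \<beta>\<bar> / (\<alpha> + \<beta>)" using assms by (simp add: abs_divide)
  also have "\<dots> \<le> B / (D0 / 2)" using assms True by (intro frac_le) auto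
  finally have "\<bar>(\<alpha> - \<beta>) / (\<alpha> + \<beta>)\<bar> \<le> 2 * B / D0" by (simp add: mult.commute)
  moreover have "16 * (\<alpha> + \<beta> - D0) ^ 4 / D0 ^ 4 \<ge> 0" by simp
  ultimately show ?thesis by linarith
next
  case False
  have "\<bar>(\<alpha> - \<beta>) / (\<alpha> + \<beta>)\<bar> \<le> 1"
    using assms by (cases "\<alpha> + \<beta> = 0") (auto simp: abs_divide divide_simps)
  moreover have "1 \<le> (2 * (D0 - (\<alpha> + \<beta>)) / D0) ^ 4"
    using False assms by (intro one_le_power) (auto simp: field_simps)
  moreover have "(2 * (D0 - (\<alpha> + \<beta>)) / D0) ^ 4 = 16 * (\<alpha> + \<beta> - D0) ^ 4 / D0 ^ 4"
  proof -
    have "(D0 - (\<alpha> + \<beta>)) ^ 4 = (\<alpha> + \<beta> - D0) ^ 4"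
      using power_even_eq[of "D0 - (\<alpha> + \<beta>)" 2] power_even_eq[of "\<alpha> + \<beta> - D0" 2] by (simp add: power2_commute)
    then show ?thesis unfolding power_divide power_mult_distrib by simp
  qed
  moreover have "2 * B / D0 \<ge> 0" using assms by simp
  ultimately show ?thesis by linarith
qed

text \<open>Summing \<open>s_dev\<close> would give a bound for the total that is weaker than
  \<open>total\<close> by a factor \<open>r\<close>. The sharper form enters through
  \<open>bd_sig\<close> whenever cell probabilities are summed over a column.\<close>

locale near_regular = scale \<theta> r for \<theta> r :: real +
  fixes n :: nat and s t :: "nat \<Rightarrow> nat" and l :: real
  assumes rn: "real n = r ^ 2"
    and l_ge: "1 / \<theta> \<le> l" and l_le: "l \<le> 1 - 1 / \<theta>"
    and s_dev: "a < n \<Longrightarrow> \<bar>real (s a) - l * real n\<bar> \<le> \<theta> * r"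
    and t_dev: "a < n \<Longrightarrow> \<bar>real (t a) - l * real n\<bar> \<le> \<theta> * r"
    and total: "\<bar>(\<Sum>a<n. real (s a)) - l * real n ^ 2\<bar> \<le> \<theta> * real n"
    and sum_eq: "(\<Sum>a<n. s a) = (\<Sum>a<n. t a)"
begin

abbreviation Omega where "Omega \<equiv> Om n s t"
abbreviation pr where "pr F Q a v \<equiv> avg (Omega F Q) (\<lambda>G. of_bool ((a,v) \<in> G))"
abbreviation q where "q \<equiv> l * (1 - l)"

text \<open>The parameter \<open>k\<close> is the number of cells that have been frozen by conditioning.\<close>

definition cls :: "nat \<Rightarrow> (nat \<times> nat) set \<Rightarrow> (nat \<times> nat) set \<Rightarrow> bool" where
  "cls k F Q \<longleftrightarrow> F \<subseteq> {..<n} \<times> {..<n} \<and> Q \<subseteq> F \<and> card Q \<le> k \<and> Omega F Q \<noteq> {}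
    \<and> (\<forall>a<n. real (card (rw F a)) \<le> \<theta> * r + real k)
    \<and> (\<forall>v<n. real (card (cl F v)) \<le> \<theta> * r + real k)
    \<and> real (card F) \<le> \<theta> * real n + real k"

lemma l_bounds: "0 < l" "l < 1" "0 \<le> l" "l \<le> 1"
proof -
  have "1 / \<theta> > 0" using theta_pos by simp
  then show "0 < l" "l < 1" "0 \<le> l" "l \<le> 1" using l_ge l_le by linarith+
qed

lemma theta_r: "\<theta> * r \<ge> 10000" "r \<ge> 10000"
proof -
  have "\<theta> ^ 2 \<le> \<theta> ^ 100" using theta_pos by (intro power_increasing) auto
  moreover have "\<theta> ^ 2 \<ge> 100 ^ 2" using theta_ge by (intro power_mono) auto
  ultimately show "r \<ge> 10000" using r_ge by simp
  then show "\<theta> * r \<ge> 10000" using theta_ge mult_mono[of 1 \<theta> 10000 r] by simp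
qed

lemma n_ge: "real n \<ge> 10000 * r" "real n \<ge> 10000"
proof -
  have "10000 * r \<le> r * r" using theta_r r_pos by (intro mult_right_mono) auto
  then show "real n \<ge> 10000 * r" by (simp add: rn power2_eq_square)
  then show "real n \<ge> 10000" using theta_r by linarith
qed

lemma q_ge: "2 * q \<ge> 1 / \<theta>" "q > 0" "q \<le> 1"
proof -
  have "q - 1/\<theta> * (1 - 1/\<theta>) = (l - 1/\<theta>) * ((1 - 1/\<theta>) - l)" by (simp add: algebra_simps)
  also have "\<dots> \<ge> 0" using l_ge l_le by (intro mult_nonneg_nonneg) auto
  finally have 1: "q \<ge> 1/\<theta> * (1 - 1/\<theta>)" by linarith
  have "1/\<theta> * (1/2) \<le> 1/\<theta> * (1 - 1/\<theta>)" using theta_ge by (intro mult_left_mono) (auto simp: field_simps)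
  then show "2 * q \<ge> 1 / \<theta>" using 1 by argo
  show "q > 0" using l_bounds by simp
  show "q \<le> 1" using l_bounds by (simp add: mult_le_one)
qed

lemma D0_ge: "2 * q * real n \<ge> real n / \<theta>"
  using mult_right_mono[OF q_ge(1), of "real n"] by simp

lemma clsD:
  assumes "cls k F Q"
  shows "F \<subseteq> {..<n} \<times> {..<n}" "Q \<subseteq> F" "card Q \<le> k" "Omega F Q \<noteq> {}" "finite F"
    "a < n \<Longrightarrow> real (card (rw F a)) \<le> \<theta> * r + real k"
    "a < n \<Longrightarrow> real (card (cl F a)) \<le> \<theta> * r + real k"
    "real (card F) \<le> \<theta> * real n + real k"
  using assms finite_subset[of F "{..<n} \<times> {..<n}"] by (auto simp: cls_def)

lemma frozen2_le:
  assumes "cls k F Q" "k \<le> 10" "a < n" "b < n"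
  shows "real (card (frozen2 F a b)) \<le> 3 * \<theta> * r"
proof -
  have "real (card (frozen2 F a b)) \<le> real (card (rw F a)) + real (card (rw F b))"
    using card_Un_le[of "rw F a" "rw F b"] by linarith
  then show ?thesis using clsD(6)[OF assms(1,3)] clsD(6)[OF assms(1,4)] assms(2) theta_r by linarith
qed

lemma only_diff:
  assumes "cls k F Q" "k \<le> 10" "a < n" "b < n" "G \<in> Omega F Q"
  shows "\<bar>real (card (only n F a b G)) - real (card (only n F b a G))\<bar> \<le> 5 * \<theta> * r"
  using only_diff_le[OF assms(5,3,4) clsD(5)[OF assms(1)]] frozen2_le[OF assms(1-4)]
    s_dev[OF assms(3)] s_dev[OF assms(4)] by linarith

lemma cod_diff_moment:
  assumes "cls k F Q" "k \<le> 10" "a < n" "b < n" "c \<noteq> a" "c \<noteq> b"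
  shows "avg (Omega F Q) (\<lambda>G. (cod G a c - cod G b c) ^ 4) \<le> \<theta> ^ 7 * r ^ 4"
proof (cases "a = b")
  case True then show ?thesis using theta_pos r_pos by (simp add: avg_def)
next
  case False
  let ?U = "\<lambda>G. real (card (only n F a b G \<inter> rw G c)) - real (card (only n F b a G \<inter> rw G c))"
  have ne: "Omega F Q \<noteq> {}" using assms(1) by (rule clsD)
  have "avg (Omega F Q) (\<lambda>G. (cod G a c - cod G b c) ^ 4) \<le> avg (Omega F Q) (\<lambda>G. 8 * (3 * \<theta> * r) ^ 4 + 8 * ?U G ^ 4)"
  proof (rule avg_mono)
    fix G assume G: "G \<in> Omega F Q"
    show "(cod G a c - cod G b c) ^ 4 \<le> 8 * (3 * \<theta> * r) ^ 4 + 8 * ?U G ^ 4"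
      using cod_diff_le[OF G clsD(5)[OF assms(1)], of a c b] frozen2_le[OF assms(1-4)]
      by (intro power4_le_of_abs) linarith
  qed
  also have "\<dots> = 8 * (3 * \<theta> * r) ^ 4 + 8 * avg (Omega F Q) (\<lambda>G. ?U G ^ 4)"
    using ne by (simp add: avg_add avg_cmult avg_const finite_Om)
  also have "avg (Omega F Q) (\<lambda>G. ?U G ^ 4) \<le> 14 * (5 * \<theta> * r) ^ 4 + 25 * real n ^ 2"
    using assms False ne only_diff[OF assms(1-4)] by (intro fourth_moment) auto
  \<comment> \<open>Here \<open>70648 = 8 * 81 + 8 * 14 * 625\<close> and
    \<open>200 = 8 * 25\<close>; three further powers of \<open>\<theta>\<close> absorb
    them.\<close>
  finally have "avg (Omega F Q) (\<lambda>G. (cod G a c - cod G b c) ^ 4) \<le> (70648 * \<theta> ^ 4 + 200) * r ^ 4"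
    by (simp add: rn power_mult_distrib algebra_simps)
  also have "\<dots> \<le> \<theta> ^ 7 * r ^ 4"
  proof (intro mult_right_mono)
    have a1: "\<theta> ^ 4 \<ge> 1" using theta_pos by (intro one_le_power) auto
    have "\<theta> ^ 3 \<ge> 100 ^ 3" using theta_ge by (intro power_mono) auto
    then have "\<theta> ^ 4 * \<theta> ^ 3 \<ge> \<theta> ^ 4 * 1000000" using theta_pos by (intro mult_left_mono) auto
    moreover have "\<theta> ^ 7 = \<theta> ^ 4 * \<theta> ^ 3" by (simp add: power_add[symmetric])
    ultimately show "70648 * \<theta> ^ 4 + 200 \<le> \<theta> ^ 7" using a1 by linarith
  qed (use r_pos in auto)
  finally show ?thesis .
qed

text \<open>Double counting of the entries in the columns that row \<open>c\<close> meets; given row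
  \<open>c\<close>, the column sums determine their number.\<close>

lemma sum_cod:
  assumes "G \<in> Omega F Q" "c < n"
  shows "(\<Sum>b\<in>{..<n}-{c}. cod G b c) = (\<Sum>v\<in>rw G c. real (t v)) - real (s c)"
proof -
  have G: "G \<subseteq> {..<n} \<times> {..<n}" and tv: "\<And>v. v < n \<Longrightarrow> card (cl G v) = t v" and sc: "card (rw G c) = s c"
    using assms by (auto simp: Om_def)
  have fin: "finite (rw G c)" using finite_rw[OF G] .
  have "(\<Sum>b<n. card (rw G b \<inter> rw G c)) = (\<Sum>b<n. \<Sum>v\<in>rw G c. of_bool ((b,v) \<in> G))"
  proof (intro sum.cong refl)
    fix b
    have "(\<Sum>v\<in>rw G c. of_bool ((b,v) \<in> G) :: nat) = card {v \<in> rw G c. (b,v) \<in> G}"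
      using fin by (simp add: of_bool_def sum.If_cases Int_def)
    also have "{v \<in> rw G c. (b,v) \<in> G} = rw G b \<inter> rw G c" by auto
    finally show "card (rw G b \<inter> rw G c) = (\<Sum>v\<in>rw G c. of_bool ((b,v) \<in> G))" by simp
  qed
  also have "\<dots> = (\<Sum>v\<in>rw G c. \<Sum>b<n. of_bool ((b,v) \<in> G))" by (rule sum.swap)
  also have "\<dots> = (\<Sum>v\<in>rw G c. t v)"
  proof (intro sum.cong refl)
    fix v assume "v \<in> rw G c"
    then have v: "v < n" using G by auto
    have "(\<Sum>b<n. of_bool ((b,v) \<in> G) :: nat) = card {b. b < n \<and> (b,v) \<in> G}"
      by (simp add: of_bool_def sum.If_cases Int_def)
    also have "{b. b < n \<and> (b,v) \<in> G} = cl G v" using G by auto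
    finally show "(\<Sum>b<n. of_bool ((b,v) \<in> G)) = t v" using tv[OF v] by simp
  qed
  finally have "real (\<Sum>b<n. card (rw G b \<inter> rw G c)) = real (\<Sum>v\<in>rw G c. t v)" by (simp only:)
  then have "(\<Sum>b<n. cod G b c) = (\<Sum>v\<in>rw G c. real (t v))" by simp
  then show ?thesis using assms(2) sc by (simp add: sum_diff1)
qed

text \<open>The average of the codegrees with \<open>c\<close> over all other rows is
  \<open>l^2 * n\<close> up to order \<open>r\<close> in every matrix, by \<open>sum_cod\<close>.
  The power mean inequality then turns the fourth moments of the differences into one of the
  deviation itself.\<close>

lemma cod_moment:
  assumes "cls k F Q" "k \<le> 10" "a < n" "c < n" "c \<noteq> a"
  shows "avg (Omega F Q) (\<lambda>G. (cod G a c - l\<^sup>2 * real n) ^ 4) \<le> \<theta> ^ 8 * r ^ 4"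
proof -
  define m where "m = real n - 1"
  define I where "I = {..<n} - {c}"
  have m: "m > 0" "4 * m \<ge> 3 * real n" using n_ge by (auto simp: m_def)
  have cI: "real (card I) = m" using assms by (simp add: I_def m_def of_nat_diff)
  have fI: "finite I" by (simp add: I_def)
  have ne: "Omega F Q \<noteq> {}" using assms(1) by (rule clsD)
  have "avg (Omega F Q) (\<lambda>G. (cod G a c - l\<^sup>2 * real n) ^ 4)
    \<le> avg (Omega F Q) (\<lambda>G. 8 * (4 * \<theta> * r) ^ 4 + (8 / m) * (\<Sum>b\<in>I. (cod G a c - cod G b c) ^ 4))"
  proof (rule avg_mono)
    fix G assume G: "G \<in> Omega F Q"
    have Gs: "G \<subseteq> {..<n} \<times> {..<n}" and sc: "card (rw G c) = s c" using G assms by (auto simp: Om_def)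
    define y where "y = (\<Sum>b\<in>I. cod G a c - cod G b c)"
    define e where "e = (\<Sum>v\<in>rw G c. real (t v)) - real (s c) - m * (l\<^sup>2 * real n)"
    have y: "y = m * cod G a c - (\<Sum>v\<in>rw G c. real (t v)) + real (s c)"
      using sum_cod[OF G assms(4)] by (simp add: y_def sum_subtractf cI[symmetric] I_def)
    have ye: "cod G a c - l\<^sup>2 * real n = (y + e) / m" using m by (simp add: y e_def field_simps)
    have sle: "real (s c) \<le> real n"
      using sc card_mono[OF _ rw_subset[OF Gs, of c]] by simp
    have e1: "\<bar>e\<bar> \<le> 3 * \<theta> * r * real n"
    proof -
      have "e = (\<Sum>v\<in>rw G c. real (t v) - l * real n) + l * real n * (real (s c) - l * real n) + (l\<^sup>2 * real n - real (s c))"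
        using sc by (simp add: e_def sum_subtractf m_def power2_eq_square algebra_simps)
      moreover have "\<bar>\<Sum>v\<in>rw G c. real (t v) - l * real n\<bar> \<le> real n * (\<theta> * r)"
      proof -
        have "\<bar>\<Sum>v\<in>rw G c. real (t v) - l * real n\<bar> \<le> (\<Sum>v\<in>rw G c. \<theta> * r)"
          using t_dev rw_subset[OF Gs, of c] by (intro order_trans[OF sum_abs] sum_mono) auto
        also have "\<dots> = real (s c) * (\<theta> * r)" using sc by simp
        also have "\<dots> \<le> real n * (\<theta> * r)" using sle theta_r by (intro mult_right_mono) auto
        finally show ?thesis .
      qed
      moreover have "\<bar>l * real n * (real (s c) - l * real n)\<bar> \<le> real n * (\<theta> * r)"
      proof -
        have "\<bar>l * real n * (real (s c) - l * real n)\<bar> = (l * real n) * \<bar>real (s c) - l * real n\<bar>"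
          using l_bounds by (simp add: abs_mult)
        also have "\<dots> \<le> real n * (\<theta> * r)"
          using l_bounds s_dev[OF assms(4)] by (intro mult_mono) (auto simp: mult_left_le_one_le)
        finally show ?thesis .
      qed
      moreover have "\<bar>l\<^sup>2 * real n - real (s c)\<bar> \<le> real n"
      proof -
        have "0 \<le> l\<^sup>2 * real n" "l\<^sup>2 * real n \<le> real n" using l_bounds by (simp_all add: mult_left_le_one_le power_le_one)
        then show ?thesis using sle by linarith
      qed
      moreover have "real n \<le> real n * (\<theta> * r)" using theta_r n_ge by (simp add: mult_le_cancel_left1)
      ultimately show ?thesis by (simp add: algebra_simps)
    qed
    have e2: "\<bar>e / m\<bar> \<le> 4 * \<theta> * r"
    proof -
      have "3 * \<theta> * r * real n \<le> 4 * \<theta> * r * m" using m mult_left_mono[OF m(2), of "\<theta> * r"] theta_r by (simp add: algebra_simps)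
      then show ?thesis using e1 m by (simp add: abs_divide divide_le_eq)
    qed
    have "(cod G a c - l\<^sup>2 * real n) ^ 4 \<le> 8 * (4 * \<theta> * r) ^ 4 + 8 * (y / m) ^ 4"
      unfolding ye add_divide_distrib using e2 by (intro power4_le_of_abs) linarith
    also have "(y / m) ^ 4 \<le> (m ^ 3 * (\<Sum>b\<in>I. (cod G a c - cod G b c) ^ 4)) / m ^ 4"
      using sum_power4_le[OF fI, of "\<lambda>b. cod G a c - cod G b c"] m
      unfolding cI y_def power_divide by (intro divide_right_mono) auto
    also have "\<dots> = (1 / m) * (\<Sum>b\<in>I. (cod G a c - cod G b c) ^ 4)"
      using m by (simp add: power4_eq_xxxx power3_eq_cube)
    finally show "(cod G a c - l\<^sup>2 * real n) ^ 4 \<le> 8 * (4 * \<theta> * r) ^ 4 + (8 / m) * (\<Sum>b\<in>I. (cod G a c - cod G b c) ^ 4)"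
      by simp
  qed
  also have "\<dots> = 8 * (4 * \<theta> * r) ^ 4 + (8 / m) * (\<Sum>b\<in>I. avg (Omega F Q) (\<lambda>G. (cod G a c - cod G b c) ^ 4))"
    using ne by (simp only: avg_add avg_cmult avg_sum avg_const finite_Om not_False_eq_True)
  also have "(\<Sum>b\<in>I. avg (Omega F Q) (\<lambda>G. (cod G a c - cod G b c) ^ 4)) \<le> (\<Sum>b\<in>I. \<theta> ^ 7 * r ^ 4)"
    using assms by (intro sum_mono cod_diff_moment[OF assms(1-3)]) (auto simp: I_def)
  also have "\<dots> = m * (\<theta> ^ 7 * r ^ 4)" using cI by simp
  finally have "avg (Omega F Q) (\<lambda>G. (cod G a c - l\<^sup>2 * real n) ^ 4) \<le> 8 * (4 * \<theta> * r) ^ 4 + (8 / m) * (m * (\<theta> ^ 7 * r ^ 4))"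
    using m by (simp add: mult_left_mono divide_right_mono)
  also have "\<dots> = (2048 * \<theta> ^ 4 + 8 * \<theta> ^ 7) * r ^ 4"
    using m by (simp add: power_mult_distrib algebra_simps)
  also have "\<dots> \<le> \<theta> ^ 8 * r ^ 4"
  proof (intro mult_right_mono)
    have "\<theta> ^ 3 \<ge> 100 ^ 3" using theta_ge by (intro power_mono) auto
    then have "\<theta> ^ 4 * \<theta> ^ 3 \<ge> \<theta> ^ 4 * 1000000" using theta_pos by (intro mult_left_mono) auto
    moreover have "\<theta> ^ 7 = \<theta> ^ 4 * \<theta> ^ 3" by (simp add: power_add[symmetric])
    moreover have "\<theta> ^ 8 = \<theta> * \<theta> ^ 7" by (simp flip: power_Suc)
    moreover have "100 * \<theta> ^ 7 \<le> \<theta> * \<theta> ^ 7" using theta_ge by (intro mult_right_mono) auto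
    moreover have "\<theta> ^ 4 \<ge> 0" by simp
    ultimately show "2048 * \<theta> ^ 4 + 8 * \<theta> ^ 7 \<le> \<theta> ^ 8" by linarith
  qed (use r_pos in auto)
  finally show ?thesis .
qed

text \<open>Apart from frozen columns, \<open>\<alpha> + \<beta>\<close> is \<open>s a + s b\<close>
  minus twice the codegree, and \<open>2 * l - 2 * l^2 = 2 * q\<close>.\<close>

lemma only_sum_eq:
  assumes "cls k F Q" "k \<le> 10" "a < n" "b < n" "G \<in> Omega F Q"
  shows "\<bar>real (card (only n F a b G)) + real (card (only n F b a G)) - 2 * q * real n\<bar>
    \<le> 5 * \<theta> * r + \<bar>2 * (cod G a b - l\<^sup>2 * real n)\<bar>"
proof -
  have Gs: "G \<subseteq> {..<n} \<times> {..<n}" using assms by (auto simp: Om_def)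
  let ?U = "frozen2 F a b"
  have fU: "finite ?U" using finite_rw[OF clsD(1)[OF assms(1)]] by simp
  have sw: "rw G b \<inter> rw G a \<inter> free2 n F b a = rw G a \<inter> rw G b \<inter> free2 n F a b" "rw F b \<union> rw F a = ?U"
    by (auto simp: free2_def)
  have sub: "rw G a \<inter> rw G b \<subseteq> {..<n}" using rw_subset[OF Gs] by auto
  have "card (rw G a \<inter> rw G b \<inter> ?U) \<le> card (rw G a \<inter> ?U)" "card (rw G a \<inter> rw G b \<inter> ?U) \<le> card (rw G b \<inter> ?U)"
    using fU by (auto intro!: card_mono)
  moreover have "card (rw G a \<inter> ?U) + card (rw G b \<inter> ?U) \<le> card ?U + card (rw G a \<inter> rw G b \<inter> ?U)"
  proof -
    have "card (rw G a \<inter> ?U) + card (rw G b \<inter> ?U) = card ((rw G a \<inter> ?U) \<union> (rw G b \<inter> ?U)) + card ((rw G a \<inter> ?U) \<inter> (rw G b \<inter> ?U))"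
      using fU by (intro card_Un_Int) auto
    moreover have "card ((rw G a \<inter> ?U) \<union> (rw G b \<inter> ?U)) \<le> card ?U" using fU by (intro card_mono) auto
    moreover have "(rw G a \<inter> ?U) \<inter> (rw G b \<inter> ?U) = rw G a \<inter> rw G b \<inter> ?U" by auto
    ultimately show ?thesis by simp
  qed
  ultimately have "0 \<le> real (card (rw G a \<inter> ?U)) + real (card (rw G b \<inter> ?U)) - 2 * real (card (rw G a \<inter> rw G b \<inter> ?U))"
    "real (card (rw G a \<inter> ?U)) + real (card (rw G b \<inter> ?U)) - 2 * real (card (rw G a \<inter> rw G b \<inter> ?U)) \<le> real (card ?U)"
    by linarith+
  then show ?thesis
    using card_only[OF assms(5,3), of F b] card_only[OF assms(5,4), of F a] card_split_frozen[OF sub, of F a b]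
      frozen2_le[OF assms(1-4)] s_dev[OF assms(3)] s_dev[OF assms(4)]
    unfolding sw by (simp add: algebra_simps power2_eq_square)
qed

lemma only_sum_moment:
  assumes "cls k F Q" "k \<le> 10" "a < n" "b < n" "a \<noteq> b"
  shows "avg (Omega F Q) (\<lambda>G. (real (card (only n F a b G)) + real (card (only n F b a G)) - 2 * q * real n) ^ 4)
    \<le> \<theta> ^ 10 * r ^ 4"
proof -
  have ne: "Omega F Q \<noteq> {}" using assms(1) by (rule clsD)
  have "avg (Omega F Q) (\<lambda>G. (real (card (only n F a b G)) + real (card (only n F b a G)) - 2 * q * real n) ^ 4)
    \<le> avg (Omega F Q) (\<lambda>G. 8 * (5 * \<theta> * r) ^ 4 + 128 * (cod G a b - l\<^sup>2 * real n) ^ 4)"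
  proof (rule avg_mono)
    fix G assume G: "G \<in> Omega F Q"
    show "(real (card (only n F a b G)) + real (card (only n F b a G)) - 2 * q * real n) ^ 4
      \<le> 8 * (5 * \<theta> * r) ^ 4 + 128 * (cod G a b - l\<^sup>2 * real n) ^ 4"
      using power4_le_of_abs[OF only_sum_eq[OF assms(1-4) G]] unfolding power_mult_distrib by simp
  qed
  also have "\<dots> = 8 * (5 * \<theta> * r) ^ 4 + 128 * avg (Omega F Q) (\<lambda>G. (cod G a b - l\<^sup>2 * real n) ^ 4)"
    using ne by (simp add: avg_add avg_cmult avg_const finite_Om)
  also have "\<dots> \<le> 8 * (5 * \<theta> * r) ^ 4 + 128 * (\<theta> ^ 8 * r ^ 4)"
    using cod_moment[OF assms(1-4)] assms(5) by simp
  also have "\<dots> = (5000 * \<theta> ^ 4 + 128 * \<theta> ^ 8) * r ^ 4" by (simp add: power_mult_distrib algebra_simps)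
  also have "\<dots> \<le> \<theta> ^ 10 * r ^ 4"
  proof (intro mult_right_mono)
    have "\<theta> ^ 2 \<ge> 100 ^ 2" using theta_ge by (intro power_mono) auto
    then have "\<theta> ^ 8 * \<theta> ^ 2 \<ge> \<theta> ^ 8 * 10000" using theta_pos by (intro mult_left_mono) auto
    moreover have "\<theta> ^ 10 = \<theta> ^ 8 * \<theta> ^ 2" by (simp add: power_add[symmetric])
    moreover have "\<theta> ^ 4 \<le> \<theta> ^ 8" using theta_pos by (intro power_increasing) auto
    moreover have "\<theta> ^ 8 \<ge> 0" by simp
    ultimately show "5000 * \<theta> ^ 4 + 128 * \<theta> ^ 8 \<le> \<theta> ^ 10" by linarith
  qed (use r_pos in auto)
  finally show ?thesis .
qed

end

subsection \<open>Cell probabilities to first order\<close>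

text \<open>With \<open>W = D1 - D\<close> one has
  \<open>1 / D = 1 / D1 + W / D1 ^ 2 + W ^ 2 / (D1 ^ 2 * D)\<close>. The remainder is treated as in
  \<open>ratio_le\<close>: for small \<open>D\<close> the ratio is at most 1, and a factor
  \<open>4 * W ^ 2 / D1 ^ 2\<close>, at least 1, is spent.\<close>

lemma expansion_le:
  fixes \<alpha> \<beta> B D1 :: real
  assumes "\<alpha> \<ge> 0" "\<beta> \<ge> 0" "\<alpha> + \<beta> > 0" "\<bar>\<alpha> - \<beta>\<bar> \<le> B" "D1 > 0"
  shows "\<bar>(\<alpha> - \<beta>) / (\<alpha> + \<beta>) - (\<alpha> - \<beta>) / D1 - (\<alpha> - \<beta>) * (D1 - (\<alpha> + \<beta>)) / D1 ^ 2\<bar>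
    \<le> 2 * B / D1 ^ 3 * (D1 - (\<alpha> + \<beta>)) ^ 2 + 4 / D1 ^ 4 * (D1 - (\<alpha> + \<beta>)) ^ 4"
proof -
  define D W where "D = \<alpha> + \<beta>" and "W = D1 - D"
  have pos: "D > 0" using assms by (simp add: D_def)
  have "(\<alpha> - \<beta>) / D - (\<alpha> - \<beta>) / D1 - (\<alpha> - \<beta>) * W / D1 ^ 2 = ((\<alpha> - \<beta>) / D) * (W ^ 2 / D1 ^ 2)"
    using pos assms by (simp add: W_def field_simps power2_eq_square)
  moreover have "\<bar>((\<alpha> - \<beta>) / D) * (W ^ 2 / D1 ^ 2)\<bar> \<le> 2 * B / D1 ^ 3 * W ^ 2 + 4 / D1 ^ 4 * W ^ 4"
  proof (cases "D \<ge> D1 / 2")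
    case True
    have "\<bar>(\<alpha> - \<beta>) / D\<bar> = \<bar>\<alpha> - \<beta>\<bar> / D" using pos by (simp add: abs_divide)
    also have "\<dots> \<le> B / (D1 / 2)" using assms True by (intro frac_le) auto
    finally have "\<bar>(\<alpha> - \<beta>) / D\<bar> * (W ^ 2 / D1 ^ 2) \<le> B / (D1 / 2) * (W ^ 2 / D1 ^ 2)"
      by (intro mult_right_mono) auto
    also have "\<dots> = 2 * B / D1 ^ 3 * W ^ 2" using assms by (simp add: power3_eq_cube power2_eq_square mult_ac)
    also have "\<dots> \<le> 2 * B / D1 ^ 3 * W ^ 2 + 4 / D1 ^ 4 * W ^ 4" by simp
    finally show ?thesis by (simp add: abs_mult)
  next
    case False
    have "\<bar>(\<alpha> - \<beta>) / D\<bar> \<le> 1" using assms pos by (auto simp: abs_divide divide_simps D_def)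
    then have "\<bar>(\<alpha> - \<beta>) / D\<bar> * (W ^ 2 / D1 ^ 2) \<le> 1 * (W ^ 2 / D1 ^ 2)" by (intro mult_right_mono) auto
    also have "\<dots> \<le> (W ^ 2 / D1 ^ 2) * (4 * (W ^ 2 / D1 ^ 2))"
    proof -
      have "1 \<le> (2 * W / D1) ^ 2" using False assms by (intro one_le_power) (auto simp: W_def field_simps)
      then have "1 \<le> 4 * (W ^ 2 / D1 ^ 2)" by (simp add: power_divide power_mult_distrib)
      then show ?thesis using mult_left_mono[of 1 "4 * (W ^ 2 / D1 ^ 2)" "W ^ 2 / D1 ^ 2"] by simp
    qed
    also have "\<dots> = 4 / D1 ^ 4 * W ^ 4" by (simp add: power4_eq_xxxx power2_eq_square mult_ac)
    also have "\<dots> \<le> 2 * B / D1 ^ 3 * W ^ 2 + 4 / D1 ^ 4 * W ^ 4" using assms by simp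
    finally show ?thesis by (simp add: abs_mult)
  qed
  ultimately show ?thesis unfolding D_def[symmetric] W_def[symmetric] by simp
qed

lemma sum_card_rw:
  assumes "F \<subseteq> {..<n} \<times> {..<n}" shows "(\<Sum>a<n. card (rw F a)) = card F"
proof -
  have "F = (SIGMA a:{..<n}. rw F a)" using assms by auto
  moreover have "card (SIGMA a:{..<n}. rw F a) = (\<Sum>a<n. card (rw F a))"
    using finite_rw[OF assms] by (intro card_SigmaI) auto
  ultimately show ?thesis by simp
qed

lemma sum_card_cl:
  assumes "F \<subseteq> {..<n} \<times> {..<n}" shows "(\<Sum>a<n. card (cl F a)) = card F"
proof -
  have "cl F v = rw (F\<inverse>) v" for v by auto
  moreover have "(\<Sum>a<n. card (rw (F\<inverse>) a)) = card (F\<inverse>)" using assms by (intro sum_card_rw) auto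
  moreover have "card (F\<inverse>) = card F" by simp
  ultimately show ?thesis by simp
qed

context near_regular begin

lemma bd_l: "bd 0 0 l" "bd 0 0 (1 - l)" "bd 0 0 q" "bd 1 0 (1 / l)" "bd 1 0 (1 / (1 - l))" "bd 1 0 (1 / (2 * q))"
proof -
  show "bd 0 0 l" "bd 0 0 (1 - l)" "bd 0 0 q" using l_bounds q_ge by (auto simp: bd_def)
  have "1 / l \<le> 1 / (1 / \<theta>)" using l_ge theta_pos l_bounds by (intro divide_left_mono) auto
  then show "bd 1 0 (1 / l)" using l_bounds by (simp add: bd_def)
  have "1 / (1 - l) \<le> 1 / (1 / \<theta>)" using l_le theta_pos l_bounds by (intro divide_left_mono) auto
  then show "bd 1 0 (1 / (1 - l))" using l_bounds by (simp add: bd_def)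
  have "1 / (2 * q) \<le> 1 / (1 / \<theta>)" using q_ge theta_pos by (intro divide_left_mono) auto
  then show "bd 1 0 (1 / (2 * q))" using q_ge by (simp add: bd_def)
qed

lemma bd_n: "bd 0 2 (real n)" "bd 0 (-2) (1 / real n)"
  using r_pos by (simp_all add: bd_def rn power_int_minus field_simps)

lemma bd_invD0: "bd 1 (-2) (1 / (2 * q * real n))"
  using bd_mult[OF bd_l(6) bd_n(2)] by simp

lemma bd_rwF:
  assumes "cls k F Q" "k \<le> 10" "a < n"
  shows "bd 2 1 (real (card (rw F a)))" "bd 2 1 (real (card (cl F a)))"
proof -
  have "2 * (\<theta> * r) \<le> \<theta> * (\<theta> * r)" using theta_ge theta_r by (intro mult_right_mono) auto
  then show "bd 2 1 (real (card (rw F a)))" "bd 2 1 (real (card (cl F a)))"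
    using clsD(6,7)[OF assms(1,3)] assms(2) theta_r by (simp_all add: bd_def power2_eq_square)
qed

lemma bd_frozen2:
  assumes "cls k F Q" "k \<le> 10" "a < n" "b < n"
  shows "bd 2 1 (real (card (frozen2 F a b)))"
proof -
  have "3 * (\<theta> * r) \<le> \<theta> * (\<theta> * r)" using theta_ge theta_r by (intro mult_right_mono) auto
  then show ?thesis using frozen2_le[OF assms] by (simp add: bd_def power2_eq_square)
qed

abbreviation onlysum where "onlysum F a b G \<equiv> real (card (only n F a b G)) + real (card (only n F b a G))"
abbreviation onlydiff where "onlydiff F a b G \<equiv> real (card (only n F a b G)) - real (card (only n F b a G))"
abbreviation xor where "xor a b v G \<equiv> (of_bool (((a,v) \<in> G) \<noteq> ((b,v) \<in> G)) :: real)"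

lemma bd_only_sum_moment:
  assumes "cls k F Q" "k \<le> 10" "a < n" "b < n" "a \<noteq> b"
  shows "bd 10 4 (avg (Omega F Q) (\<lambda>G. (onlysum F a b G - 2 * q * real n) ^ 4))"
  using only_sum_moment[OF assms] avg_nonneg[of "Omega F Q" "\<lambda>G. (onlysum F a b G - 2 * q * real n) ^ 4"]
  by (simp add: bd_def)

text \<open>For the order \<open>1 / r\<close> absolute values in \<open>avg_row_difference\<close>
  suffice. This crude bound starts the iteration and makes conditioning possible.\<close>

lemma pr_diff_rough:
  assumes "cls k F Q" "k \<le> 10" "a < n" "b < n" "v < n" "(a,v) \<notin> F" "(b,v) \<notin> F"
  shows "bd 4 (-1) (pr F Q a v - pr F Q b v)"
proof (cases "a = b")
  case True then show ?thesis by (simp add: bd_0)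
next
  case False
  let ?D0 = "2 * q * real n"
  have D0: "?D0 > 0" using q_ge n_ge by simp
  have ne: "Omega F Q \<noteq> {}" using assms(1) by (rule clsD)
  let ?X = "avg (Omega F Q) (\<lambda>G. (onlysum F a b G - ?D0) ^ 4)"
  have "\<bar>pr F Q a v - pr F Q b v\<bar> \<le> avg (Omega F Q) (\<lambda>G. \<bar>xor a b v G * (onlydiff F a b G / onlysum F a b G)\<bar>)"
    unfolding avg_row_difference[OF False assms(3-7)] by (rule avg_abs)
  also have "\<dots> \<le> avg (Omega F Q) (\<lambda>G. 2 * (5 * \<theta> * r) / ?D0 + (16 / ?D0 ^ 4) * (onlysum F a b G - ?D0) ^ 4)"
  proof (rule avg_mono)
    fix G assume G: "G \<in> Omega F Q"
    have "\<bar>onlydiff F a b G / onlysum F a b G\<bar> \<le> 2 * (5 * \<theta> * r) / ?D0 + 16 * (onlysum F a b G - ?D0) ^ 4 / ?D0 ^ 4"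
      using only_diff[OF assms(1-4) G] D0 by (intro ratio_le) auto
    moreover from this have "0 \<le> 2 * (5 * \<theta> * r) / ?D0 + 16 * (onlysum F a b G - ?D0) ^ 4 / ?D0 ^ 4"
      using order_trans[OF abs_ge_zero] by blast
    ultimately show "\<bar>xor a b v G * (onlydiff F a b G / onlysum F a b G)\<bar> \<le> 2 * (5 * \<theta> * r) / ?D0 + (16 / ?D0 ^ 4) * (onlysum F a b G - ?D0) ^ 4"
      by (auto simp: abs_mult)
  qed
  also have "\<dots> = 10 * \<theta> * r * (1 / ?D0) + 16 * (1 / ?D0) ^ 4 * ?X"
    unfolding avg_add avg_cmult avg_const[OF finite_Om ne] power_one_over by simp
  finally have le: "\<bar>pr F Q a v - pr F Q b v\<bar> \<le> 10 * \<theta> * r * (1 / ?D0) + 16 * (1 / ?D0) ^ 4 * ?X" .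
  have "bd 3 (-1) (10 * \<theta> * r * (1 / ?D0))"
    by (rule bd_weaken[OF bd_mult[OF bd_mult[OF bd_mult[OF bd_const[of 10] bd_theta] bd_r] bd_invD0]]) auto
  moreover have "bd 15 (-4) (16 * (1 / ?D0) ^ 4 * ?X)"
    by (rule bd_weaken[OF bd_mult[OF bd_mult[OF bd_const[of 16] bd_power[OF bd_invD0, of 4]] bd_only_sum_moment[OF assms(1-4) False]]]) auto
  \<comment> \<open>The exceptional matrices contribute only order \<open>r powi (-4)\<close>, so
    the fifteen powers of \<open>\<theta>\<close> disappear.\<close>
  then have "bd 3 (-1) (16 * (1 / ?D0) ^ 4 * ?X)" by (rule bd_absorb) auto
  ultimately have "bd 4 (-1) (10 * \<theta> * r * (1 / ?D0) + 16 * (1 / ?D0) ^ 4 * ?X)"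
    by (rule bd_addI) auto
  then show ?thesis using le by (rule bd_le)
qed

definition freecol :: "(nat \<times> nat) set \<Rightarrow> nat \<Rightarrow> nat set" where
  "freecol F v = {b. b < n \<and> (b,v) \<notin> F}"

lemma card_freecol:
  assumes "cls k F Q"
  shows "real (card (freecol F v)) = real n - real (card (cl F v))"
proof -
  have sub: "cl F v \<subseteq> {..<n}" using clsD(1)[OF assms] by (rule cl_subset)
  have "freecol F v = {..<n} - cl F v" by (auto simp: freecol_def)
  then have "card (freecol F v) = n - card (cl F v)" using sub by (simp add: card_Diff_subset finite_subset)
  moreover have "card (cl F v) \<le> n" using card_mono[OF _ sub] by simp
  ultimately show ?thesis by simp
qed

lemma freecol_ge:
  assumes "cls k F Q" "k \<le> 10" "v < n"
  shows "real (card (freecol F v)) \<ge> real n / 2" "bd 1 (-2) (1 / real (card (freecol F v)))"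
proof -
  have "4 * (\<theta> * r) \<le> r * r"
  proof -
    have "\<theta> ^ 2 \<le> \<theta> ^ 100" using theta_pos by (intro power_increasing) auto
    then have "\<theta> * \<theta> \<le> r" using r_ge by (simp add: power2_eq_square)
    then have "4 * \<theta> \<le> r" using theta_ge mult_right_mono[of 4 \<theta> \<theta>] by linarith
    then show ?thesis using r_pos by (simp flip: mult.assoc)
  qed
  then have "real (card (cl F v)) \<le> real n / 2"
    unfolding rn power2_eq_square using clsD(7)[OF assms(1,3)] assms(2) theta_r by linarith
  then show 1: "real (card (freecol F v)) \<ge> real n / 2" using card_freecol[OF assms(1)] by simp
  have "1 / real (card (freecol F v)) \<le> 1 / (real n / 2)" using 1 n_ge by (intro divide_left_mono) auto
  also have "\<dots> = 2 * (1 / real n)" by simp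
  finally have "\<bar>1 / real (card (freecol F v))\<bar> \<le> 2 * (1 / real n)" by simp
  moreover have "bd 1 (-2) (2 * (1 / real n))" using bd_mult[OF bd_const[of 2] bd_n(2)] by simp
  ultimately show "bd 1 (-2) (1 / real (card (freecol F v)))" using bd_le by blast
qed

text \<open>The column sum is not random. It fixes the level of the probabilities in column
  \<open>v\<close>, which their differences leave open.\<close>

lemma sum_pr:
  assumes "cls k F Q" "v < n"
  shows "(\<Sum>b\<in>freecol F v. pr F Q b v) = real (t v) - real (card (cl Q v))"
proof -
  have ne: "Omega F Q \<noteq> {}" using assms(1) by (rule clsD)
  have "(\<Sum>b\<in>freecol F v. pr F Q b v) = avg (Omega F Q) (\<lambda>G. \<Sum>b\<in>freecol F v. of_bool ((b,v) \<in> G))"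
    by (simp add: avg_sum)
  also have "\<dots> = avg (Omega F Q) (\<lambda>G. real (t v) - real (card (cl Q v)))"
  proof (rule avg_cong)
    fix G assume G: "G \<in> Omega F Q"
    have Gs: "G \<subseteq> {..<n} \<times> {..<n}" and tv: "card (cl G v) = t v" and GF: "G \<inter> F = Q"
      using G assms(2) by (auto simp: Om_def)
    have fin: "finite (cl G v)" using finite_cl[OF Gs] .
    have "(\<Sum>b\<in>freecol F v. of_bool ((b,v) \<in> G) :: real) = real (card (freecol F v \<inter> {b. (b,v) \<in> G}))"
      by (simp add: of_bool_def sum.If_cases freecol_def)
    also have "freecol F v \<inter> {b. (b,v) \<in> G} = cl G v - cl Q v" using Gs GF by (auto simp: freecol_def)
    also have "real (card (cl G v - cl Q v)) = real (t v) - real (card (cl Q v))"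
    proof -
      have sub: "cl Q v \<subseteq> cl G v" using GF by auto
      then show ?thesis using tv fin card_mono[OF fin sub] by (simp add: card_Diff_subset finite_subset of_nat_diff)
    qed
    finally show "(\<Sum>b\<in>freecol F v. of_bool ((b,v) \<in> G)) = real (t v) - real (card (cl Q v))" .
  qed
  finally show ?thesis using ne by (simp add: avg_const finite_Om)
qed

lemma card_clQ:
  assumes "cls k F Q" shows "card (cl Q v) \<le> k" "card (rw Q v) \<le> k"
proof -
  have fin: "finite Q" using clsD(2,5)[OF assms] finite_subset by blast
  have "cl Q v \<subseteq> fst ` Q" by force
  then have "card (cl Q v) \<le> card Q"
    using fin card_mono[of "fst ` Q" "cl Q v"] card_image_le[of Q fst] by fastforce
  then show "card (cl Q v) \<le> k" using clsD(3)[OF assms] by simp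
  have "rw Q v \<subseteq> snd ` Q" by force
  then have "card (rw Q v) \<le> card Q"
    using fin card_mono[of "snd ` Q" "rw Q v"] card_image_le[of Q snd] by fastforce
  then show "card (rw Q v) \<le> k" using clsD(3)[OF assms] by simp
qed

text \<open>For \<open>F\<close> the diagonal together with \<open>H\<close>, these are the deviations \<open>\<delta>\<close> and \<open>\<eta>\<close> of the theorem,
  up to the contribution of the diagonal.\<close>

definition dd :: "(nat \<times> nat) set \<Rightarrow> nat \<Rightarrow> real" where
  "dd F a = real (s a) - l * real n + l * real (card (rw F a))"
definition ee :: "(nat \<times> nat) set \<Rightarrow> nat \<Rightarrow> real" where
  "ee F v = real (t v) - l * real n + l * real (card (cl F v))"
definition sig :: "(nat \<times> nat) set \<Rightarrow> real" where
  "sig F = (\<Sum>a<n. real (s a)) - l * real n ^ 2 + l * real (card F)"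

lemma bd_dd:
  assumes "cls k F Q" "k \<le> 10" "a < n"
  shows "bd 2 1 (dd F a)" "bd 2 1 (ee F a)"
proof -
  have "l * real (card (rw F a)) \<le> real (card (rw F a))" "l * real (card (cl F a)) \<le> real (card (cl F a))"
    using l_bounds by (auto simp: mult_left_le_one_le)
  moreover have "0 \<le> l * real (card (rw F a))" "0 \<le> l * real (card (cl F a))" using l_bounds by auto
  moreover have "3 * (\<theta> * r) \<le> \<theta> * (\<theta> * r)" using theta_ge theta_r by (intro mult_right_mono) auto
  ultimately show "bd 2 1 (dd F a)" "bd 2 1 (ee F a)"
    using clsD(6,7)[OF assms(1,3)] assms(2) theta_r s_dev[OF assms(3)] t_dev[OF assms(3)]
    by (simp_all add: bd_def power2_eq_square dd_def ee_def)
qed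

lemma bd_sig:
  assumes "cls k F Q" "k \<le> 10" shows "bd 2 2 (sig F)"
proof -
  have "l * real (card F) \<le> real (card F)" "0 \<le> l * real (card F)"
    using l_bounds by (auto simp: mult_left_le_one_le)
  moreover have "3 * (\<theta> * real n) \<le> \<theta> * (\<theta> * real n)" using theta_ge n_ge by (intro mult_right_mono) auto
  moreover have "10 \<le> \<theta> * real n" using mult_mono[of 1 \<theta> 10 "real n"] theta_pos n_ge by simp
  ultimately have "\<bar>sig F\<bar> \<le> \<theta> * (\<theta> * real n)"
    using clsD(8)[OF assms(1)] assms(2) total unfolding sig_def by linarith
  then show ?thesis by (simp add: bd_def power2_eq_square rn)
qed

lemma sum_dd:
  assumes "cls k F Q"
  shows "(\<Sum>a<n. dd F a) = sig F" "(\<Sum>a<n. ee F a) = sig F"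
proof -
  have 1: "(\<Sum>a<n. real (card (rw F a))) = real (card F)" "(\<Sum>a<n. real (card (cl F a))) = real (card F)"
    using sum_card_rw[OF clsD(1)[OF assms]] sum_card_cl[OF clsD(1)[OF assms]] by (simp_all flip: of_nat_sum)
  have 2: "(\<Sum>a<n. real (s a)) = (\<Sum>a<n. real (t a))" using sum_eq by (simp flip: of_nat_sum)
  show "(\<Sum>a<n. dd F a) = sig F" "(\<Sum>a<n. ee F a) = sig F"
    unfolding dd_def ee_def sig_def sum.distrib sum_subtractf sum_distrib_left[symmetric] 1
    by (simp_all add: 2 power2_eq_square algebra_simps)
qed

lemma pr_rough:
  assumes "cls k F Q" "k \<le> 10" "a < n" "v < n" "(a,v) \<notin> F"
  shows "bd 6 (-1) (pr F Q a v - l)"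
proof -
  define m where "m = real (card (freecol F v))"
  have m: "m \<ge> real n / 2" "bd 1 (-2) (1 / m)" "m = real n - real (card (cl F v))" "m > 0"
    using freecol_ge[OF assms(1,2,4)] card_freecol[OF assms(1)] n_ge unfolding m_def by auto
  define X where "X = (\<Sum>b\<in>freecol F v. pr F Q a v - pr F Q b v)"
  have "X = m * pr F Q a v - (real (t v) - real (card (cl Q v)))"
    using sum_pr[OF assms(1,4)] by (simp add: X_def sum_subtractf m_def)
  then have mp: "m * pr F Q a v = X + (real (t v) - real (card (cl Q v)))" by linarith
  have ml: "m * l = l * real n - l * real (card (cl F v))" by (simp add: m(3) algebra_simps)
  have "pr F Q a v - l = (m * pr F Q a v - m * l) * (1 / m)" using m(4) by (simp add: field_simps)
  also have "m * pr F Q a v - m * l = X + (ee F v - real (card (cl Q v)))" unfolding mp ml ee_def by simp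
  finally have eq: "pr F Q a v - l = X * (1 / m) + (ee F v - real (card (cl Q v))) * (1 / m)"
    by (simp only: distrib_right)
  have "bd 4 1 X"
  proof -
    have "m \<le> real n" using m by simp
    then have bm: "bd 0 2 m" using m bd_n bd_le[of 0 2 "real n" m] by simp
    have "bd (4 + 0) (-1 + 2) X" unfolding X_def
      using bm assms by (intro bd_sum pr_diff_rough[OF assms(1-3)]) (auto simp: m_def freecol_def)
    then show ?thesis by simp
  qed
  then have 1: "bd 5 (-1) (X * (1 / m))" by (rule bd_multI[OF _ m(2)]) auto
  have "bd 2 1 (real (card (cl Q v)))"
    using card_clQ(1)[OF assms(1), of v] assms(2) by (intro bd_weaken[OF bd_const, of _ 2 1]) auto
  then have "bd 3 1 (ee F v - real (card (cl Q v)))" by (rule bd_diffI[OF bd_dd(2)[OF assms(1,2,4)]]) auto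
  then have "bd 4 (-1) ((ee F v - real (card (cl Q v))) * (1 / m))" by (rule bd_multI[OF _ m(2)]) auto
  with 1 show ?thesis unfolding eq by (rule bd_addI) auto
qed

text \<open>The density stays \<open>1 / \<theta>\<close> away from 0 and 1 while the error is of
  order \<open>1 / r\<close>. Both values of a free cell therefore occur, and either may be
  conditioned on.\<close>

lemma pr_pos:
  assumes "cls k F Q" "k \<le> 10" "a < n" "v < n" "(a,v) \<notin> F"
  shows "0 < pr F Q a v" "pr F Q a v < 1"
proof -
  have "\<theta> ^ 6 * r powi (-1) < 1 / \<theta>"
  proof -
    have "\<theta> ^ 7 < \<theta> ^ 100" using theta_ge by (intro power_strict_increasing) auto
    then have "\<theta> ^ 7 < r" using r_ge by simp
    moreover have "\<theta> * \<theta> ^ 6 = \<theta> ^ 7" by (simp flip: power_Suc)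
    ultimately show ?thesis using r_pos theta_pos by (simp add: power_int_minus field_simps)
  qed
  then show "0 < pr F Q a v" "pr F Q a v < 1"
    using bdD[OF pr_rough[OF assms]] l_ge l_le by linarith+
qed

section \<open>Conditioning on the value of a cell\<close>

lemma avg_incl:
  assumes "(a,v) \<notin> F" "Q \<subseteq> F"
  shows "avg (Omega F Q) (\<lambda>G. of_bool ((a,v) \<in> G) * f G)
    = pr F Q a v * avg (Omega (insert (a,v) F) (insert (a,v) Q)) f"
proof -
  let ?T = "Omega (insert (a,v) F) (insert (a,v) Q)"
  have T: "?T = {G \<in> Omega F Q. (a,v) \<in> G}" using Om_incl[OF assms] .
  have "avg (Omega F Q) (\<lambda>G. of_bool ((a,v) \<in> G) * f G) = avg (Omega F Q) (\<lambda>G. of_bool (G \<in> ?T) * f G)"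
    by (rule avg_cong) (simp add: T)
  also have "\<dots> = avg (Omega F Q) (\<lambda>G. of_bool (G \<in> ?T)) * avg ?T f"
    by (rule avg_restrict) (auto simp: finite_Om T)
  also have "avg (Omega F Q) (\<lambda>G. of_bool (G \<in> ?T)) = pr F Q a v"
    by (rule avg_cong) (simp add: T)
  finally show ?thesis .
qed

lemma avg_excl:
  assumes "(a,v) \<notin> F" "Q \<subseteq> F" "Omega F Q \<noteq> {}"
  shows "avg (Omega F Q) (\<lambda>G. of_bool ((a,v) \<notin> G) * f G)
    = (1 - pr F Q a v) * avg (Omega (insert (a,v) F) Q) f"
proof -
  let ?T = "Omega (insert (a,v) F) Q"
  have T: "?T = {G \<in> Omega F Q. (a,v) \<notin> G}" using Om_excl[OF assms(1,2)] .
  have "avg (Omega F Q) (\<lambda>G. of_bool ((a,v) \<notin> G) * f G) = avg (Omega F Q) (\<lambda>G. of_bool (G \<in> ?T) * f G)"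
    by (rule avg_cong) (simp add: T)
  also have "\<dots> = avg (Omega F Q) (\<lambda>G. of_bool (G \<in> ?T)) * avg ?T f"
    by (rule avg_restrict) (auto simp: finite_Om T)
  also have "avg (Omega F Q) (\<lambda>G. of_bool (G \<in> ?T)) = avg (Omega F Q) (\<lambda>G. 1 - of_bool ((a,v) \<in> G))"
    by (rule avg_cong) (simp add: T)
  also have "\<dots> = 1 - pr F Q a v" using assms(3) by (simp add: avg_diff avg_const finite_Om)
  finally show ?thesis .
qed

text \<open>Conditioning stays within the class. Apart from counting, this requires the conditioned
  set to be inhabited, which is where \<open>pr_pos\<close> enters.\<close>

lemma cls_insert:
  assumes "cls k F Q" "k \<le> 10" "a < n" "v < n" "(a,v) \<notin> F"
  shows "cls (Suc k) (insert (a,v) F) (insert (a,v) Q)" "cls (Suc k) (insert (a,v) F) Q"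
proof -
  note c = clsD[OF assms(1)]
  have ne: "Omega (insert (a,v) F) (insert (a,v) Q) \<noteq> {}" "Omega (insert (a,v) F) Q \<noteq> {}"
  proof -
    show "Omega (insert (a,v) F) (insert (a,v) Q) \<noteq> {}"
      using avg_incl[OF assms(5) c(2), of "\<lambda>_. 1"] pr_pos[OF assms] by (auto simp: avg_def)
    show "Omega (insert (a,v) F) Q \<noteq> {}"
    proof
      assume "Omega (insert (a,v) F) Q = {}"
      then have "avg (Omega F Q) (\<lambda>G. of_bool ((a,v) \<notin> G) * 1) = 0"
        using avg_excl[OF assms(5) c(2) c(4), of "\<lambda>_. 1"] by (simp add: avg_def)
      moreover have "avg (Omega F Q) (\<lambda>G. of_bool ((a,v) \<notin> G) * 1) = avg (Omega F Q) (\<lambda>G. 1 - of_bool ((a,v) \<in> G))"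
        by (rule avg_cong) simp
      ultimately show False using pr_pos[OF assms] c(4) by (simp add: avg_diff avg_const finite_Om)
    qed
  qed
  have finQ: "finite Q" using c(2,5) finite_subset by blast
  have r1: "real (card (rw (insert (a,v) F) b)) \<le> real (card (rw F b)) + 1" for b
  proof -
    have "rw (insert (a,v) F) b \<subseteq> insert v (rw F b)" by auto
    then have "card (rw (insert (a,v) F) b) \<le> card (insert v (rw F b))"
      using finite_rw[OF c(1)] by (intro card_mono) auto
    also have "\<dots> \<le> Suc (card (rw F b))" by (rule card_insert_le_m1) (auto)
    finally show ?thesis by simp
  qed
  have r2: "real (card (cl (insert (a,v) F) b)) \<le> real (card (cl F b)) + 1" for b
  proof -
    have "cl (insert (a,v) F) b \<subseteq> insert a (cl F b)" by auto
    then have "card (cl (insert (a,v) F) b) \<le> card (insert a (cl F b))"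
      using finite_cl[OF c(1)] by (intro card_mono) auto
    also have "\<dots> \<le> Suc (card (cl F b))" by (rule card_insert_le_m1) (auto)
    finally show ?thesis by simp
  qed
  have r3: "real (card (insert (a,v) F)) \<le> real (card F) + 1" using c(5) assms(5) by simp
  have r4: "card (insert (a,v) Q) \<le> Suc k" "card Q \<le> Suc k" using c(3) finQ by (auto simp: card_insert_if)
  have f: "real (card (rw (insert (a,v) F) b)) \<le> \<theta> * r + real (Suc k)"
    "real (card (cl (insert (a,v) F) b)) \<le> \<theta> * r + real (Suc k)" if "b < n" for b
    using r1[of b] r2[of b] clsD(6,7)[OF assms(1) that] by auto
  have g: "real (card (insert (a,v) F)) \<le> \<theta> * real n + real (Suc k)" using r3 c(8) by simp
  show "cls (Suc k) (insert (a,v) F) (insert (a,v) Q)" "cls (Suc k) (insert (a,v) F) Q"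
    unfolding cls_def using c(1,2) ne r4 f g assms(3,4) by auto
qed

end

lemma mult_le_sum_squares: "(x::real) * y \<le> y * y + x * x"
proof -
  have "y * y + x * x - x * y = (x - y / 2)\<^sup>2 + 3 / 4 * y\<^sup>2" by (simp add: power2_eq_square field_simps)
  moreover have "\<dots> \<ge> 0" by simp
  ultimately show ?thesis by linarith
qed

context near_regular begin

section \<open>Means of the counts under conditioned measures\<close>

lemma onlydiff_eq:
  assumes "G \<in> Omega F' Q'" "a < n" "b < n"
  shows "onlydiff F a b G = real (s a) - real (s b) - real (card (rw G a \<inter> frozen2 F a b)) + real (card (rw G b \<inter> frozen2 F a b))"
proof -
  have "rw G b \<inter> frozen2 F b a = rw G b \<inter> frozen2 F a b"
    "rw G b \<inter> rw G a \<inter> free2 n F b a = rw G a \<inter> rw G b \<inter> free2 n F a b"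
    by (auto simp: free2_def)
  then show ?thesis using card_only[OF assms(1,2), of F b] card_only[OF assms(1,3), of F a] by simp
qed

lemma onlysum_eq:
  assumes "G \<in> Omega F' Q'" "a < n" "b < n"
  shows "onlysum F a b G = real (s a) + real (s b) - real (card (rw G a \<inter> frozen2 F a b)) - real (card (rw G b \<inter> frozen2 F a b))
    - 2 * real (card (rw G a \<inter> rw G b \<inter> free2 n F a b))"
proof -
  have "rw G b \<inter> frozen2 F b a = rw G b \<inter> frozen2 F a b"
    "rw G b \<inter> rw G a \<inter> free2 n F b a = rw G a \<inter> rw G b \<inter> free2 n F a b"
    by (auto simp: free2_def)
  then show ?thesis using card_only[OF assms(1,2), of F b] card_only[OF assms(1,3), of F a] by simp
qed

text \<open>The two cells differ in one of two ways, each reached by freezing one cell as 1 and then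
  the other as 0. Both parts are averages over measures of the same kind with two more frozen
  cells.\<close>

lemma xor_split:
  assumes "cls k F Q" "k \<le> 9" "a \<noteq> b" "a < n" "b < n" "v < n" "(a,v) \<notin> F" "(b,v) \<notin> F"
  shows "avg (Omega F Q) (\<lambda>G. xor a b v G * f G)
    = pr F Q a v * (1 - pr (insert (a,v) F) (insert (a,v) Q) b v) * avg (Omega (insert (b,v) (insert (a,v) F)) (insert (a,v) Q)) f
    + pr F Q b v * (1 - pr (insert (b,v) F) (insert (b,v) Q) a v) * avg (Omega (insert (a,v) (insert (b,v) F)) (insert (b,v) Q)) f"
proof -
  have k: "k \<le> 10" using assms(2) by simp
  note Qs = clsD(2)[OF assms(1)]
  note c1 = cls_insert(1)[OF assms(1) k assms(4,6,7)]
  note c2 = cls_insert(1)[OF assms(1) k assms(5,6,8)]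
  have "avg (Omega F Q) (\<lambda>G. xor a b v G * f G) = avg (Omega F Q) (\<lambda>G. of_bool ((a,v) \<in> G) * (of_bool ((b,v) \<notin> G) * f G)
      + of_bool ((b,v) \<in> G) * (of_bool ((a,v) \<notin> G) * f G))"
    by (rule avg_cong) auto
  also have "\<dots> = pr F Q a v * ((1 - pr (insert (a,v) F) (insert (a,v) Q) b v) * avg (Omega (insert (b,v) (insert (a,v) F)) (insert (a,v) Q)) f)
    + pr F Q b v * ((1 - pr (insert (b,v) F) (insert (b,v) Q) a v) * avg (Omega (insert (a,v) (insert (b,v) F)) (insert (b,v) Q)) f)"
    unfolding avg_add avg_incl[OF assms(7) Qs] avg_incl[OF assms(8) Qs]
    using assms(3,7,8) clsD(2,4)[OF c1] clsD(2,4)[OF c2] by (simp add: avg_excl)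
  finally show ?thesis by simp
qed

lemma pr_bounds: "0 \<le> pr F Q a v" "pr F Q a v \<le> 1"
proof -
  show "0 \<le> pr F Q a v" by (rule avg_nonneg) simp
  show "pr F Q a v \<le> 1"
  proof (cases "Omega F Q = {}")
    case True then show ?thesis by (simp add: avg_def)
  next
    case False
    have "pr F Q a v \<le> avg (Omega F Q) (\<lambda>_. 1)" by (rule avg_mono) simp
    then show ?thesis using False by (simp add: avg_const finite_Om)
  qed
qed

lemma bd_pr: "bd 0 0 (pr F Q a v)" "bd 0 0 (1 - pr F Q a v)"
  using pr_bounds by (simp_all add: bd_def)

lemma avg_xor:
  assumes "cls k F Q" "k \<le> 9" "a \<noteq> b" "a < n" "b < n" "v < n" "(a,v) \<notin> F" "(b,v) \<notin> F"
  shows "avg (Omega F Q) (xor a b v) = pr F Q a v * (1 - pr (insert (a,v) F) (insert (a,v) Q) b v)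
    + pr F Q b v * (1 - pr (insert (b,v) F) (insert (b,v) Q) a v)"
proof -
  have k: "k \<le> 10" using assms(2) by simp
  note c1 = cls_insert(2)[OF cls_insert(1)[OF assms(1) k assms(4,6,7)], of b v]
  note c2 = cls_insert(2)[OF cls_insert(1)[OF assms(1) k assms(5,6,8)], of a v]
  have "Omega (insert (b,v) (insert (a,v) F)) (insert (a,v) Q) \<noteq> {}" "Omega (insert (a,v) (insert (b,v) F)) (insert (b,v) Q) \<noteq> {}"
    using clsD(4)[OF c1] clsD(4)[OF c2] assms by auto
  then show ?thesis using xor_split[OF assms, of "\<lambda>_. 1"] by (simp add: avg_const finite_Om)
qed

text \<open>A decoupling principle: if both ways of filling the two cells leave the conditional mean
  of \<open>f\<close> near \<open>m\<close>, then \<open>f\<close> may be replaced by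
  \<open>m\<close> under the average.\<close>

lemma bd_avg_xor:
  assumes "cls k F Q" "k \<le> 9" "a \<noteq> b" "a < n" "b < n" "v < n" "(a,v) \<notin> F" "(b,v) \<notin> F"
    and 1: "bd k' j (avg (Omega (insert (b,v) (insert (a,v) F)) (insert (a,v) Q)) f - m)"
    and 2: "bd k' j (avg (Omega (insert (a,v) (insert (b,v) F)) (insert (b,v) Q)) f - m)"
  shows "bd (Suc k') j (avg (Omega F Q) (\<lambda>G. xor a b v G * f G) - avg (Omega F Q) (xor a b v) * m)"
proof -
  let ?w1 = "pr F Q a v * (1 - pr (insert (a,v) F) (insert (a,v) Q) b v)"
  let ?w2 = "pr F Q b v * (1 - pr (insert (b,v) F) (insert (b,v) Q) a v)"
  have "avg (Omega F Q) (\<lambda>G. xor a b v G * f G) - avg (Omega F Q) (xor a b v) * m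
    = ?w1 * (avg (Omega (insert (b,v) (insert (a,v) F)) (insert (a,v) Q)) f - m)
    + ?w2 * (avg (Omega (insert (a,v) (insert (b,v) F)) (insert (b,v) Q)) f - m)"
    unfolding avg_xor[OF assms(1-8)] xor_split[OF assms(1-8)] by (simp only: ring_distribs)
  moreover have "bd k' j (?w1 * (avg (Omega (insert (b,v) (insert (a,v) F)) (insert (a,v) Q)) f - m))"
    by (rule bd_weaken[OF bd_mult[OF bd_mult[OF bd_pr(1) bd_pr(2)] 1]]) auto
  moreover have "bd k' j (?w2 * (avg (Omega (insert (a,v) (insert (b,v) F)) (insert (b,v) Q)) f - m))"
    by (rule bd_weaken[OF bd_mult[OF bd_mult[OF bd_pr(1) bd_pr(2)] 2]]) auto
  ultimately show ?thesis by (simp only: bd_add)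
qed

lemma avg_card_rw:
  assumes "finite W"
  shows "avg (Omega F Q) (\<lambda>G. real (card (rw G a \<inter> W))) = (\<Sum>w\<in>W. pr F Q a w)"
proof -
  have "avg (Omega F Q) (\<lambda>G. real (card (rw G a \<inter> W))) = avg (Omega F Q) (\<lambda>G. \<Sum>w\<in>W. of_bool ((a,w) \<in> G))"
    using assms by (intro avg_cong) (simp add: of_bool_def sum.If_cases rw_def Int_commute)
  then show ?thesis by (simp add: avg_sum)
qed

lemma pr_frozen:
  assumes "cls k F Q" "(a,v) \<in> F"
  shows "pr F Q a v = of_bool ((a,v) \<in> Q)"
proof -
  have "pr F Q a v = avg (Omega F Q) (\<lambda>G. of_bool ((a,v) \<in> Q))"
    using assms(2) by (intro avg_cong) (auto simp: Om_def)
  then show ?thesis using clsD(4)[OF assms(1)] by (simp add: avg_const finite_Om)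
qed

text \<open>About \<open>r\<close> columns contribute an error of order \<open>1 / r\<close> each. A
  frozen cell has probability 0 unless it lies in \<open>Q'\<close>, which has at most ten cells,
  and passing from \<open>F\<close> to \<open>F'\<close> affects at most ten more.\<close>

lemma row_part:
  assumes "cls k F' Q'" "k \<le> 10" "F \<subseteq> F'" "card (F' - F) \<le> 10" "a < n" "W \<subseteq> {..<n}" "bd 2 1 (real (card W))"
  shows "bd 11 0 ((\<Sum>w\<in>W. pr F' Q' a w) - l * real (card (W - rw F a)))"
proof -
  have fW: "finite W" using assms(6) finite_subset by blast
  have fF: "finite F'" using clsD(5)[OF assms(1)] .
  have "(\<Sum>w\<in>W. pr F' Q' a w) = (\<Sum>w\<in>W - rw F' a. pr F' Q' a w) + (\<Sum>w\<in>W \<inter> rw F' a. pr F' Q' a w)"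
    using fW by (simp add: sum.Int_Diff[of W _ "rw F' a"])
  also have "(\<Sum>w\<in>W \<inter> rw F' a. pr F' Q' a w) = real (card (W \<inter> rw F' a \<inter> rw Q' a))"
  proof -
    have "(\<Sum>w\<in>W \<inter> rw F' a. pr F' Q' a w) = (\<Sum>w\<in>W \<inter> rw F' a. of_bool ((a,w) \<in> Q'))"
      by (intro sum.cong refl pr_frozen[OF assms(1)]) simp
    also have "\<dots> = real (card (W \<inter> rw F' a \<inter> rw Q' a))"
      using fW by (simp add: of_bool_def sum.If_cases rw_def)
    finally show ?thesis .
  qed
  finally have eq: "(\<Sum>w\<in>W. pr F' Q' a w) - l * real (card (W - rw F a))
    = (\<Sum>w\<in>W - rw F' a. pr F' Q' a w - l) + (real (card (W \<inter> rw F' a \<inter> rw Q' a)) - l * (real (card (W - rw F a)) - real (card (W - rw F' a))))"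
    by (simp add: sum_subtractf algebra_simps)
  have "bd 8 0 (\<Sum>w\<in>W - rw F' a. pr F' Q' a w - l)"
  proof -
    have "bd 2 1 (real (card (W - rw F' a)))"
      using fW card_mono[of W "W - rw F' a"] by (intro bd_le[OF assms(7)]) auto
    then have "bd (6 + 2) (-1 + 1) (\<Sum>w\<in>W - rw F' a. pr F' Q' a w - l)"
      using assms(6) by (intro bd_sum pr_rough[OF assms(1,2,5)]) auto
    then show ?thesis by simp
  qed
  moreover have "bd 1 0 (real (card (W \<inter> rw F' a \<inter> rw Q' a)))"
  proof -
    have "finite (rw Q' a)" using finite_rw[of Q' n a] clsD(1,2)[OF assms(1)] by blast
    then have "card (W \<inter> rw F' a \<inter> rw Q' a) \<le> card (rw Q' a)" by (intro card_mono) auto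
    then show ?thesis using card_clQ(2)[OF assms(1), of a] assms(2) by (intro bd_const) auto
  qed
  moreover have "bd 1 0 (l * (real (card (W - rw F a)) - real (card (W - rw F' a))))"
  proof -
    have "card (W - rw F' a) \<le> card (W - rw F a)" using fW assms(3) by (intro card_mono) auto
    moreover have "card (W - rw F a) \<le> card ((W - rw F' a) \<union> rw (F' - F) a)"
      using fW fF finite_rw[OF clsD(1)[OF assms(1)], of a] by (intro card_mono) (auto intro: finite_subset[of _ "rw F' a"])
    moreover have "card ((W - rw F' a) \<union> rw (F' - F) a) \<le> card (W - rw F' a) + card (rw (F' - F) a)" by (rule card_Un_le)
    moreover have "card (rw (F' - F) a) \<le> 10"
    proof -
      have "rw (F' - F) a \<subseteq> snd ` (F' - F)" by force
      then have "card (rw (F' - F) a) \<le> card (snd ` (F' - F))" using fF by (intro card_mono) auto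
      also have "\<dots> \<le> card (F' - F)" using fF by (intro card_image_le) auto
      finally show ?thesis using assms(4) by simp
    qed
    ultimately have "\<bar>real (card (W - rw F a)) - real (card (W - rw F' a))\<bar> \<le> 100" by linarith
    then show ?thesis by (intro bd_multI[OF bd_l(1) bd_const]) auto
  qed
  then have "bd 2 0 (real (card (W \<inter> rw F' a \<inter> rw Q' a)) - l * (real (card (W - rw F a)) - real (card (W - rw F' a))))"
    by (intro bd_diffI[OF calculation(2)]) auto
  ultimately show ?thesis unfolding eq by (intro bd_addI[of 8 0 _ 2 0]) auto
qed

lemma card_frozen2_diff:
  assumes "cls k F Q"
  shows "real (card (frozen2 F a b - rw F a)) = real (card (frozen2 F a b)) - real (card (rw F a))"
    "real (card (frozen2 F a b - rw F b)) = real (card (frozen2 F a b)) - real (card (rw F b))"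
proof -
  have fin: "finite (rw F a)" "finite (rw F b)" using finite_rw[OF clsD(1)[OF assms]] by auto
  then have "card (rw F a) \<le> card (frozen2 F a b)" "card (rw F b) \<le> card (frozen2 F a b)"
    by (auto intro: card_mono)
  then show "real (card (frozen2 F a b - rw F a)) = real (card (frozen2 F a b)) - real (card (rw F a))"
    "real (card (frozen2 F a b - rw F b)) = real (card (frozen2 F a b)) - real (card (rw F b))"
    using fin by (simp_all add: card_Diff_subset of_nat_diff)
qed

lemma frozen2_subset:
  assumes "cls k F Q" shows "frozen2 F a b \<subseteq> {..<n}" "finite (frozen2 F a b)"
  using rw_subset[OF clsD(1)[OF assms]] finite_rw[OF clsD(1)[OF assms]] by auto

lemma avg_onlydiff:
  assumes "cls k0 F Q" "k0 \<le> 10" "cls k F' Q'" "a < n" "b < n"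
  shows "avg (Omega F' Q') (onlydiff F a b) = real (s a) - real (s b) - (\<Sum>w\<in>frozen2 F a b. pr F' Q' a w) + (\<Sum>w\<in>frozen2 F a b. pr F' Q' b w)"
proof -
  have "avg (Omega F' Q') (onlydiff F a b) = avg (Omega F' Q') (\<lambda>G. real (s a) - real (s b) - real (card (rw G a \<inter> frozen2 F a b)) + real (card (rw G b \<inter> frozen2 F a b)))"
    using assms by (intro avg_cong onlydiff_eq)
  then show ?thesis
    using clsD(4)[OF assms(3)] frozen2_subset(2)[OF assms(1)]
    by (simp add: avg_add avg_diff avg_const finite_Om avg_card_rw)
qed

text \<open>Each free cell in the columns of \<open>frozen2\<close> enters with weight about
  \<open>l\<close>. The size of \<open>frozen2\<close> itself cancels between the rows, and
  \<open>l * card (rw F a)\<close> completes the degree of \<open>a\<close> to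
  \<open>dd F a\<close>.\<close>

lemma avg_onlydiff_rough:
  assumes "cls k0 F Q" "k0 \<le> 10" "cls k F' Q'" "k \<le> 10" "F \<subseteq> F'" "card (F' - F) \<le> 10" "a < n" "b < n"
  shows "bd 12 0 (avg (Omega F' Q') (onlydiff F a b) - (dd F a - dd F b))"
proof -
  let ?U = "frozen2 F a b"
  note row = row_part[OF assms(3-6) _ frozen2_subset(1)[OF assms(1)] bd_frozen2[OF assms(1,2,7,8)]]
  have "avg (Omega F' Q') (onlydiff F a b) - (dd F a - dd F b)
    = ((\<Sum>w\<in>?U. pr F' Q' b w) - l * real (card (?U - rw F b))) - ((\<Sum>w\<in>?U. pr F' Q' a w) - l * real (card (?U - rw F a)))"
    unfolding avg_onlydiff[OF assms(1-3,7,8)] card_frozen2_diff[OF assms(1)] dd_def by (simp add: algebra_simps)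
  then show ?thesis using bd_diffI[OF row[OF assms(8)] row[OF assms(7)], of 12 0] by simp
qed

lemma D1_facts:
  assumes "bd 4 1 (D1 - 2 * q * real n)"
  shows "D1 > 0" "bd 2 (-2) (1 / D1)"
proof -
  have "2 * \<theta> ^ 5 * r \<le> r * r"
  proof -
    have "\<theta> * \<theta> ^ 5 \<le> \<theta> ^ 100" using power_increasing[of 6 100 \<theta>] theta_pos by (simp flip: power_Suc)
    moreover have "2 * \<theta> ^ 5 \<le> \<theta> * \<theta> ^ 5" using theta_ge by (intro mult_right_mono) auto
    ultimately show ?thesis using r_ge r_pos by (intro mult_right_mono) auto
  qed
  then have "\<theta> ^ 4 * r \<le> real n / \<theta> / 2"
    using theta_pos by (simp add: rn power2_eq_square field_simps numeral_eq_Suc)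
  then have 1: "D1 \<ge> real n / \<theta> / 2" using bdD[OF assms] D0_ge by simp
  have pos: "real n / \<theta> / 2 > 0" using n_ge theta_pos by simp
  show D1: "D1 > 0" using 1 pos by linarith
  have "1 / D1 \<le> 1 / (real n / \<theta> / 2)" using 1 pos D1 by (intro divide_left_mono mult_pos_pos) auto
  then have "\<bar>1 / D1\<bar> \<le> 2 * \<theta> * (1 / real n)" using D1 by (simp add: mult.commute)
  moreover have "bd 2 (-2) (2 * \<theta> * (1 / real n))"
    by (rule bd_weaken[OF bd_mult[OF bd_mult[OF bd_const[of 2] bd_theta] bd_n(2)]]) auto
  ultimately show "bd 2 (-2) (1 / D1)" using bd_le by blast
qed

section \<open>Moments of the centred sum and expansion of the ratio\<close>

lemma bd_W4:
  assumes "cls k F Q" "k \<le> 10" "a < n" "b < n" "a \<noteq> b" "bd 4 1 (D1 - 2 * q * real n)"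
  shows "bd 18 4 (avg (Omega F Q) (\<lambda>G. (D1 - onlysum F a b G) ^ 4))"
proof -
  have ne: "Omega F Q \<noteq> {}" using clsD(4)[OF assms(1)] .
  have "avg (Omega F Q) (\<lambda>G. (D1 - onlysum F a b G) ^ 4) \<le> avg (Omega F Q) (\<lambda>G. 8 * (D1 - 2 * q * real n) ^ 4 + 8 * (onlysum F a b G - 2 * q * real n) ^ 4)"
  proof (rule avg_mono)
    fix G
    have "(D1 - onlysum F a b G) ^ 4 \<le> 8 * \<bar>D1 - 2 * q * real n\<bar> ^ 4 + 8 * (onlysum F a b G - 2 * q * real n) ^ 4"
      by (rule power4_le_of_abs) linarith
    then show "(D1 - onlysum F a b G) ^ 4 \<le> 8 * (D1 - 2 * q * real n) ^ 4 + 8 * (onlysum F a b G - 2 * q * real n) ^ 4"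
      by simp
  qed
  also have "\<dots> = 8 * (D1 - 2 * q * real n) ^ 4 + 8 * avg (Omega F Q) (\<lambda>G. (onlysum F a b G - 2 * q * real n) ^ 4)"
    unfolding avg_add avg_cmult avg_const[OF finite_Om ne] by simp
  finally have "\<bar>avg (Omega F Q) (\<lambda>G. (D1 - onlysum F a b G) ^ 4)\<bar> \<le> \<dots>"
    using avg_nonneg[of "Omega F Q" "\<lambda>G. (D1 - onlysum F a b G) ^ 4"] by simp
  moreover have "bd 18 4 (8 * (D1 - 2 * q * real n) ^ 4 + 8 * avg (Omega F Q) (\<lambda>G. (onlysum F a b G - 2 * q * real n) ^ 4))"
    by (rule bd_addI[OF bd_mult[OF bd_const[of 8] bd_power[OF assms(6)]] bd_mult[OF bd_const[of 8] bd_only_sum_moment[OF assms(1-5)]]]) auto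
  ultimately show ?thesis using bd_le by blast
qed

text \<open>Obtained from the fourth moment by \<open>x * n \<le> n^2 + x^2\<close> with
  \<open>x\<close> the square of the deviation. The first absolute moment follows from the second in
  the same way, with \<open>r\<close> in place of \<open>n\<close>.\<close>

lemma bd_W2:
  assumes "cls k F Q" "k \<le> 10" "a < n" "b < n" "a \<noteq> b" "bd 4 1 (D1 - 2 * q * real n)"
  shows "bd 19 2 (avg (Omega F Q) (\<lambda>G. (D1 - onlysum F a b G) ^ 2))"
proof -
  have ne: "Omega F Q \<noteq> {}" using clsD(4)[OF assms(1)] .
  have "avg (Omega F Q) (\<lambda>G. (D1 - onlysum F a b G) ^ 2) \<le> avg (Omega F Q) (\<lambda>G. real n + (1 / real n) * (D1 - onlysum F a b G) ^ 4)"
  proof (rule avg_mono)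
    fix G
    define x where "x = (D1 - onlysum F a b G) ^ 2"
    have "x * real n \<le> real n * real n + x * x" by (rule mult_le_sum_squares)
    then have "x \<le> real n + (1 / real n) * (x * x)" using n_ge by (simp add: field_simps)
    moreover have "x * x = (D1 - onlysum F a b G) ^ 4" by (simp add: x_def power4_eq_xxxx power2_eq_square)
    ultimately show "(D1 - onlysum F a b G) ^ 2 \<le> real n + (1 / real n) * (D1 - onlysum F a b G) ^ 4" by (simp add: x_def)
  qed
  also have "\<dots> = real n + (1 / real n) * avg (Omega F Q) (\<lambda>G. (D1 - onlysum F a b G) ^ 4)"
    unfolding avg_add avg_cmult avg_const[OF finite_Om ne] by simp
  finally have "\<bar>avg (Omega F Q) (\<lambda>G. (D1 - onlysum F a b G) ^ 2)\<bar> \<le> \<dots>"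
    using avg_nonneg[of "Omega F Q" "\<lambda>G. (D1 - onlysum F a b G) ^ 2"] by simp
  moreover have "bd 19 2 (real n + (1 / real n) * avg (Omega F Q) (\<lambda>G. (D1 - onlysum F a b G) ^ 4))"
    by (rule bd_addI[OF bd_n(1) bd_mult[OF bd_n(2) bd_W4[OF assms]]]) auto
  ultimately show ?thesis using bd_le by blast
qed

lemma bd_W1:
  assumes "cls k F Q" "k \<le> 10" "a < n" "b < n" "a \<noteq> b" "bd 4 1 (D1 - 2 * q * real n)"
  shows "bd 20 1 (avg (Omega F Q) (\<lambda>G. \<bar>D1 - onlysum F a b G\<bar>))"
proof -
  have ne: "Omega F Q \<noteq> {}" using clsD(4)[OF assms(1)] .
  have "avg (Omega F Q) (\<lambda>G. \<bar>D1 - onlysum F a b G\<bar>) \<le> avg (Omega F Q) (\<lambda>G. r + (1 / r) * (D1 - onlysum F a b G) ^ 2)"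
  proof (rule avg_mono)
    fix G
    define x where "x = \<bar>D1 - onlysum F a b G\<bar>"
    have "x * r \<le> r * r + x * x" by (rule mult_le_sum_squares)
    then have "x \<le> r + (1 / r) * (x * x)" using r_pos by (simp add: field_simps)
    moreover have "x * x = (D1 - onlysum F a b G) ^ 2" by (simp add: x_def power2_eq_square)
    ultimately show "\<bar>D1 - onlysum F a b G\<bar> \<le> r + (1 / r) * (D1 - onlysum F a b G) ^ 2" by (simp add: x_def)
  qed
  also have "\<dots> = r + (1 / r) * avg (Omega F Q) (\<lambda>G. (D1 - onlysum F a b G) ^ 2)"
    unfolding avg_add avg_cmult avg_const[OF finite_Om ne] by simp
  finally have "\<bar>avg (Omega F Q) (\<lambda>G. \<bar>D1 - onlysum F a b G\<bar>)\<bar> \<le> \<dots>"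
    using avg_nonneg[of "Omega F Q" "\<lambda>G. \<bar>D1 - onlysum F a b G\<bar>"] by simp
  moreover have "bd 0 (-1) (1 / r)" using r_pos by (simp add: bd_def power_int_minus field_simps)
  then have "bd 20 1 (r + (1 / r) * avg (Omega F Q) (\<lambda>G. (D1 - onlysum F a b G) ^ 2))"
    by (intro bd_addI[OF bd_r bd_mult[OF _ bd_W2[OF assms]]]) auto
  ultimately show ?thesis using bd_le by blast
qed

text \<open>The centre \<open>D1\<close> is left open within order \<open>r\<close> of
  \<open>2 * q * n\<close>: the first round takes this value itself, the second the refined
  \<open>Dmean\<close>. The two remainders have orders \<open>r * r^2 / r^6\<close> and
  \<open>r^4 / r^8\<close>.\<close>

lemma avg_ratio_expansion:
  assumes "cls k F Q" "k \<le> 10" "a < n" "b < n" "a \<noteq> b" "v < n" "(a,v) \<notin> F" "(b,v) \<notin> F" and D1: "bd 4 1 (D1 - 2 * q * real n)"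
  shows "bd 30 (-3) ((pr F Q a v - pr F Q b v) - (avg (Omega F Q) (\<lambda>G. xor a b v G * onlydiff F a b G) * (1 / D1)
     + avg (Omega F Q) (\<lambda>G. xor a b v G * (onlydiff F a b G * (D1 - onlysum F a b G))) * (1 / D1) ^ 2))"
proof -
  note D1f = D1_facts[OF D1]
  let ?N = "\<lambda>G. onlydiff F a b G" and ?D = "\<lambda>G. onlysum F a b G"
  let ?W2 = "avg (Omega F Q) (\<lambda>G. (D1 - onlysum F a b G) ^ 2)" and ?W4 = "avg (Omega F Q) (\<lambda>G. (D1 - onlysum F a b G) ^ 4)"
  have "(pr F Q a v - pr F Q b v) - (avg (Omega F Q) (\<lambda>G. xor a b v G * ?N G) * (1 / D1)
     + avg (Omega F Q) (\<lambda>G. xor a b v G * (?N G * (D1 - ?D G))) * (1 / D1) ^ 2)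
     = avg (Omega F Q) (\<lambda>G. xor a b v G * (?N G / ?D G)) - (1 / D1 * avg (Omega F Q) (\<lambda>G. xor a b v G * ?N G)
      + (1 / D1) ^ 2 * avg (Omega F Q) (\<lambda>G. xor a b v G * (?N G * (D1 - ?D G))))"
    unfolding avg_row_difference[OF assms(5,3,4,6-8)] by (simp only: mult.commute)
  also have "\<dots> = avg (Omega F Q) (\<lambda>G. xor a b v G * (?N G / ?D G) - (1 / D1 * (xor a b v G * ?N G)
      + (1 / D1) ^ 2 * (xor a b v G * (?N G * (D1 - ?D G)))))"
    by (simp only: avg_diff avg_add avg_cmult)
  finally have eq: "(pr F Q a v - pr F Q b v) - (avg (Omega F Q) (\<lambda>G. xor a b v G * ?N G) * (1 / D1)
     + avg (Omega F Q) (\<lambda>G. xor a b v G * (?N G * (D1 - ?D G))) * (1 / D1) ^ 2)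
     = avg (Omega F Q) (\<lambda>G. xor a b v G * (?N G / ?D G) - (1 / D1 * (xor a b v G * ?N G)
      + (1 / D1) ^ 2 * (xor a b v G * (?N G * (D1 - ?D G)))))" .
  have "\<bar>avg (Omega F Q) (\<lambda>G. xor a b v G * (?N G / ?D G) - (1 / D1 * (xor a b v G * ?N G)
      + (1 / D1) ^ 2 * (xor a b v G * (?N G * (D1 - ?D G)))))\<bar>
     \<le> avg (Omega F Q) (\<lambda>G. \<bar>xor a b v G * (?N G / ?D G) - (1 / D1 * (xor a b v G * ?N G)
      + (1 / D1) ^ 2 * (xor a b v G * (?N G * (D1 - ?D G))))\<bar>)" by (rule avg_abs)
  also have "\<dots> \<le> avg (Omega F Q) (\<lambda>G. 2 * (5 * \<theta> * r) / D1 ^ 3 * (D1 - ?D G) ^ 2 + 4 / D1 ^ 4 * (D1 - ?D G) ^ 4)"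
  proof (rule avg_mono)
    fix G assume G: "G \<in> Omega F Q"
    show "\<bar>xor a b v G * (?N G / ?D G) - (1 / D1 * (xor a b v G * ?N G)
      + (1 / D1) ^ 2 * (xor a b v G * (?N G * (D1 - ?D G))))\<bar> \<le> 2 * (5 * \<theta> * r) / D1 ^ 3 * (D1 - ?D G) ^ 2 + 4 / D1 ^ 4 * (D1 - ?D G) ^ 4"
    proof (cases "((a,v) \<in> G) \<noteq> ((b,v) \<in> G)")
      case True
      then have "v \<in> only n F a b G \<or> v \<in> only n F b a G" using assms by (auto simp: only_def free2_def)
      then have "card (only n F a b G) > 0 \<or> card (only n F b a G) > 0" by (auto simp: card_gt_0_iff)
      then have pos: "?D G > 0" by auto
      show ?thesis
        using expansion_le[OF _ _ pos only_diff[OF assms(1-4) G] D1f(1)] True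
        by (simp add: power_one_over diff_diff_eq mult_ac)
    next
      case False
      then show ?thesis using theta_pos r_pos D1f(1) by simp
    qed
  qed
  also have "\<dots> = 10 * \<theta> * r * (1 / D1) ^ 3 * ?W2 + 4 * (1 / D1) ^ 4 * ?W4"
    unfolding avg_add avg_cmult power_one_over by simp
  finally have le: "\<bar>avg (Omega F Q) (\<lambda>G. xor a b v G * (?N G / ?D G) - (1 / D1 * (xor a b v G * ?N G)
      + (1 / D1) ^ 2 * (xor a b v G * (?N G * (D1 - ?D G)))))\<bar> \<le> 10 * \<theta> * r * (1 / D1) ^ 3 * ?W2 + 4 * (1 / D1) ^ 4 * ?W4" .
  have 1: "bd 29 (-3) (10 * \<theta> * r * (1 / D1) ^ 3 * ?W2)"
    by (rule bd_weaken[OF bd_mult[OF bd_mult[OF bd_mult[OF bd_mult[OF bd_const[of 10] bd_theta] bd_r] bd_power[OF D1f(2), of 3]] bd_W2[OF assms(1-5) D1]]]) auto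
  have 2: "bd 29 (-4) (4 * (1 / D1) ^ 4 * ?W4)"
    by (rule bd_weaken[OF bd_mult[OF bd_mult[OF bd_const[of 4] bd_power[OF D1f(2), of 4]] bd_W4[OF assms(1-5) D1]]]) auto
  have "bd 30 (-3) (10 * \<theta> * r * (1 / D1) ^ 3 * ?W2 + 4 * (1 / D1) ^ 4 * ?W4)"
    by (rule bd_addI[OF 1 2]) auto
  then show ?thesis unfolding eq using le by (rule bd_le)
qed

lemma sdiff_bd: "a < n \<Longrightarrow> b < n \<Longrightarrow> bd 2 1 (real (s a) - real (s b))"
proof -
  assume "a < n" "b < n"
  then have "\<bar>real (s a) - real (s b)\<bar> \<le> 2 * (\<theta> * r)" using s_dev[of a] s_dev[of b] by linarith
  also have "\<dots> \<le> \<theta> * (\<theta> * r)" using theta_ge theta_r by (intro mult_right_mono) auto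
  finally show ?thesis by (simp add: bd_def power2_eq_square)
qed

lemma card_two_insert: "card (insert x (insert y F) - F) \<le> 10"
proof -
  have "card (insert x (insert y F) - F) \<le> card {x, y}" by (intro card_mono) auto
  also have "\<dots> \<le> 10" by (simp add: card_insert_if)
  finally show ?thesis .
qed

text \<open>At this accuracy absolute values still suffice for the linear term, of order
  \<open>r * r / r^4\<close>. The probability of \<open>xor\<close> is close to \<open>2 * q\<close>
  and cancels against the centre \<open>2 * q * n\<close>, leaving the slope \<open>1 / n\<close>.
  The bound on \<open>k\<close> leaves room for freezing two more cells.\<close>

lemma pr_diff_first:
  assumes "cls k F Q" "k \<le> 8" "a < n" "b < n" "v < n" "(a,v) \<notin> F" "(b,v) \<notin> F"
  shows "bd 32 (-2) ((pr F Q a v - pr F Q b v) - (dd F a - dd F b) / real n)"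
proof (cases "a = b")
  case True then show ?thesis by (simp add: bd_0)
next
  case False
  have k: "k \<le> 10" "k \<le> 9" "Suc k \<le> 10" "Suc (Suc k) \<le> 10" using assms(2) by auto
  let ?D0 = "2 * q * real n"
  let ?\<mu> = "avg (Omega F Q) (xor a b v)"
  let ?N = "avg (Omega F Q) (\<lambda>G. xor a b v G * onlydiff F a b G)"
  let ?NW = "avg (Omega F Q) (\<lambda>G. xor a b v G * (onlydiff F a b G * (?D0 - onlysum F a b G)))"
  let ?d = "dd F a - dd F b"
  have D0: "bd 4 1 (?D0 - ?D0)" by (simp add: bd_0)
  note e1 = avg_ratio_expansion[OF assms(1) k(1) assms(3,4) False assms(5-7) D0]
  note ca = cls_insert(1)[OF assms(1) k(1) assms(3,5,6)]
  note cb = cls_insert(1)[OF assms(1) k(1) assms(4,5,7)]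
  have bva: "(b,v) \<notin> insert (a,v) F" and avb: "(a,v) \<notin> insert (b,v) F" using False assms by auto
  note cab = cls_insert(2)[OF ca k(3) assms(4,5) bva]
  note cba = cls_insert(2)[OF cb k(3) assms(3,5) avb]
  have N: "bd 13 0 (?N - ?\<mu> * ?d)"
    by (rule bd_weaken[OF bd_avg_xor[OF assms(1) k(2) False assms(3-7)
        avg_onlydiff_rough[OF assms(1) k(1) cab k(4) _ card_two_insert assms(3,4)]
        avg_onlydiff_rough[OF assms(1) k(1) cba k(4) _ card_two_insert assms(3,4)]]]) auto
  have NW: "bd 22 2 ?NW"
  proof -
    have "\<bar>?NW\<bar> \<le> avg (Omega F Q) (\<lambda>G. 5 * \<theta> * r * \<bar>?D0 - onlysum F a b G\<bar>)"
    proof (rule order_trans[OF avg_abs avg_mono])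
      fix G assume G: "G \<in> Omega F Q"
      have "\<bar>xor a b v G * (onlydiff F a b G * (?D0 - onlysum F a b G))\<bar> \<le> \<bar>onlydiff F a b G\<bar> * \<bar>?D0 - onlysum F a b G\<bar>"
        by (simp add: abs_mult)
      also have "\<dots> \<le> 5 * \<theta> * r * \<bar>?D0 - onlysum F a b G\<bar>"
        using only_diff[OF assms(1) k(1) assms(3,4) G] by (intro mult_right_mono) auto
      finally show "\<bar>xor a b v G * (onlydiff F a b G * (?D0 - onlysum F a b G))\<bar> \<le> 5 * \<theta> * r * \<bar>?D0 - onlysum F a b G\<bar>" .
    qed
    also have "\<dots> = 5 * \<theta> * r * avg (Omega F Q) (\<lambda>G. \<bar>?D0 - onlysum F a b G\<bar>)" by (rule avg_cmult)
    finally have "\<bar>?NW\<bar> \<le> 5 * \<theta> * r * avg (Omega F Q) (\<lambda>G. \<bar>?D0 - onlysum F a b G\<bar>)" .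
    moreover have "bd 22 2 (5 * \<theta> * r * avg (Omega F Q) (\<lambda>G. \<bar>?D0 - onlysum F a b G\<bar>))"
      by (rule bd_weaken[OF bd_mult[OF bd_mult[OF bd_mult[OF bd_const[of 5] bd_theta] bd_r] bd_W1[OF assms(1) k(1) assms(3,4) False D0]]]) auto
    ultimately show ?thesis using bd_le by blast
  qed
  have mu: "bd 9 (-1) (?\<mu> - 2 * q)"
  proof -
    let ?x = "pr F Q a v" and ?y = "pr F Q b v" and ?x' = "pr (insert (b,v) F) (insert (b,v) Q) a v" and ?y' = "pr (insert (a,v) F) (insert (a,v) Q) b v"
    have "?\<mu> - 2 * q = ((?x - l) * (1 - ?y') - l * (?y' - l)) + ((?y - l) * (1 - ?x') - l * (?x' - l))"
      unfolding avg_xor[OF assms(1) k(2) False assms(3-7)] by (simp add: algebra_simps)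
    moreover have "bd 7 (-1) ((?x - l) * (1 - ?y') - l * (?y' - l))"
      by (rule bd_diffI[OF bd_mult[OF pr_rough[OF assms(1) k(1) assms(3,5,6)] bd_pr(2)] bd_mult[OF bd_l(1) pr_rough[OF ca k(3) assms(4,5) bva]]]) auto
    moreover have "bd 7 (-1) ((?y - l) * (1 - ?x') - l * (?x' - l))"
      by (rule bd_diffI[OF bd_mult[OF pr_rough[OF assms(1) k(1) assms(4,5,7)] bd_pr(2)] bd_mult[OF bd_l(1) pr_rough[OF cb k(3) assms(3,5) avb]]]) auto
    ultimately show ?thesis by (simp only: bd_addI[of 7 "-1" _ 7 "-1" _ 9 "-1"]) 
  qed
  have d: "bd 3 1 ?d" by (rule bd_diffI[OF bd_dd(1)[OF assms(1) k(1) assms(3)] bd_dd(1)[OF assms(1) k(1) assms(4)]]) auto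
  have "(pr F Q a v - pr F Q b v) - ?d / real n
    = ((pr F Q a v - pr F Q b v) - (?N * (1 / ?D0) + ?NW * (1 / ?D0) ^ 2))
      + ((?N - ?\<mu> * ?d) * (1 / ?D0) + ?NW * (1 / ?D0) ^ 2) + (?\<mu> - 2 * q) * ?d * (1 / ?D0)"
  proof -
    have "2 * x * y * (1 / (2 * x * real n)) = y / real n" if "x > 0" for x y :: real using that n_ge by simp
    then have "2 * q * ?d * (1 / ?D0) = ?d / real n" using q_ge(2) by blast
    then show ?thesis by (simp only: ring_distribs)
  qed
  moreover have "bd 30 (-2) ((pr F Q a v - pr F Q b v) - (?N * (1 / ?D0) + ?NW * (1 / ?D0) ^ 2))"
    by (rule bd_weaken[OF e1]) auto
  moreover have "bd 30 (-2) ((?N - ?\<mu> * ?d) * (1 / ?D0) + ?NW * (1 / ?D0) ^ 2)"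
    by (rule bd_addI[OF bd_mult[OF N bd_invD0] bd_mult[OF NW bd_power[OF bd_invD0, of 2]]]) auto
  moreover have "bd 30 (-2) ((?\<mu> - 2 * q) * ?d * (1 / ?D0))"
    by (rule bd_weaken[OF bd_mult[OF bd_mult[OF mu d] bd_invD0]]) auto
  moreover have "bd 32 (-2) (x + y + z)" if "bd 30 (-2) x" "bd 30 (-2) y" "bd 30 (-2) z" for x y z
    by (rule bd_addI[OF bd_add[OF that(1,2)] that(3)]) auto
  ultimately show ?thesis by (simp only:)
qed

lemma pr_first:
  assumes "cls k F Q" "k \<le> 8" "a < n" "v < n" "(a,v) \<notin> F"
  shows "bd 36 (-2) (pr F Q a v - (l + (dd F a + ee F v) * (1 / real n)))"
proof -
  have k: "k \<le> 10" using assms(2) by auto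
  define m where "m = real (card (freecol F v))"
  have m: "m \<ge> real n / 2" "bd 1 (-2) (1 / m)" "m = real n - real (card (cl F v))" "m > 0"
    using freecol_ge[OF assms(1) k assms(4)] card_freecol[OF assms(1)] n_ge unfolding m_def by auto
  have bm: "bd 0 2 m" using m bd_le[OF bd_n(1), of m] by simp
  define X where "X = (\<Sum>b\<in>freecol F v. (pr F Q a v - pr F Q b v) - (dd F a - dd F b) / real n)"
  define S where "S = (\<Sum>b\<in>cl F v. dd F b)"
  have Sd: "(\<Sum>b\<in>freecol F v. dd F b) = sig F - S"
  proof -
    have "cl F v \<subseteq> {..<n}" using cl_subset[OF clsD(1)[OF assms(1)]] .
    moreover have "freecol F v = {..<n} - cl F v" by (auto simp: freecol_def)
    ultimately show ?thesis using sum_dd(1)[OF assms(1)] by (simp add: S_def sum_diff)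
  qed
  have bX: "bd 32 0 X"
  proof -
    have "bd (32 + 0) (-2 + 2) X" unfolding X_def
      using bm assms by (intro bd_sum pr_diff_first) (auto simp: m_def freecol_def)
    then show ?thesis by simp
  qed
  have bS: "bd 4 2 S"
  proof -
    have "bd (2 + 2) (1 + 1) S" unfolding S_def
      using cl_subset[OF clsD(1)[OF assms(1)], of v]
      by (intro bd_sum bd_dd(1)[OF assms(1) k] bd_rwF(2)[OF assms(1) k assms(4)]) auto
    then show ?thesis by simp
  qed
  have "X = m * pr F Q a v - (real (t v) - real (card (cl Q v))) - (m * dd F a - (sig F - S)) / real n"
    using sum_pr[OF assms(1,4)] Sd unfolding X_def
    by (simp add: sum_subtractf m_def sum_divide_distrib[symmetric])
  then have mp: "m * pr F Q a v = X + (real (t v) - real (card (cl Q v))) + (m * dd F a - (sig F - S)) / real n" by linarith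
  have tv: "real (t v) = l * m + ee F v" by (simp add: ee_def m(3) algebra_simps)
  have mn: "m / real n = 1 - real (card (cl F v)) / real n" using n_ge by (simp add: m(3) field_simps)
  have "m * (pr F Q a v - (l + (dd F a + ee F v) * (1 / real n)))
     = m * pr F Q a v - m * l - (m * dd F a) / real n - (m / real n) * ee F v" by (simp add: algebra_simps)
  also have "\<dots> = X - real (card (cl Q v)) - (sig F - S) * (1 / real n) + real (card (cl F v)) * ee F v * (1 / real n)"
    unfolding mp tv mn by (simp add: algebra_simps diff_divide_distrib add_divide_distrib)
  finally have eq: "pr F Q a v - (l + (dd F a + ee F v) * (1 / real n))
     = (X - real (card (cl Q v)) - (sig F - S) * (1 / real n) + real (card (cl F v)) * ee F v * (1 / real n)) * (1 / m)"
    using m(4) by (simp add: field_simps)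
  have c: "bd 1 0 (real (card (cl Q v)))"
    using card_clQ(1)[OF assms(1), of v] k by (intro bd_const) auto
  have 1: "bd 6 0 ((sig F - S) * (1 / real n))"
    by (rule bd_multI[OF bd_diffI[OF bd_sig[OF assms(1) k] bS, of 5 2] bd_n(2)]) auto
  have 2: "bd 6 0 (real (card (cl F v)) * ee F v * (1 / real n))"
    by (rule bd_weaken[OF bd_mult[OF bd_mult[OF bd_rwF(2)[OF assms(1) k assms(4)] bd_dd(2)[OF assms(1) k assms(4)]] bd_n(2)]]) auto
  have 3: "bd 33 0 (X - real (card (cl Q v)))" by (rule bd_diffI[OF bX c]) auto
  have 4: "bd 34 0 (X - real (card (cl Q v)) - (sig F - S) * (1 / real n))" by (rule bd_diffI[OF 3 1]) auto
  have 5: "bd 35 0 (X - real (card (cl Q v)) - (sig F - S) * (1 / real n) + real (card (cl F v)) * ee F v * (1 / real n))"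
    by (rule bd_addI[OF 4 2]) auto
  show ?thesis unfolding eq by (rule bd_multI[OF 5 m(2)]) auto
qed

end

subsection \<open>Cell probabilities to second order\<close>

lemma sum_of_bool_mem: "finite M \<Longrightarrow> (\<Sum>u\<in>M. of_bool (u \<in> X) :: real) = real (card (X \<inter> M))"
  by (simp add: of_bool_def sum.If_cases Int_commute)

context near_regular begin

lemma card_rw_ext:
  assumes "F \<subseteq> F'" "card (F' - F) \<le> 10" "F' \<subseteq> {..<n} \<times> {..<n}"
  shows "card (rw F a) \<le> card (rw F' a)" "card (rw F' a) \<le> card (rw F a) + 10"
    "card (cl F a) \<le> card (cl F' a)" "card (cl F' a) \<le> card (cl F a) + 10"
    "card (rw (F' - F) a) \<le> 10"
proof -
  have fin: "finite (rw F' a)" "finite (cl F' a)" "finite F'"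
    using finite_rw[OF assms(3)] finite_cl[OF assms(3)] finite_subset[OF assms(3)] by auto
  have fs: "finite (rw F a)" "finite (cl F a)" "finite (rw (F' - F) a)" "finite (cl (F' - F) a)"
    by (rule finite_subset[OF _ fin(1)] finite_subset[OF _ fin(2)], use assms(1) in auto)+
  show "card (rw F a) \<le> card (rw F' a)" "card (cl F a) \<le> card (cl F' a)"
    using assms(1) fin by (auto intro!: card_mono)
  have "rw (F' - F) a \<subseteq> snd ` (F' - F)" "cl (F' - F) a \<subseteq> fst ` (F' - F)" by force+
  then have "card (rw (F' - F) a) \<le> card (snd ` (F' - F))" "card (cl (F' - F) a) \<le> card (fst ` (F' - F))"
    using fin by (auto intro!: card_mono)
  then have le: "card (rw (F' - F) a) \<le> 10" "card (cl (F' - F) a) \<le> 10"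
    using card_image_le[of "F' - F" snd] card_image_le[of "F' - F" fst] fin(3) assms(2) by auto
  then show "card (rw (F' - F) a) \<le> 10" by simp
  have "card (rw F' a) \<le> card (rw F a \<union> rw (F' - F) a)" "card (cl F' a) \<le> card (cl F a \<union> cl (F' - F) a)"
    using fs by (auto intro!: card_mono)
  then show "card (rw F' a) \<le> card (rw F a) + 10" "card (cl F' a) \<le> card (cl F a) + 10"
    using le card_Un_le[of "rw F a" "rw (F' - F) a"] card_Un_le[of "cl F a" "cl (F' - F) a"] by linarith+
qed

lemma dd_ext:
  assumes "F \<subseteq> F'" "card (F' - F) \<le> 10" "F' \<subseteq> {..<n} \<times> {..<n}"
  shows "bd 1 0 (dd F' a - dd F a)" "bd 1 0 (ee F' a - ee F a)"
proof -
  have "dd F' a - dd F a = l * (real (card (rw F' a)) - real (card (rw F a)))"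
    "ee F' a - ee F a = l * (real (card (cl F' a)) - real (card (cl F a)))" by (simp_all add: dd_def ee_def algebra_simps)
  moreover have "bd 1 0 (real (card (rw F' a)) - real (card (rw F a)))" "bd 1 0 (real (card (cl F' a)) - real (card (cl F a)))"
    by (rule bd_const, use card_rw_ext[OF assms, of a] in linarith)+
  ultimately show "bd 1 0 (dd F' a - dd F a)" "bd 1 0 (ee F' a - ee F a)"
    by (simp_all only:) (rule bd_multI[OF bd_l(1)], assumption, auto)+
qed

text \<open>Freezing a bounded number of cells moves \<open>dd\<close> and \<open>ee\<close> by a
  bounded amount and hence the estimate by order \<open>1 / n\<close>. Stated with the original
  \<open>F\<close>, it makes conditional means under different freezings comparable.\<close>

lemma pr_first_ext:
  assumes "cls k F' Q'" "k \<le> 8" "F \<subseteq> F'" "card (F' - F) \<le> 10" "a < n" "v < n" "(a,v) \<notin> F'"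
  shows "bd 37 (-2) (pr F' Q' a v - (l + (dd F a + ee F v) * (1 / real n)))"
proof -
  note e = dd_ext[OF assms(3,4) clsD(1)[OF assms(1)]]
  have "pr F' Q' a v - (l + (dd F a + ee F v) * (1 / real n))
    = (pr F' Q' a v - (l + (dd F' a + ee F' v) * (1 / real n))) + ((dd F' a - dd F a) + (ee F' v - ee F v)) * (1 / real n)"
    by (simp add: algebra_simps)
  moreover have "bd 2 (-2) (((dd F' a - dd F a) + (ee F' v - ee F v)) * (1 / real n))"
    by (rule bd_multI[OF bd_addI[OF e(1) e(2), of 2 0] bd_n(2)]) auto
  ultimately show ?thesis
    by (simp only:) (rule bd_addI[OF pr_first[OF assms(1,2,5-7)]], assumption, auto)
qed

lemma bd_z:
  assumes "cls k F Q" "k \<le> 10" "a < n" "v < n"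
  shows "bd 3 (-1) ((dd F a + ee F v) * (1 / real n))"
  by (rule bd_multI[OF bd_addI[OF bd_dd(1)[OF assms(1-3)] bd_dd(2)[OF assms(1,2,4)], of 3 1] bd_n(2)]) auto

text \<open>The chain rule: the probability of one cell times that of the other after freezing the
  first. The product of the two first-order corrections is already of the order of the
  error.\<close>

lemma pair_pr:
  assumes "cls k0 F Q" "k0 \<le> 10" "cls k F' Q'" "k \<le> 7" "F \<subseteq> F'" "card (F' - F) \<le> 9"
    and "a \<noteq> b" "a < n" "b < n" "u < n" "(a,u) \<notin> F'" "(b,u) \<notin> F'"
  shows "bd 43 (-2) (avg (Omega F' Q') (\<lambda>G. of_bool ((a,u) \<in> G) * of_bool ((b,u) \<in> G))
     - (l\<^sup>2 + l * ((dd F a + ee F u) * (1 / real n) + (dd F b + ee F u) * (1 / real n))))"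
proof -
  let ?F = "insert (a,u) F'" and ?Q = "insert (a,u) Q'"
  have k: "k \<le> 10" "k \<le> 8" "Suc k \<le> 8" "card (F' - F) \<le> 10" using assms by auto
  have cF: "card (?F - F) \<le> 10"
  proof -
    have "card (?F - F) \<le> card (insert (a,u) (F' - F))" using clsD(5)[OF assms(3)] by (intro card_mono) auto
    also have "\<dots> \<le> Suc (card (F' - F))" by (rule card_insert_le_m1) auto
    finally show ?thesis using assms(6) by simp
  qed
  note c = cls_insert(1)[OF assms(3) k(1) assms(8,10,11)]
  define x y where "x = pr F' Q' a u" and "y = pr ?F ?Q b u"
  define za zb where "za = (dd F a + ee F u) * (1 / real n)" and "zb = (dd F b + ee F u) * (1 / real n)"
  have x: "bd 37 (-2) (x - (l + za))" unfolding x_def za_def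
    by (rule pr_first_ext[OF assms(3) k(2) assms(5) k(4) assms(8,10,11)])
  have y: "bd 37 (-2) (y - (l + zb))" unfolding y_def zb_def
    using assms by (intro pr_first_ext[OF c k(3) _ cF]) auto
  have z: "bd 3 (-1) za" "bd 3 (-1) zb" unfolding za_def zb_def
    using bd_z[OF assms(1,2,8,10)] bd_z[OF assms(1,2,9,10)] by auto
  have "avg (Omega F' Q') (\<lambda>G. of_bool ((a,u) \<in> G) * of_bool ((b,u) \<in> G)) = x * y"
    unfolding x_def y_def by (rule avg_incl[OF assms(11) clsD(2)[OF assms(3)]])
  moreover have "x * y - (l\<^sup>2 + l * (za + zb)) = (x * (y - (l + zb)) + (x - (l + za)) * (l + zb)) + za * zb"
    by (simp add: algebra_simps power2_eq_square)
  moreover have "bd 42 (-2) (x * (y - (l + zb)) + (x - (l + za)) * (l + zb))"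
  proof (rule bd_addI)
    show "bd 37 (-2) (x * (y - (l + zb)))" by (rule bd_multI[OF _ y, of 0 0]) (auto simp: x_def bd_pr)
    have "bd 4 0 (l + zb)" by (rule bd_addI[OF bd_l(1) z(2)]) auto
    then show "bd 41 (-2) ((x - (l + za)) * (l + zb))" by (rule bd_multI[OF x]) auto
  qed auto
  moreover have "bd 6 (-2) (za * zb)" by (rule bd_multI[OF z]) auto
  ultimately show ?thesis unfolding za_def[symmetric] zb_def[symmetric]
    by (simp only:) (rule bd_addI, assumption, assumption, auto)
qed

lemma card_free2:
  assumes "cls k F Q" shows "real (card (free2 n F a b)) = real n - real (card (frozen2 F a b))"
proof -
  have "{..<n} \<inter> free2 n F a b = free2 n F a b" by (auto simp: free2_def)
  moreover have "{..<n} \<inter> frozen2 F a b = frozen2 F a b" using frozen2_subset(1)[OF assms] by (rule Int_absorb1)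
  ultimately show ?thesis using card_split_frozen[of "{..<n}" n F a b] by simp
qed

lemma sum_ee_free2:
  assumes "cls k F Q"
  shows "(\<Sum>u\<in>free2 n F a b. ee F u) = sig F - (\<Sum>u\<in>frozen2 F a b. ee F u)"
proof -
  have "free2 n F a b = {..<n} - frozen2 F a b" by (auto simp: free2_def)
  then show ?thesis using sum_dd(2)[OF assms] frozen2_subset[OF assms, of a b] by (simp add: sum_diff)
qed

lemma bd_sum_ee:
  assumes "cls k F Q" "k \<le> 10" "a < n" "b < n"
  shows "bd 4 2 (\<Sum>u\<in>frozen2 F a b. ee F u)"
  by (rule bd_weaken[OF bd_sum[OF bd_dd(2)[OF assms(1,2)] bd_frozen2[OF assms]]])
    (use frozen2_subset[OF assms(1), of a b] in auto)

text \<open>Up to powers of \<open>\<theta>\<close>, \<open>n\<close> columns with error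
  \<open>1 / n\<close> each give a bounded error. The \<open>ee\<close> part sums to
  \<open>sig F\<close> minus a sum over frozen columns, and after division by \<open>n\<close> it is
  bounded as well. At most 20 columns are lost by freezing further cells, and each of them is
  estimated trivially.\<close>

lemma cod_mean:
  assumes "cls k0 F Q" "k0 \<le> 10" "cls k F' Q'" "k \<le> 7" "F \<subseteq> F'" "card (F' - F) \<le> 9"
    and "a \<noteq> b" "a < n" "b < n"
  shows "bd 45 0 (avg (Omega F' Q') (\<lambda>G. real (card (rw G a \<inter> rw G b \<inter> free2 n F a b)))
     - (l\<^sup>2 * real (card (free2 n F a b)) + l * (dd F a + dd F b)))"
proof -
  define M M' where "M = free2 n F a b" and "M' = free2 n F' a b"
  let ?U = "frozen2 F a b"
  define c where "c u = avg (Omega F' Q') (\<lambda>G. of_bool ((a,u) \<in> G) * of_bool ((b,u) \<in> G))" for u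
  define h where "h u = l\<^sup>2 + l * ((dd F a + ee F u) * (1 / real n) + (dd F b + ee F u) * (1 / real n))" for u
  have fM: "finite M" "M' \<subseteq> M" using assms(5) by (auto simp: M_def M'_def free2_def)
  have ne: "Omega F' Q' \<noteq> {}" using clsD(4)[OF assms(3)] .
  have "avg (Omega F' Q') (\<lambda>G. real (card (rw G a \<inter> rw G b \<inter> M)))
    = avg (Omega F' Q') (\<lambda>G. \<Sum>u\<in>M. of_bool ((a,u) \<in> G) * of_bool ((b,u) \<in> G))"
  proof (rule avg_cong)
    fix G
    have "(\<Sum>u\<in>M. of_bool ((a,u) \<in> G) * of_bool ((b,u) \<in> G)) = (\<Sum>u\<in>M. of_bool (u \<in> rw G a \<inter> rw G b) :: real)"
      by (intro sum.cong) auto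
    also have "\<dots> = real (card (rw G a \<inter> rw G b \<inter> M))"
      using fM(1) by (rule sum_of_bool_mem)
    finally show "real (card (rw G a \<inter> rw G b \<inter> M)) = (\<Sum>u\<in>M. of_bool ((a,u) \<in> G) * of_bool ((b,u) \<in> G))" by simp
  qed
  also have "\<dots> = (\<Sum>u\<in>M. c u)" by (simp add: avg_sum c_def)
  also have "\<dots> = (\<Sum>u\<in>M'. c u - h u) + (\<Sum>u\<in>M - M'. c u - h u) + (\<Sum>u\<in>M. h u)"
    using sum.subset_diff[OF fM(2) fM(1), of "\<lambda>u. c u - h u"] by (simp add: sum_subtractf)
  also have "(\<Sum>u\<in>M. h u) = l\<^sup>2 * real (card M) + l * (dd F a + dd F b) * (real (card M) / real n) + 2 * l * (\<Sum>u\<in>M. ee F u) / real n"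
    unfolding h_def by (simp add: sum.distrib sum_distrib_left sum_distrib_right sum_divide_distrib add_divide_distrib algebra_simps)
  also have "real (card M) / real n = 1 - real (card ?U) / real n"
    using card_free2[OF assms(1), of a b] n_ge by (simp add: M_def field_simps)
  also have "(\<Sum>u\<in>M. ee F u) = sig F - (\<Sum>u\<in>?U. ee F u)" using sum_ee_free2[OF assms(1)] by (simp add: M_def)
  finally have eq: "avg (Omega F' Q') (\<lambda>G. real (card (rw G a \<inter> rw G b \<inter> M))) - (l\<^sup>2 * real (card M) + l * (dd F a + dd F b))
    = ((\<Sum>u\<in>M'. c u - h u) + (\<Sum>u\<in>M - M'. c u - h u)) + (2 * l * (sig F - (\<Sum>u\<in>?U. ee F u)) * (1 / real n) - l * (dd F a + dd F b) * real (card ?U) * (1 / real n))"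
    by (simp add: algebra_simps diff_divide_distrib)
  have dab: "bd 3 1 (dd F a + dd F b)"
    by (rule bd_addI[OF bd_dd(1)[OF assms(1,2,8)] bd_dd(1)[OF assms(1,2,9)]]) auto
  have 1: "bd 43 0 (\<Sum>u\<in>M'. c u - h u)"
  proof -
    have "card M' \<le> card {..<n}" by (intro card_mono) (auto simp: M'_def free2_def)
    then have "bd 0 2 (real (card M'))" by (intro bd_le[OF bd_n(1)]) simp
    then have "bd (43 + 0) (-2 + 2) (\<Sum>u\<in>M'. c u - h u)" unfolding c_def h_def
      by (intro bd_sum pair_pr[OF assms]) (auto simp: M'_def free2_def)
    then show ?thesis by simp
  qed
  have 2: "bd 7 0 (\<Sum>u\<in>M - M'. c u - h u)"
  proof -
    have F10: "card (F' - F) \<le> 10" using assms(6) by simp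
    note e = card_rw_ext(5)[OF assms(5) F10 clsD(1)[OF assms(3)]]
    have fin: "finite (rw (F' - F) a \<union> rw (F' - F) b)"
      using finite_rw[of "F' - F" n] clsD(1)[OF assms(3)] by blast
    have "card (M - M') \<le> card (rw (F' - F) a \<union> rw (F' - F) b)"
      using fin by (intro card_mono) (auto simp: M_def M'_def free2_def)
    also have "\<dots> \<le> 20" using card_Un_le[of "rw (F' - F) a" "rw (F' - F) b"] e[of a] e[of b] by linarith
    finally have "bd 1 0 (real (card (M - M')))" by (intro bd_const) simp
    moreover have "bd 6 0 (c u - h u)" if "u \<in> M - M'" for u
    proof -
      have u: "u < n" using that by (auto simp: M_def free2_def)
      have "\<bar>c u\<bar> \<le> 1"
      proof -
        have "\<bar>c u\<bar> \<le> avg (Omega F' Q') (\<lambda>_. 1)" unfolding c_def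
          by (rule order_trans[OF avg_abs avg_mono]) auto
        then show ?thesis using ne by (simp add: avg_const finite_Om)
      qed
      then have c1: "bd 0 0 (c u)" by (rule bd_one)
      have z: "bd 4 0 ((dd F a + ee F u) * (1 / real n) + (dd F b + ee F u) * (1 / real n))"
        by (rule bd_addI[OF bd_z[OF assms(1,2,8) u] bd_z[OF assms(1,2,9) u]]) auto
      have "bd 0 0 (l\<^sup>2)" using l_bounds by (intro bd_one) (simp add: power_le_one)
      then have "bd 5 0 (h u)" unfolding h_def
        by (rule bd_addI[OF _ bd_mult[OF bd_l(1) z]]) auto
      then show ?thesis by (rule bd_diffI[OF c1]) auto
    qed
    ultimately show ?thesis using bd_sum[of "M - M'" 6 0 "\<lambda>u. c u - h u" 1 0] by simp
  qed
  have 3: "bd 7 0 (2 * l * (sig F - (\<Sum>u\<in>?U. ee F u)) * (1 / real n) - l * (dd F a + dd F b) * real (card ?U) * (1 / real n))"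
  proof (rule bd_diffI)
    have b5: "bd 5 2 (sig F - (\<Sum>u\<in>?U. ee F u))"
      by (rule bd_diffI[OF bd_sig[OF assms(1,2)] bd_sum_ee[OF assms(1,2,8,9)]]) auto
    show "bd 6 0 (2 * l * (sig F - (\<Sum>u\<in>?U. ee F u)) * (1 / real n))"
      by (rule bd_weaken[OF bd_mult[OF bd_mult[OF bd_mult[OF bd_const[of 2] bd_l(1)] b5] bd_n(2)]]) auto
    show "bd 5 0 (l * (dd F a + dd F b) * real (card ?U) * (1 / real n))"
      by (rule bd_weaken[OF bd_mult[OF bd_mult[OF bd_mult[OF bd_l(1) dab] bd_frozen2[OF assms(1,2,8,9)]] bd_n(2)]]) auto
  qed auto
  show ?thesis unfolding M_def[symmetric] eq
    by (rule bd_addI[OF bd_addI[OF 1 2, of 44 0] 3]) auto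
qed

text \<open>The mean of \<open>\<alpha> + \<beta>\<close> up to a power of \<open>\<theta>\<close>,
  as \<open>avg_onlysum\<close> shows: the free columns carry \<open>2 * q\<close> each, and a row
  of larger degree adds with weight \<open>1 - 2 * l\<close>.\<close>

definition Dmean :: "(nat \<times> nat) set \<Rightarrow> nat \<Rightarrow> nat \<Rightarrow> real" where
  "Dmean F a b = 2 * q * (real n - real (card (frozen2 F a b))) + (1 - 2 * l) * (dd F a + dd F b)"

lemma bd_1_2l: "bd 0 0 (1 - 2 * l)" using l_bounds by (intro bd_one) auto

lemma bd_Dmean:
  assumes "cls k F Q" "k \<le> 10" "a < n" "b < n"
  shows "bd 4 1 (Dmean F a b - 2 * q * real n)"
proof -
  have dab: "bd 3 1 (dd F a + dd F b)"
    by (rule bd_addI[OF bd_dd(1)[OF assms(1-3)] bd_dd(1)[OF assms(1,2,4)]]) auto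
  have eq: "Dmean F a b - 2 * q * real n = (1 - 2 * l) * (dd F a + dd F b) - 2 * q * real (card (frozen2 F a b))"
    by (simp add: Dmean_def algebra_simps)
  show ?thesis unfolding eq
    by (rule bd_diffI[OF bd_mult[OF bd_1_2l dab] bd_mult[OF bd_mult[OF bd_const[of 2] bd_l(3)] bd_frozen2[OF assms]]]) auto
qed

text \<open>The same centre serves every measure obtained by freezing up to nine more cells, which
  is what makes the decoupling in \<open>avg_ind_W\<close> possible.\<close>

lemma avg_onlysum:
  assumes "cls k0 F Q" "k0 \<le> 10" "cls k F' Q'" "k \<le> 7" "F \<subseteq> F'" "card (F' - F) \<le> 9"
    and "a \<noteq> b" "a < n" "b < n"
  shows "bd 47 0 (avg (Omega F' Q') (\<lambda>G. Dmean F a b - onlysum F a b G))"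
proof -
  let ?U = "frozen2 F a b" and ?M = "free2 n F a b"
  have k: "k \<le> 10" "card (F' - F) \<le> 10" using assms by auto
  have ne: "Omega F' Q' \<noteq> {}" using clsD(4)[OF assms(3)] .
  let ?C = "avg (Omega F' Q') (\<lambda>G. real (card (rw G a \<inter> rw G b \<inter> ?M)))"
  have "avg (Omega F' Q') (\<lambda>G. Dmean F a b - onlysum F a b G) = avg (Omega F' Q') (\<lambda>G. Dmean F a b - (real (s a) + real (s b) - real (card (rw G a \<inter> ?U)) - real (card (rw G b \<inter> ?U))
    - 2 * real (card (rw G a \<inter> rw G b \<inter> ?M))))"
    using assms by (intro avg_cong) (simp only: onlysum_eq[of _ F' Q' a b F])
  also have "\<dots> = Dmean F a b - (real (s a) + real (s b) - (\<Sum>w\<in>?U. pr F' Q' a w) - (\<Sum>w\<in>?U. pr F' Q' b w) - 2 * ?C)"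
    unfolding avg_diff avg_add avg_cmult avg_const[OF finite_Om ne] avg_card_rw[OF frozen2_subset(2)[OF assms(1)]] ..
  also have "\<dots> = ((\<Sum>w\<in>?U. pr F' Q' a w) - l * real (card (?U - rw F a))) + ((\<Sum>w\<in>?U. pr F' Q' b w) - l * real (card (?U - rw F b)))
    + 2 * (?C - (l\<^sup>2 * real (card ?M) + l * (dd F a + dd F b)))"
    unfolding card_frozen2_diff[OF assms(1)] card_free2[OF assms(1)] Dmean_def dd_def
    by (simp add: algebra_simps power2_eq_square)
  finally have eq: "avg (Omega F' Q') (\<lambda>G. Dmean F a b - onlysum F a b G) =
     ((\<Sum>w\<in>?U. pr F' Q' a w) - l * real (card (?U - rw F a))) + ((\<Sum>w\<in>?U. pr F' Q' b w) - l * real (card (?U - rw F b)))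
    + 2 * (?C - (l\<^sup>2 * real (card ?M) + l * (dd F a + dd F b)))" .
  note row = row_part[OF assms(3) k(1) assms(5) k(2) _ frozen2_subset(1)[OF assms(1)] bd_frozen2[OF assms(1,2,8,9)]]
  show ?thesis unfolding eq
    by (rule bd_addI[OF bd_addI[OF row[OF assms(8)] row[OF assms(9)], of 12 0] bd_mult[OF bd_const[of 2] cod_mean[OF assms]]]) auto
qed

text \<open>Freezing the cell \<open>(c,w)\<close> as 1 leaves the centred sum with a mean of the
  same order. So the indicator of one cell is nearly uncorrelated with it.\<close>

lemma avg_ind_W:
  assumes "cls k0 F Q" "k0 \<le> 10" "cls k F' Q'" "k \<le> 6" "F \<subseteq> F'" "card (F' - F) \<le> 8"
    and "a \<noteq> b" "a < n" "b < n" "c < n" "w < n"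
  shows "bd 47 0 (avg (Omega F' Q') (\<lambda>G. of_bool ((c,w) \<in> G) * (Dmean F a b - onlysum F a b G)))"
proof (cases "(c,w) \<in> F'")
  case True
  have eq: "avg (Omega F' Q') (\<lambda>G. of_bool ((c,w) \<in> G) * (Dmean F a b - onlysum F a b G))
    = of_bool ((c,w) \<in> Q') * avg (Omega F' Q') (\<lambda>G. Dmean F a b - onlysum F a b G)"
    unfolding avg_cmult[symmetric] using True by (intro avg_cong) (auto simp: Om_def)
  have "bd 0 0 (of_bool ((c,w) \<in> Q'))" by (intro bd_one) auto
  moreover have "bd 47 0 (avg (Omega F' Q') (\<lambda>G. Dmean F a b - onlysum F a b G))"
    using assms by (intro avg_onlysum[OF assms(1-3) _ assms(5) _ assms(7-9)]) auto
  ultimately show ?thesis unfolding eq by (rule bd_multI) auto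
next
  case False
  let ?F = "insert (c,w) F'"
  have k: "k \<le> 10" "Suc k \<le> 7" using assms by auto
  note c = cls_insert(1)[OF assms(3) k(1) assms(10,11) False]
  have cF: "card (?F - F) \<le> 9"
  proof -
    have "card (?F - F) \<le> card (insert (c,w) (F' - F))" using clsD(5)[OF assms(3)] by (intro card_mono) auto
    also have "\<dots> \<le> Suc (card (F' - F))" by (rule card_insert_le_m1) auto
    finally show ?thesis using assms(6) by simp
  qed
  have sub: "F \<subseteq> ?F" using assms(5) by auto
  show ?thesis unfolding avg_incl[OF False clsD(2)[OF assms(3)]]
    by (rule bd_multI[OF bd_pr(1) avg_onlysum[OF assms(1,2) c k(2) sub cF assms(7-9)]]) auto
qed

lemma avg_NW:
  assumes "cls k0 F Q" "k0 \<le> 10" "cls k F' Q'" "k \<le> 6" "F \<subseteq> F'" "card (F' - F) \<le> 8"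
    and "a \<noteq> b" "a < n" "b < n"
  shows "bd 51 1 (avg (Omega F' Q') (\<lambda>G. onlydiff F a b G * (Dmean F a b - onlysum F a b G)))"
proof -
  let ?U = "frozen2 F a b"
  let ?W = "\<lambda>G. Dmean F a b - onlysum F a b G"
  let ?A = "\<lambda>c. \<Sum>w\<in>?U. avg (Omega F' Q') (\<lambda>G. of_bool ((c,w) \<in> G) * ?W G)"
  have fU: "finite ?U" using frozen2_subset(2)[OF assms(1)] .
  have "avg (Omega F' Q') (\<lambda>G. onlydiff F a b G * ?W G)
     = avg (Omega F' Q') (\<lambda>G. (real (s a) - real (s b)) * ?W G - (\<Sum>w\<in>?U. of_bool ((a,w) \<in> G) * ?W G) + (\<Sum>w\<in>?U. of_bool ((b,w) \<in> G) * ?W G))"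
  proof (rule avg_cong)
    fix G assume G: "G \<in> Omega F' Q'"
    have c: "(\<Sum>w\<in>?U. of_bool ((c,w) \<in> G) * x) = real (card (rw G c \<inter> ?U)) * x" for c x
      using sum_of_bool_mem[OF fU, of "rw G c"] by (simp add: sum_distrib_right[symmetric])
    have d: "(A - B - C + D) * x = (A - B) * x - C * x + D * x" for A B C D x :: real by (simp add: algebra_simps)
    show "onlydiff F a b G * ?W G = (real (s a) - real (s b)) * ?W G - (\<Sum>w\<in>?U. of_bool ((a,w) \<in> G) * ?W G) + (\<Sum>w\<in>?U. of_bool ((b,w) \<in> G) * ?W G)"
      unfolding onlydiff_eq[OF G assms(8,9)] c d ..
  qed
  also have "\<dots> = (real (s a) - real (s b)) * avg (Omega F' Q') ?W - ?A a + ?A b"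
    unfolding avg_add avg_diff[of _ "\<lambda>G. (real (s a) - real (s b)) * ?W G"] avg_cmult avg_sum ..
  finally have eq: "avg (Omega F' Q') (\<lambda>G. onlydiff F a b G * ?W G) = (real (s a) - real (s b)) * avg (Omega F' Q') ?W - ?A a + ?A b" .
  have A: "bd 49 1 (?A c)" if "c < n" for c
  proof -
    have "bd (47 + 2) (0 + 1) (?A c)"
      using frozen2_subset(1)[OF assms(1), of a b] that
      by (intro bd_sum avg_ind_W[OF assms] bd_frozen2[OF assms(1,2,8,9)]) auto
    then show ?thesis by simp
  qed
  have W: "bd 47 0 (avg (Omega F' Q') ?W)"
    using assms by (intro avg_onlysum[OF assms(1-3) _ assms(5) _ assms(7-9)]) auto
  show ?thesis unfolding eq
    by (rule bd_addI[OF bd_diffI[OF bd_mult[OF sdiff_bd[OF assms(8,9)] W] A[OF assms(8)], of 50 1] A[OF assms(9)]]) auto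
qed

text \<open>For \<open>F\<close> the diagonal with \<open>H\<close>, \<open>EE\<close> and
  \<open>DC\<close> are, up to lower order, what adding an arc changes in \<open>Y\<close> through
  the arcs already present at its ends, divided by the density; compare
  \<open>pot_step\<close>.\<close>

definition EE :: "(nat \<times> nat) set \<Rightarrow> nat \<Rightarrow> real" where "EE F a = (\<Sum>w\<in>rw F a. ee F w)"
definition DC :: "(nat \<times> nat) set \<Rightarrow> nat \<Rightarrow> real" where "DC F v = (\<Sum>b\<in>cl F v. dd F b)"

abbreviation phi where "phi F a \<equiv> real (card (rw F a))"
abbreviation psi where "psi F v \<equiv> real (card (cl F v))"

text \<open>Refines \<open>row_part\<close> by inserting the first-order probability of each free
  cell. The hypotheses \<open>new\<close> and \<open>Q'\<close> express that conditioning has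
  touched none of the columns summed over.\<close>

lemma second_row:
  assumes "cls k0 F Q" "k0 \<le> 10" "cls k F' Q'" "k \<le> 8" "F \<subseteq> F'" "card (F' - F) \<le> 10"
    and ab: "a < n" "b < n" and c: "c = a \<or> c = b"
    and new: "\<And>w. w \<in> frozen2 F a b \<Longrightarrow> (c,w) \<in> F' \<Longrightarrow> (c,w) \<in> F"
    and Q': "\<And>w. w \<in> frozen2 F a b \<Longrightarrow> (c,w) \<notin> Q'"
  shows "bd 39 (-1) ((\<Sum>w\<in>frozen2 F a b. pr F' Q' c w) - (l * (real (card (frozen2 F a b)) - phi F c)
    + (dd F c * (real (card (frozen2 F a b)) - phi F c) + (\<Sum>w\<in>frozen2 F a b. ee F w) - EE F c) * (1 / real n)))"
proof -
  let ?U = "frozen2 F a b"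
  have fU: "finite ?U" "?U \<subseteq> {..<n}" using frozen2_subset[OF assms(1)] by auto
  have sub: "rw F c \<subseteq> ?U" using c by auto
  have cU: "real (card (?U - rw F c)) = real (card ?U) - phi F c"
    using card_frozen2_diff[OF assms(1), of a b] c by auto
  have cn: "c < n" using ab c by auto
  have "(\<Sum>w\<in>?U. pr F' Q' c w) = (\<Sum>w\<in>?U - rw F c. pr F' Q' c w) + (\<Sum>w\<in>rw F c. pr F' Q' c w)"
    by (rule sum.subset_diff[OF sub fU(1)])
  also have "(\<Sum>w\<in>rw F c. pr F' Q' c w) = 0"
  proof (intro sum.neutral ballI)
    fix w assume w: "w \<in> rw F c"
    then have "(c,w) \<in> F'" using assms(5) by auto
    then show "pr F' Q' c w = 0" using pr_frozen[OF assms(3)] Q'[of w] w sub by auto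
  qed
  finally have 1: "(\<Sum>w\<in>?U. pr F' Q' c w) = (\<Sum>w\<in>?U - rw F c. pr F' Q' c w)" by simp
  have "(\<Sum>w\<in>?U - rw F c. l + (dd F c + ee F w) * (1 / real n))
    = l * real (card (?U - rw F c)) + (dd F c * real (card (?U - rw F c)) + (\<Sum>w\<in>?U - rw F c. ee F w)) * (1 / real n)"
    by (simp add: sum.distrib sum_divide_distrib add_divide_distrib algebra_simps)
  also have "(\<Sum>w\<in>?U - rw F c. ee F w) = (\<Sum>w\<in>?U. ee F w) - EE F c"
    unfolding EE_def by (rule sum_diff[OF fU(1) sub])
  finally have eq: "(\<Sum>w\<in>?U. pr F' Q' c w) - (l * (real (card ?U) - phi F c)
    + (dd F c * (real (card ?U) - phi F c) + (\<Sum>w\<in>?U. ee F w) - EE F c) * (1 / real n))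
    = (\<Sum>w\<in>?U - rw F c. pr F' Q' c w - (l + (dd F c + ee F w) * (1 / real n)))"
    unfolding 1 cU sum_subtractf by (simp add: algebra_simps)
  have "bd 2 1 (real (card (?U - rw F c)))"
    using fU card_mono[of ?U "?U - rw F c"] by (intro bd_le[OF bd_frozen2[OF assms(1,2) ab]]) auto
  then have "bd (37 + 2) (-2 + 1) (\<Sum>w\<in>?U - rw F c. pr F' Q' c w - (l + (dd F c + ee F w) * (1 / real n)))"
    using fU(2) new by (intro bd_sum pr_first_ext[OF assms(3-6) cn]) auto
  then show ?thesis unfolding eq by simp
qed

lemma avg_onlydiff_second:
  assumes "cls k0 F Q" "k0 \<le> 10" "cls k F' Q'" "k \<le> 8" "F' = insert (a,v) (insert (b,v) F)" "Q' \<subseteq> {(a,v),(b,v)}"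
    and ab: "a < n" "b < n" and v: "(a,v) \<notin> F" "(b,v) \<notin> F"
  shows "bd 40 (-1) (avg (Omega F' Q') (onlydiff F a b) - ((dd F a - dd F b) * (1 - real (card (frozen2 F a b)) * (1 / real n))
    + (phi F a * dd F a - phi F b * dd F b + EE F a - EE F b) * (1 / real n)))"
proof -
  let ?U = "frozen2 F a b"
  have sub: "F \<subseteq> F'" and cF: "card (F' - F) \<le> 10" using assms(5) card_two_insert by auto
  \<comment> \<open>The conditioned cells lie in column \<open>v\<close>, which is free in both rows
    and so outside the columns summed over.\<close>
  have vU: "v \<notin> ?U" using v by auto
  note row = second_row[OF assms(1-4) sub cF ab]
  have new: "\<And>w c. w \<in> ?U \<Longrightarrow> (c,w) \<in> F' \<Longrightarrow> (c,w) \<in> F" "\<And>w c. w \<in> ?U \<Longrightarrow> (c,w) \<notin> Q'"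
    using vU assms(5,6) by auto
  have ra: "bd 39 (-1) ((\<Sum>w\<in>?U. pr F' Q' a w) - (l * (real (card ?U) - phi F a)
    + (dd F a * (real (card ?U) - phi F a) + (\<Sum>w\<in>?U. ee F w) - EE F a) * (1 / real n)))"
    by (rule row[OF disjI1[OF refl] new(1) new(2)])
  have rb: "bd 39 (-1) ((\<Sum>w\<in>?U. pr F' Q' b w) - (l * (real (card ?U) - phi F b)
    + (dd F b * (real (card ?U) - phi F b) + (\<Sum>w\<in>?U. ee F w) - EE F b) * (1 / real n)))"
    by (rule row[OF disjI2[OF refl] new(1) new(2)])
  define x y where "x = (\<Sum>w\<in>?U. pr F' Q' a w)" and "y = (\<Sum>w\<in>?U. pr F' Q' b w)"
  have sab: "real (s a) - real (s b) = dd F a - dd F b - l * phi F a + l * phi F b" by (simp add: dd_def)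
  have eq: "avg (Omega F' Q') (onlydiff F a b) - ((dd F a - dd F b) * (1 - real (card ?U) * (1 / real n))
    + (phi F a * dd F a - phi F b * dd F b + EE F a - EE F b) * (1 / real n))
    = (y - (l * (real (card ?U) - phi F b)
    + (dd F b * (real (card ?U) - phi F b) + (\<Sum>w\<in>?U. ee F w) - EE F b) * (1 / real n)))
    - (x - (l * (real (card ?U) - phi F a)
    + (dd F a * (real (card ?U) - phi F a) + (\<Sum>w\<in>?U. ee F w) - EE F a) * (1 / real n)))"
    unfolding avg_onlydiff[OF assms(1-3) ab] x_def[symmetric] y_def[symmetric] sab
    by (simp add: algebra_simps diff_divide_distrib add_divide_distrib)
  show ?thesis unfolding eq x_def y_def by (rule bd_diffI[OF rb ra]) auto
qed

lemma xor_second: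
  assumes "cls k F Q" "k \<le> 7" "a \<noteq> b" "a < n" "b < n" "v < n" "(a,v) \<notin> F" "(b,v) \<notin> F"
  shows "bd 44 (-2) (avg (Omega F Q) (xor a b v) - (2 * q + (1 - 2 * l) * ((dd F a + dd F b + 2 * ee F v) * (1 / real n))))"
proof -
  have k: "k \<le> 9" "k \<le> 10" "k \<le> 8" "Suc k \<le> 8" using assms by auto
  note ca = cls_insert(1)[OF assms(1) k(2) assms(4,6,7)]
  note cb = cls_insert(1)[OF assms(1) k(2) assms(5,6,8)]
  have bva: "(b,v) \<notin> insert (a,v) F" and avb: "(a,v) \<notin> insert (b,v) F" using assms by auto
  have c1: "card (insert x F - F) \<le> 10" for x
  proof -
    have "card (insert x F - F) \<le> card {x}" by (intro card_mono) auto
    then show ?thesis by simp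
  qed
  define x y x' y' where "x = pr F Q a v" and "y = pr F Q b v" and "x' = pr (insert (b,v) F) (insert (b,v) Q) a v" and "y' = pr (insert (a,v) F) (insert (a,v) Q) b v"
  define za zb where "za = (dd F a + ee F v) * (1 / real n)" and "zb = (dd F b + ee F v) * (1 / real n)"
  have z: "bd 3 (-1) za" "bd 3 (-1) zb" unfolding za_def zb_def
    using bd_z[OF assms(1) k(2) assms(4,6)] bd_z[OF assms(1) k(2) assms(5,6)] by auto
  have ex: "bd 36 (-2) (x - (l + za))" "bd 36 (-2) (y - (l + zb))"
    unfolding x_def y_def za_def zb_def
    using pr_first[OF assms(1) k(3) assms(4,6,7)] pr_first[OF assms(1) k(3) assms(5,6,8)] by auto
  have ex': "bd 37 (-2) (x' - (l + za))" unfolding x'_def za_def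
    by (rule pr_first_ext[OF cb k(4) _ c1 assms(4,6) avb]) auto
  have ey': "bd 37 (-2) (y' - (l + zb))" unfolding y'_def zb_def
    by (rule pr_first_ext[OF ca k(4) _ c1 assms(5,6) bva]) auto
  have lz: "bd 4 0 (l + za)" "bd 4 0 (l + zb)"
    by (rule bd_addI[OF bd_l(1) z(1)], simp_all) (rule bd_addI[OF bd_l(1) z(2)], simp_all)
  have "avg (Omega F Q) (xor a b v) = x * (1 - y') + y * (1 - x')"
    unfolding avg_xor[OF assms(1) k(1) assms(3-8)] x_def y_def x'_def y'_def ..
  moreover have zz: "(dd F a + dd F b + 2 * ee F v) * (1 / real n) = za + zb"
    by (simp add: za_def zb_def add_divide_distrib algebra_simps)
  \<comment> \<open>To first order \<open>x'\<close> and \<open>y'\<close> agree with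
    \<open>x\<close> and \<open>y\<close>. The product \<open>(l + za) * (1 - l - zb)\<close> and
    its mirror image add up to \<open>2 * q + (1 - 2 * l) * (za + zb) - 2 * za * zb\<close>.\<close>
  moreover have "x * (1 - y') + y * (1 - x') - (2 * q + (1 - 2 * l) * (za + zb))
    = (((x - (l + za)) * (1 - y') - (l + za) * (y' - (l + zb))) + ((y - (l + zb)) * (1 - x') - (l + zb) * (x' - (l + za)))) - 2 * (za * zb)"
    by (simp add: algebra_simps)
  moreover have 1: "bd 42 (-2) ((x - (l + za)) * (1 - y') - (l + za) * (y' - (l + zb)))"
    unfolding y'_def
    by (rule bd_diffI[OF bd_mult[OF ex(1) bd_pr(2)] bd_mult[OF lz(1) ey'[unfolded y'_def]]]) auto
  moreover have 2: "bd 42 (-2) ((y - (l + zb)) * (1 - x') - (l + zb) * (x' - (l + za)))"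
    unfolding x'_def
    by (rule bd_diffI[OF bd_mult[OF ex(2) bd_pr(2)] bd_mult[OF lz(2) ex'[unfolded x'_def]]]) auto
  moreover have 3: "bd 7 (-2) (2 * (za * zb))"
    by (rule bd_weaken[OF bd_mult[OF bd_const[of 2] bd_mult[OF z]]]) auto
  ultimately show ?thesis
    by (simp only:) (rule bd_diffI[OF bd_addI[OF 1 2, of 43 "-2"] 3], auto)
qed

abbreviation kappa where "kappa \<equiv> (1 - 2 * l) * (1 / q)"

lemma bd_kappa: "bd 2 0 (1 / q)" "bd 2 0 kappa"
proof -
  have "1 / q = 2 * (1 / (2 * q))" by simp
  moreover have "bd 2 0 (2 * (1 / (2 * q)))" by (rule bd_multI[OF bd_const[of 2] bd_l(6)]) auto
  ultimately show 1: "bd 2 0 (1 / q)" by (simp only:)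
  show "bd 2 0 kappa" by (rule bd_multI[OF bd_1_2l 1]) auto
qed

lemma bd_EE:
  assumes "cls k F Q" "k \<le> 10" "a < n"
  shows "bd 4 2 (EE F a)" "bd 4 2 (DC F a)" "bd 4 2 (phi F a * dd F a)"
proof -
  show "bd 4 2 (EE F a)" unfolding EE_def
    by (rule bd_weaken[OF bd_sum[OF bd_dd(2)[OF assms(1,2)] bd_rwF(1)[OF assms]]])
      (use rw_subset[OF clsD(1)[OF assms(1)], of a] in auto)
  show "bd 4 2 (DC F a)" unfolding DC_def
    by (rule bd_weaken[OF bd_sum[OF bd_dd(1)[OF assms(1,2)] bd_rwF(2)[OF assms]]])
      (use cl_subset[OF clsD(1)[OF assms(1)], of a] in auto)
  show "bd 4 2 (phi F a * dd F a)" by (rule bd_multI[OF bd_rwF(1)[OF assms] bd_dd(1)[OF assms]]) auto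
qed

lemma second_order_algebra:
  fixes x y e T m Q N :: real
  assumes "N \<noteq> 0" "Q \<noteq> 0" "D \<noteq> 0"
    and D: "D = 2 * Q * N * (1 + e1)" and e12: "e2 - e1 = K * e * (1 / N) + u * (1 / N)"
    and tau: "tau = T * (1 / N) - x * (u * (1 / N))"
  shows "2 * Q * (1 + e2) * (x + tau) * (1 / D) - (x * (1 / N) * (1 + K * e * (1 / N)) + T * (1 / N) ^ 2)
    = (x * (e1 ^ 2 - e1 * e2) + tau * (e2 - e1)) * (2 * Q) * (1 / D)"
proof -
  have TT: "x * (1 / N) * (1 + K * e * (1 / N)) + T * (1 / N) ^ 2 = (1 / N) * (x * (1 + e2 - e1) + tau)"
  proof -
    have e: "1 + e2 - e1 = 1 + K * e * (1 / N) + u * (1 / N)" using e12 by simp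
    show ?thesis unfolding e tau by (simp add: algebra_simps power2_eq_square)
  qed
  have N: "1 / N = (1 + e1) * (2 * Q) * (1 / D)" using assms by (simp add: D field_simps)
  show ?thesis unfolding TT unfolding N by (simp add: algebra_simps power2_eq_square add_divide_distrib)
qed

text \<open>Stated only for measures that avoid \<open>F\<close>, since no further conditioning
  follows. With the centre \<open>Dmean\<close> the linear term \<open>NW\<close> has order
  \<open>r\<close> and contributes \<open>r / r^4\<close>, within the error.\<close>

lemma pr_diff_second:
  assumes "cls 0 F {}" "a < n" "b < n" "v < n" "(a,v) \<notin> F" "(b,v) \<notin> F"
  shows "bd 62 (-3) ((pr F {} a v - pr F {} b v) - ((dd F a - dd F b) * (1 / real n) * (1 + kappa * ee F v * (1 / real n))
     + (phi F a * dd F a - phi F b * dd F b + EE F a - EE F b) * (1 / real n) ^ 2))"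
proof (cases "a = b")
  case True then show ?thesis by (simp add: bd_0)
next
  case False
  have k: "0 \<le> (10::nat)" "0 \<le> (9::nat)" "0 \<le> (7::nat)" "Suc 0 \<le> 10" "Suc (Suc 0) \<le> 6" "Suc (Suc 0) \<le> 8" by auto
  let ?U = "frozen2 F a b"
  define D1 where "D1 = Dmean F a b"
  define \<mu> where "\<mu> = avg (Omega F {}) (xor a b v)"
  define N where "N = avg (Omega F {}) (\<lambda>G. xor a b v G * onlydiff F a b G)"
  define NW where "NW = avg (Omega F {}) (\<lambda>G. xor a b v G * (onlydiff F a b G * (D1 - onlysum F a b G)))"
  define x where "x = dd F a - dd F b"
  define T where "T = phi F a * dd F a - phi F b * dd F b + EE F a - EE F b"
  define u where "u = real (card ?U)"
  define e where "e = ee F v"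
  define tau where "tau = T * (1 / real n) - x * (u * (1 / real n))"
  define e2 where "e2 = kappa * (dd F a + dd F b + 2 * e) * (1 / 2) * (1 / real n)"
  define e1 where "e1 = kappa * (dd F a + dd F b) * (1 / 2) * (1 / real n) - u * (1 / real n)"
  have bD1: "bd 4 1 (D1 - 2 * q * real n)" unfolding D1_def by (rule bd_Dmean[OF assms(1) k(1) assms(2,3)])
  note D1f = D1_facts[OF bD1]
  have exp: "bd 30 (-3) ((pr F {} a v - pr F {} b v) - (N * (1 / D1) + NW * (1 / D1) ^ 2))"
    unfolding N_def NW_def by (rule avg_ratio_expansion[OF assms(1) k(1) assms(2,3) False assms(4-6) bD1])
  note ca = cls_insert(1)[OF assms(1) k(1) assms(2,4,5)]
  note cb = cls_insert(1)[OF assms(1) k(1) assms(3,4,6)]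
  have bva: "(b,v) \<notin> insert (a,v) F" and avb: "(a,v) \<notin> insert (b,v) F" using False assms by auto
  note cab = cls_insert(2)[OF ca k(4) assms(3,4) bva]
  note cba = cls_insert(2)[OF cb k(4) assms(2,4) avb]
  have two: "card (insert p (insert p' F) - F) \<le> 8" for p p'
  proof -
    have "card (insert p (insert p' F) - F) \<le> card {p, p'}" by (intro card_mono) auto
    also have "\<dots> \<le> 8" by (simp add: card_insert_if)
    finally show ?thesis .
  qed
  have bN: "bd 41 (-1) (N - \<mu> * (x + tau))"
  proof -
    have eq: "(dd F a - dd F b) * (1 - real (card ?U) * (1 / real n)) + (phi F a * dd F a - phi F b * dd F b + EE F a - EE F b) * (1 / real n) = x + tau"
      by (simp add: x_def tau_def T_def u_def algebra_simps)
    have 1: "bd 40 (-1) (avg (Omega (insert (b,v) (insert (a,v) F)) {(a,v)}) (onlydiff F a b) - (x + tau))"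
      unfolding eq[symmetric]
      using assms by (intro avg_onlydiff_second[OF assms(1) k(1) cab k(6)]) auto
    have 2: "bd 40 (-1) (avg (Omega (insert (a,v) (insert (b,v) F)) {(b,v)}) (onlydiff F a b) - (x + tau))"
      unfolding eq[symmetric]
      using assms by (intro avg_onlydiff_second[OF assms(1) k(1) cba k(6)]) auto
    show ?thesis unfolding N_def \<mu>_def
      by (rule bd_weaken[OF bd_avg_xor[OF assms(1) k(2) False assms(2-6) 1 2]]) auto
  qed
  have bNW: "bd 52 1 NW"
  proof -
    have 1: "bd 51 1 (avg (Omega (insert (b,v) (insert (a,v) F)) {(a,v)}) (\<lambda>G. onlydiff F a b G * (D1 - onlysum F a b G)) - 0)"
      unfolding D1_def diff_0_right
      by (rule avg_NW[OF assms(1) k(1) cab k(5) _ two False assms(2,3)]) auto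
    have 2: "bd 51 1 (avg (Omega (insert (a,v) (insert (b,v) F)) {(b,v)}) (\<lambda>G. onlydiff F a b G * (D1 - onlysum F a b G)) - 0)"
      unfolding D1_def diff_0_right
      by (rule avg_NW[OF assms(1) k(1) cba k(5) _ two False assms(2,3)]) auto
    have "bd (Suc 51) 1 (NW - \<mu> * 0)"
      unfolding NW_def \<mu>_def by (rule bd_avg_xor[OF assms(1) k(2) False assms(2-6) 1 2])
    then show ?thesis by simp
  qed
  have mu: "bd 44 (-2) (\<mu> - 2 * q * (1 + e2))"
  proof -
    have "2 * Q * (1 + (w * (1 / Q)) * z * (1 / 2) * y) = 2 * Q + w * (z * y)" if "Q > 0" for Q w z y :: real
      using that by (simp add: field_simps)
    then have "2 * q * (1 + e2) = 2 * q + (1 - 2 * l) * ((dd F a + dd F b + 2 * ee F v) * (1 / real n))"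
      unfolding e2_def e_def using q_ge(2) by blast
    then show ?thesis unfolding \<mu>_def using xor_second[OF assms(1) k(3) False assms(2-6)] by (simp only:)
  qed
  have bx: "bd 3 1 x" unfolding x_def by (rule bd_diffI[OF bd_dd(1)[OF assms(1) k(1) assms(2)] bd_dd(1)[OF assms(1) k(1) assms(3)]]) auto
  have bu: "bd 2 (-1) (u * (1 / real n))" unfolding u_def by (rule bd_multI[OF bd_frozen2[OF assms(1) k(1) assms(2,3)] bd_n(2)]) auto
  have bT: "bd 7 2 T" unfolding T_def
    by (rule bd_diffI[OF bd_addI[OF bd_diffI[OF bd_EE(3)[OF assms(1) k(1) assms(2)] bd_EE(3)[OF assms(1) k(1) assms(3)], of 5 2] bd_EE(1)[OF assms(1) k(1) assms(2)], of 6 2] bd_EE(1)[OF assms(1) k(1) assms(3)]]) auto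
  have btau: "bd 8 0 tau" unfolding tau_def
    by (rule bd_diffI[OF bd_mult[OF bT bd_n(2)] bd_mult[OF bx bu]]) auto
  have dab: "bd 3 1 (dd F a + dd F b)"
    by (rule bd_addI[OF bd_dd(1)[OF assms(1) k(1) assms(2)] bd_dd(1)[OF assms(1) k(1) assms(3)]]) auto
  have dabe: "bd 4 1 (dd F a + dd F b + 2 * e)" unfolding e_def
    by (rule bd_addI[OF dab bd_mult[OF bd_const[of 2] bd_dd(2)[OF assms(1) k(1) assms(4)]]]) auto
  have half: "bd 0 0 (1 / 2)" by (rule bd_one) simp
  have be2: "bd 6 (-1) e2" unfolding e2_def
    by (rule bd_weaken[OF bd_mult[OF bd_mult[OF bd_mult[OF bd_kappa(2) dabe] half] bd_n(2)]]) auto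
  have be1: "bd 6 (-1) e1" unfolding e1_def
    by (rule bd_diffI[OF bd_mult[OF bd_mult[OF bd_mult[OF bd_kappa(2) dab] half] bd_n(2)] bu]) auto
  have alg: "2 * q * (1 + e2) * (x + tau) * (1 / D1) - (x * (1 / real n) * (1 + kappa * e * (1 / real n)) + T * (1 / real n) ^ 2)
    = (x * (e1 ^ 2 - e1 * e2) + tau * (e2 - e1)) * (2 * q) * (1 / D1)"
  proof (rule second_order_algebra)
    show "real n \<noteq> 0" "q \<noteq> 0" "D1 \<noteq> 0" using n_ge q_ge(2) D1f(1) by auto
    have "2 * Q * (N - u) + w * z = 2 * Q * N * (1 + ((w * (1 / Q)) * z * (1 / 2) * (1 / N) - u * (1 / N)))"
      if "Q > 0" "N > 0" for Q N u w z :: real using that by (simp add: field_simps)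
    moreover have "real n > 0" using n_ge by linarith
    ultimately show "D1 = 2 * q * real n * (1 + e1)"
      unfolding D1_def Dmean_def e1_def u_def using q_ge(2) by blast
    have "k * (z + 2 * e) * (1 / 2) * y - (k * z * (1 / 2) * y - u * y) = k * e * y + u * y" for k z e y u :: real
      by (simp add: algebra_simps)
    then show "e2 - e1 = kappa * e * (1 / real n) + u * (1 / real n)" unfolding e2_def e1_def by blast
    show "tau = T * (1 / real n) - x * (u * (1 / real n))" by (simp add: tau_def)
  qed
  have bracket: "bd 20 (-1) (x * (e1 ^ 2 - e1 * e2) + tau * (e2 - e1))"
  proof (rule bd_addI)
    have "bd 13 (-2) (e1 ^ 2 - e1 * e2)" by (rule bd_diffI[OF bd_power[OF be1, of 2] bd_mult[OF be1 be2]]) auto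
    then show "bd 16 (-1) (x * (e1 ^ 2 - e1 * e2))" by (rule bd_multI[OF bx]) auto
    have "bd 7 (-1) (e2 - e1)" by (rule bd_diffI[OF be2 be1]) auto
    then show "bd 15 (-1) (tau * (e2 - e1))" by (rule bd_multI[OF btau]) auto
  qed auto
  have last: "bd 23 (-3) ((x * (e1 ^ 2 - e1 * e2) + tau * (e2 - e1)) * (2 * q) * (1 / D1))"
    by (rule bd_weaken[OF bd_mult[OF bd_mult[OF bracket bd_mult[OF bd_const[of 2] bd_l(3)]] D1f(2)]]) auto
  have xt: "bd 9 1 (x + tau)" by (rule bd_addI[OF bx btau]) auto
  have eq: "(pr F {} a v - pr F {} b v) - (x * (1 / real n) * (1 + kappa * e * (1 / real n)) + T * (1 / real n) ^ 2)
    = (((pr F {} a v - pr F {} b v) - (N * (1 / D1) + NW * (1 / D1) ^ 2)) + (x * (e1 ^ 2 - e1 * e2) + tau * (e2 - e1)) * (2 * q) * (1 / D1))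
      + (((N - \<mu> * (x + tau)) * (1 / D1) + (\<mu> - 2 * q * (1 + e2)) * (x + tau) * (1 / D1)) + NW * (1 / D1) ^ 2)"
  proof -
    have "P - S = (P - (N * d + W) + (B * y * d - S)) + (((N - m * y) * d + (m - B) * y * d) + W)" for P S N d W B y m :: real
      by (simp add: algebra_simps)
    then show ?thesis unfolding alg[symmetric] by blast
  qed
  show ?thesis unfolding x_def[symmetric] T_def[symmetric] e_def[symmetric] eq
  proof (rule bd_addI)
    show "bd 31 (-3) (((pr F {} a v - pr F {} b v) - (N * (1 / D1) + NW * (1 / D1) ^ 2)) + (x * (e1 ^ 2 - e1 * e2) + tau * (e2 - e1)) * (2 * q) * (1 / D1))"
      by (rule bd_addI[OF exp last]) auto
    show "bd 61 (-3) (((N - \<mu> * (x + tau)) * (1 / D1) + (\<mu> - 2 * q * (1 + e2)) * (x + tau) * (1 / D1)) + NW * (1 / D1) ^ 2)"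
      by (rule bd_addI[OF bd_addI[OF bd_mult[OF bN D1f(2)] bd_mult[OF bd_mult[OF mu xt] D1f(2)], of 57 "-3"] bd_mult[OF bNW bd_power[OF D1f(2), of 2]]]) auto
  qed auto
qed

end

lemma ln_cubic_bound:
  fixes w :: real
  assumes "\<bar>w\<bar> \<le> 1/2"
  shows "\<bar>ln (1 - w) + w + w\<^sup>2 / 2\<bar> \<le> 2 * \<bar>w\<bar> ^ 3"
proof -
  let ?f = "\<lambda>x::real. ln (1 - x) + x + x\<^sup>2 / 2"
  \<comment> \<open>The derivative collapses to \<open>- x^2 / (1 - x)\<close>, so the mean value
    theorem yields the cubic bound at once.\<close>
  have der: "(?f has_real_derivative (- (x\<^sup>2 / (1 - x)))) (at x)" if "\<bar>x\<bar> \<le> 1/2" for x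
  proof -
    have "1 - x > 0" using that by linarith
    then show ?thesis
      by (auto intro!: derivative_eq_intros simp: field_simps power2_eq_square)
  qed
  have "\<exists>z. \<bar>z\<bar> \<le> \<bar>w\<bar> \<and> ?f w - ?f 0 = w * (- (z\<^sup>2 / (1 - z)))"
  proof (cases w "0::real" rule: linorder_cases)
    case less
    have "\<exists>z>w. z < 0 \<and> ?f 0 - ?f w = (0 - w) * (- (z\<^sup>2 / (1 - z)))"
      using less assms by (intro MVT2 der) auto
    then obtain z where "z > w" "z < 0" "?f 0 - ?f w = (0 - w) * (- (z\<^sup>2 / (1 - z)))" by blast
    then have "\<bar>z\<bar> \<le> \<bar>w\<bar>" "?f w - ?f 0 = w * (- (z\<^sup>2 / (1 - z)))" by auto
    then show ?thesis by blast
  next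
    case equal then show ?thesis by auto
  next
    case greater
    have "\<exists>z>0. z < w \<and> ?f w - ?f 0 = (w - 0) * (- (z\<^sup>2 / (1 - z)))"
      using greater assms by (intro MVT2 der) auto
    then obtain z where "z > 0" "z < w" "?f w - ?f 0 = (w - 0) * (- (z\<^sup>2 / (1 - z)))" by blast
    then have "\<bar>z\<bar> \<le> \<bar>w\<bar>" "?f w - ?f 0 = w * (- (z\<^sup>2 / (1 - z)))" by auto
    then show ?thesis by blast
  qed
  then obtain z where z: "\<bar>z\<bar> \<le> \<bar>w\<bar>" and eq: "?f w - ?f 0 = w * (- (z\<^sup>2 / (1 - z)))" by blast
  have z2: "1 - z \<ge> 1/2" using z assms by linarith
  have "z\<^sup>2 \<le> w\<^sup>2" using z by (simp add: abs_le_square_iff)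
  then have "z\<^sup>2 / (1 - z) \<le> w\<^sup>2 / (1/2)" using z2 by (intro frac_le) auto
  moreover have "z\<^sup>2 / (1 - z) \<ge> 0" using z2 by simp
  ultimately have "\<bar>z\<^sup>2 / (1 - z)\<bar> \<le> 2 * w\<^sup>2" by (simp only: abs_of_nonneg) simp
  then have "\<bar>w\<bar> * \<bar>z\<^sup>2 / (1 - z)\<bar> \<le> \<bar>w\<bar> * (2 * w\<^sup>2)" by (rule mult_left_mono) simp
  moreover have "\<bar>?f w\<bar> = \<bar>w\<bar> * \<bar>z\<^sup>2 / (1 - z)\<bar>" using eq by (simp add: abs_mult)
  ultimately have "\<bar>?f w\<bar> \<le> \<bar>w\<bar> * (2 * w\<^sup>2)" by simp
  also have "\<dots> = 2 * \<bar>w\<bar> ^ 3" by (simp add: power3_eq_cube power2_eq_square)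
  finally show ?thesis .
qed

section \<open>The probability of one cell to second order\<close>

context near_regular begin

text \<open>Taking the maximum over the rows would give order \<open>r^4\<close>. The bound on the
  total number of frozen cells, of order \<open>n\<close> instead of \<open>n * r\<close>, saves a
  factor \<open>r\<close>.\<close>

lemma bd_sum_phi:
  assumes "cls 0 F Q" "I \<subseteq> {..<n}" "\<And>b. b < n \<Longrightarrow> \<bar>y b\<bar> \<le> phi F b * (\<theta> ^ 2 * r)"
  shows "bd 3 3 (\<Sum>b\<in>I. y b)"
proof -
  have "\<bar>\<Sum>b\<in>I. y b\<bar> \<le> (\<Sum>b\<in>I. \<bar>y b\<bar>)" by (rule sum_abs)
  also have "\<dots> \<le> (\<Sum>b<n. \<bar>y b\<bar>)" using assms(2) by (intro sum_mono2) auto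
  also have "\<dots> \<le> (\<Sum>b<n. phi F b * (\<theta> ^ 2 * r))" using assms(3) by (intro sum_mono) auto
  also have "\<dots> = real (card F) * (\<theta> ^ 2 * r)"
    using sum_card_rw[OF clsD(1)[OF assms(1)]] by (simp flip: sum_distrib_right of_nat_sum)
  also have "\<dots> \<le> (\<theta> * real n) * (\<theta> ^ 2 * r)"
    using clsD(8)[OF assms(1)] theta_pos r_pos by (intro mult_right_mono) auto
  also have "\<dots> = \<theta> ^ 3 * r powi 3" by (simp add: rn power2_eq_square power3_eq_cube)
  finally show ?thesis by (simp add: bd_def)
qed

lemma pr_second:
  assumes "cls 0 F {}" "a < n" "v < n" "(a,v) \<notin> F"
  shows "bd 66 (-3) (pr F {} a v - (l + (dd F a + ee F v) * (1 / real n) - sig F * (1 / real n) ^ 2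
    + (phi F a * dd F a + EE F a + psi F v * ee F v + DC F v) * (1 / real n) ^ 2
    + kappa * dd F a * ee F v * (1 / real n) ^ 2))"
proof -
  have k: "0 \<le> (10::nat)" by simp
  define m where "m = real (card (freecol F v))"
  have m: "m \<ge> real n / 2" "bd 1 (-2) (1 / m)" "m = real n - psi F v" "m > 0"
    using freecol_ge[OF assms(1) k assms(3)] card_freecol[OF assms(1)] n_ge unfolding m_def by auto
  have bm: "bd 0 2 m" using m bd_le[OF bd_n(1), of m] by simp
  define N where "N = 1 / real n"
  have N: "bd 0 (-2) N" "N * real n = 1" using bd_n(2) n_ge by (auto simp: N_def)
  define e where "e = ee F v"
  define P where "P = pr F {} a v"
  define K where "K = kappa"
  define c where "c = K * e * N"
  define f where "f b = phi F b * dd F b + EE F b" for b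
  \<comment> \<open>For fixed \<open>v\<close> the second-order difference is
    \<open>(g a - g b) * N\<close>, so that averaging over the free rows \<open>b\<close> only
    involves the sum of \<open>g\<close>.\<close>
  define g where "g b = dd F b * (1 + c) + f b * N" for b
  define X where "X = (\<Sum>b\<in>freecol F v. (P - pr F {} b v) - (g a - g b) * N)"
  define S where "S = DC F v"
  define Y where "Y = (\<Sum>b\<in>freecol F v. f b)"
  define Z where "Z = (sig F - S) * c + Y * N"
  have be: "bd 2 1 e" unfolding e_def by (rule bd_dd(2)[OF assms(1) k assms(3)])
  have bpsi: "bd 2 1 (psi F v)" by (rule bd_rwF(2)[OF assms(1) k assms(3)])
  have bX: "bd 62 (-1) X"
  proof -
    have "bd 62 (-3) ((P - pr F {} b v) - (g a - g b) * N)" if "b \<in> freecol F v" for b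
    proof -
      have "(g a - g b) * N = (dd F a - dd F b) * N * (1 + K * e * N) + (phi F a * dd F a - phi F b * dd F b + EE F a - EE F b) * N ^ 2"
        by (simp only: g_def f_def c_def) (simp add: algebra_simps power2_eq_square)
      then show ?thesis unfolding P_def N_def e_def K_def
        using pr_diff_second[OF assms(1,2) _ assms(3,4), of b] that by (simp only:) (simp add: freecol_def)
    qed
    then have "bd (62 + 0) (-3 + 2) X" unfolding X_def
      using bm by (intro bd_sum) (auto simp: m_def)
    then show ?thesis by simp
  qed
  have Sd: "(\<Sum>b\<in>freecol F v. dd F b) = sig F - S"
  proof -
    have "cl F v \<subseteq> {..<n}" using cl_subset[OF clsD(1)[OF assms(1)]] .
    moreover have "freecol F v = {..<n} - cl F v" by (auto simp: freecol_def)
    ultimately show ?thesis using sum_dd(1)[OF assms(1)] by (simp add: S_def DC_def sum_diff)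
  qed
  have bS: "bd 5 2 (sig F - S)" unfolding S_def
    by (rule bd_diffI[OF bd_sig[OF assms(1) k] bd_EE(2)[OF assms(1) k assms(3)]]) auto
  have bY: "bd 4 3 Y"
  proof -
    have sub: "freecol F v \<subseteq> {..<n}" by (auto simp: freecol_def)
    have 1: "bd 3 3 (\<Sum>b\<in>freecol F v. phi F b * dd F b)"
    proof (rule bd_sum_phi[OF assms(1) sub])
      fix b assume "b < n"
      then show "\<bar>phi F b * dd F b\<bar> \<le> phi F b * (\<theta> ^ 2 * r)"
        using bdD[OF bd_dd(1)[OF assms(1) k, of b]] by (simp add: abs_mult mult_left_mono)
    qed
    have 2: "bd 3 3 (\<Sum>b\<in>freecol F v. EE F b)"
    proof (rule bd_sum_phi[OF assms(1) sub])
      fix b assume "b < n"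
      have "\<bar>EE F b\<bar> \<le> (\<Sum>w\<in>rw F b. \<bar>ee F w\<bar>)" unfolding EE_def by (rule sum_abs)
      also have "\<dots> \<le> (\<Sum>w\<in>rw F b. \<theta> ^ 2 * r)"
        using bdD[OF bd_dd(2)[OF assms(1) k]] rw_subset[OF clsD(1)[OF assms(1)], of b] by (intro sum_mono) auto
      finally show "\<bar>EE F b\<bar> \<le> phi F b * (\<theta> ^ 2 * r)" by simp
    qed
    show ?thesis unfolding Y_def f_def sum.distrib by (rule bd_addI[OF 1 2]) auto
  qed
  have bc: "bd 4 (-1) c" unfolding c_def by (rule bd_weaken[OF bd_mult[OF bd_mult[OF bd_kappa(2)[folded K_def] be] N(1)]]) auto
  have bZ: "bd 10 1 Z" unfolding Z_def by (rule bd_addI[OF bd_mult[OF bS bc] bd_mult[OF bY N(1)]]) auto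
  have Sg: "(\<Sum>b\<in>freecol F v. g b) = (sig F - S) + Z"
    unfolding g_def sum.distrib Y_def[symmetric] sum_distrib_right[symmetric] Sd Z_def by (simp add: algebra_simps)
  have sp: "(\<Sum>b\<in>freecol F v. pr F {} b v) = real (t v)"
    using sum_pr[OF assms(1,3)] by (simp add: cl_def)
  have "X = m * P - real (t v) - (m * g a - ((sig F - S) + Z)) * N"
    unfolding X_def sum_subtractf sum_distrib_right[symmetric] Sg sp by (simp add: m_def)
  then have mP: "m * P = X + real (t v) + (m * g a - ((sig F - S) + Z)) * N" by linarith
  have tv: "real (t v) = l * m + e" by (simp add: e_def ee_def m(3) algebra_simps)
  have P: "P = (m * P) * (1 / m)" using m(4) by simp
  \<comment> \<open>Inserted into itself, this expands \<open>1 / m\<close> about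
    \<open>1 / n\<close>. The first correction, applied to \<open>e\<close>, produces the term
    \<open>psi F v * ee F v\<close> of the result.\<close>
  have im: "1 / m = N + psi F v * N * (1 / m)"
  proof -
    have "real n \<noteq> 0" using n_ge by auto
    moreover have "real n - psi F v \<noteq> 0" using m(3,4) by auto
    ultimately show ?thesis unfolding N_def m(3) by (simp add: field_simps)
  qed
  have mm: "m * (1 / m) = 1" using m(4) by simp
  have eq: "P - (l + (dd F a + e) * N - sig F * N ^ 2 + (phi F a * dd F a + EE F a + psi F v * e + S) * N ^ 2 + K * dd F a * e * N ^ 2)
    = (X * (1 / m) - Z * N * (1 / m)) + (e * psi F v ^ 2 * N ^ 2 * (1 / m) - (sig F - S) * N * psi F v * N * (1 / m))"
  proof -
    define i where "i = 1 / m"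
    have i: "i = N + psi F v * N * i" "m * i = 1" unfolding i_def by (rule im, rule mm)
    have e1: "e * i = e * N + e * psi F v * N ^ 2 + e * psi F v ^ 2 * N ^ 2 * i"
    proof -
      have "e * i = e * N + e * psi F v * N * i" using arg_cong[OF i(1), of "\<lambda>x. e * x"] by (simp add: algebra_simps)
      also have "\<dots> = e * N + e * psi F v * N * (N + psi F v * N * i)" by (rule arg_cong[OF i(1), of "\<lambda>x. e * N + e * psi F v * N * x"])
      finally show ?thesis by (simp add: algebra_simps power2_eq_square)
    qed
    have e2: "(sig F - S) * N * i = (sig F - S) * N ^ 2 + (sig F - S) * N * psi F v * N * i"
      using arg_cong[OF i(1), of "\<lambda>x. (sig F - S) * N * x"] by (simp add: algebra_simps power2_eq_square)
    have "P = (X + (l * m + e) + (m * g a - ((sig F - S) + Z)) * N) * i"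
      using P mP tv by (simp add: i_def)
    also have "\<dots> = X * i + l * (m * i) + e * i + g a * N * (m * i) - (sig F - S) * N * i - Z * N * i"
      by (simp add: algebra_simps)
    finally have P2: "P = X * i + l + (e * N + e * psi F v * N ^ 2 + e * psi F v ^ 2 * N ^ 2 * i) + g a * N - ((sig F - S) * N ^ 2 + (sig F - S) * N * psi F v * N * i) - Z * N * i"
      unfolding i(2) e1 e2 by simp
    show ?thesis unfolding i_def[symmetric]
      by (subst P2) (simp add: g_def f_def c_def algebra_simps power2_eq_square)
  qed
  show ?thesis unfolding P_def[symmetric] N_def[symmetric] e_def[symmetric] S_def[symmetric] K_def[symmetric] eq
  proof (rule bd_addI)
    show "bd 65 (-3) (X * (1 / m) - Z * N * (1 / m))"
      by (rule bd_diffI[OF bd_mult[OF bX m(2)] bd_mult[OF bd_mult[OF bZ N(1)] m(2)]]) auto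
    show "bd 12 (-3) (e * psi F v ^ 2 * N ^ 2 * (1 / m) - (sig F - S) * N * psi F v * N * (1 / m))"
      by (rule bd_diffI[OF bd_mult[OF bd_mult[OF bd_mult[OF be bd_power[OF bpsi, of 2]] bd_power[OF N(1), of 2]] m(2)]
        bd_mult[OF bd_mult[OF bd_mult[OF bd_mult[OF bS N(1)] bpsi] N(1)] m(2)]]) auto
  qed auto
qed

end

subsection \<open>The exponent as a potential\<close>

abbreviation xo :: "(nat \<times> nat) set \<Rightarrow> nat \<Rightarrow> real" where "xo H j \<equiv> real (card (rw H j))"
abbreviation yi :: "(nat \<times> nat) set \<Rightarrow> nat \<Rightarrow> real" where "yi H k \<equiv> real (card (cl H k))"

text \<open>The exponent as a linear form in the statistics of \<open>H\<close>. With the square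
  \<open>X2\<close> kept apart from \<open>X\<close>, an increment of the exponent is again a value
  of \<open>mform\<close>.\<close>

definition mform :: "real \<Rightarrow> real \<Rightarrow> real \<Rightarrow> real \<Rightarrow> real \<Rightarrow> real \<Rightarrow> real \<Rightarrow> real \<Rightarrow> real \<Rightarrow> real \<Rightarrow> real" where
  "mform l N X X2 R11 Y R02 R03 R12 R21 =
      l * X / ((1 - l) * N) + l * X2 / (2 * (1 - l) * N^2) - R11 / ((1 - l) * N) - Y / (l * (1 - l) * N^2)
      + l * R02 / (2 * (1 - l) * N) + l * (1 - 2*l) * R03 / (6 * (1 - l)^2 * N^2)
      - (1 - 2*l) * R12 / (2 * (1 - l)^2 * N^2) - R21 / (2 * (1 - l)^2 * N^2)"

definition psum :: "nat \<Rightarrow> (nat \<Rightarrow> real) \<Rightarrow> (nat \<Rightarrow> real) \<Rightarrow> (nat \<times> nat) set \<Rightarrow> nat \<Rightarrow> nat \<Rightarrow> real" where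
  "psum n \<delta> \<eta> H h k = (\<Sum>j<n. \<delta> j ^ h * xo H j ^ k) + (\<Sum>j<n. \<eta> j ^ h * yi H j ^ k)"

text \<open>One function covers both exponents, \<open>potential_Mexp\<close> and
  \<open>potential_Texp\<close>: the second arises from the density and deviations of the
  complement.\<close>

definition potential :: "real \<Rightarrow> nat \<Rightarrow> (nat \<Rightarrow> real) \<Rightarrow> (nat \<Rightarrow> real) \<Rightarrow> (nat \<times> nat) set \<Rightarrow> real" where
  "potential l n \<delta> \<eta> H = mform l (real n) (real (card H)) (real (card H) ^ 2) (psum n \<delta> \<eta> H 1 1)
     (\<Sum>(j,k)\<in>H. \<delta> j * \<eta> k) (psum n \<delta> \<eta> H 0 2) (psum n \<delta> \<eta> H 0 3) (psum n \<delta> \<eta> H 1 2) (psum n \<delta> \<eta> H 2 1)"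

lemma mform_diff:
  "mform l N X X2 R11 Y R02 R03 R12 R21 - mform l N X' X2' R11' Y' R02' R03' R12' R21'
   = mform l N (X - X') (X2 - X2') (R11 - R11') (Y - Y') (R02 - R02') (R03 - R03') (R12 - R12') (R21 - R21')"
  by (simp add: mform_def diff_divide_distrib right_diff_distrib)

lemma sum_diff_single:
  fixes f g :: "'a \<Rightarrow> real"
  assumes "finite A" "j \<in> A" "\<And>i. i \<in> A \<Longrightarrow> i \<noteq> j \<Longrightarrow> f i = g i"
  shows "(\<Sum>i\<in>A. f i) - (\<Sum>i\<in>A. g i) = f j - g j"
proof -
  have "(\<Sum>i\<in>A. f i) = f j + (\<Sum>i\<in>A - {j}. f i)" "(\<Sum>i\<in>A. g i) = g j + (\<Sum>i\<in>A - {j}. g i)"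
    using assms by (simp_all add: sum.remove)
  moreover have "(\<Sum>i\<in>A - {j}. f i) = (\<Sum>i\<in>A - {j}. g i)" using assms by (intro sum.cong) auto
  ultimately show ?thesis by simp
qed

text \<open>The part of \<open>n^2\<close> times the increment of the exponent that is negligible.\<close>

definition low :: "real \<Rightarrow> real \<Rightarrow> real \<Rightarrow> real \<Rightarrow> real \<Rightarrow> real \<Rightarrow> real \<Rightarrow> real" where
  "low l i g x y d e = (i * l * (1/2) - (d * l + e * l + l * l) * (g * i)) +
     (l * (1 - 2 * l) * i^2 * ((3 * x + 3 * y + 2) * (1/6)) -
     (1 - 2 * l) * i^2 * ((d + l * (2 * x + 1) + e + l * (2 * y + 1)) * (1/2))) -
     i^2 * ((2 * l * d + l^2 * (x + 1) + 2 * l * e + l^2 * (y + 1)) * (1/2))"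

text \<open>At order \<open>M\<close> the terms \<open>l * x\<close> and \<open>l * y\<close> from
  \<open>R11\<close> cancel against \<open>R02\<close> and \<open>X\<close>, and at order
  \<open>M^2\<close> the squares \<open>x^2\<close> and \<open>y^2\<close> from \<open>R03\<close>
  cancel against those from \<open>R12\<close>. What remains has to match the logarithm of a
  probability.\<close>

lemma mform_step:
  fixes l N X x y d e E :: real
  assumes "l \<noteq> 0" "1 - l \<noteq> 0" "N \<noteq> 0"
  defines "i \<equiv> 1 / (1 - l)" and "g \<equiv> 1 / l" and "M \<equiv> 1 / N"
  shows "mform l N 1 (2 * X + 1) ((d + l * x + l) + (e + l * y + l)) ((d + l) * (e + l) + l * E) ((2 * x + 1) + (2 * y + 1))
     ((3 * x^2 + 3 * x + 1) + (3 * y^2 + 3 * y + 1)) ((d * (2 * x + 1) + l * (x + 1)^2) + (e * (2 * y + 1) + l * (y + 1)^2))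
     ((d^2 + 2 * l * d * (x + 1) + l^2 * (x + 1)) + (e^2 + 2 * l * e * (y + 1) + l^2 * (y + 1)))
    = - (d + e) * i * M + M^2 * (l * X * i - (d * e + l * E) * (g * i) - i * (d * x + e * y) - i^2 * (d^2 + e^2) * (1/2) + low l i g x y d e)"
proof -
  have mf: "mform l N A B C D F G H J = l * A * i * M + l * B * (1/2) * i * M^2 - C * i * M - D * (g * i) * M^2
      + l * F * (1/2) * i * M + l * (1 - 2*l) * G * (1/6) * i^2 * M^2
      - (1 - 2*l) * H * (1/2) * i^2 * M^2 - J * (1/2) * i^2 * M^2" for A B C D F G H J
    by (simp add: mform_def i_def g_def M_def power_divide)
  \<comment> \<open>The coefficient of \<open>d * x\<close> arrives as
    \<open>(1 - 2 * l) * i^2\<close> from \<open>R12\<close> plus \<open>l * i^2\<close> from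
    \<open>R21\<close>, up to sign; together this is \<open>i\<close>.\<close>
  have i: "(1 - l) * i = 1" using assms(2) by (simp add: i_def)
  then have i2: "i = (1 - l) * i^2" by (simp add: power2_eq_square)
  have "M^2 * (i * (d * x + e * y)) = M^2 * ((1 - l) * i^2 * (d * x + e * y))" using i2 by simp
  then show ?thesis unfolding mf low_def by (simp add: algebra_simps power2_eq_square)
qed

text \<open>The coefficients of \<open>d * e\<close> meet here: \<open>K * i\<close> from the
  second-order probability, \<open>i^2\<close> from the square in the logarithm and
  \<open>g * i\<close> from \<open>Y\<close>. They cancel because
  \<open>i * K + i^2 = g * i\<close>, while the \<open>E\<close> terms cancel by
  \<open>g * i * l = i\<close>.\<close>

lemma step_algebra:
  fixes l i g K d e x y E X M \<rho> L1 z z1 z2 z3 :: real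
  assumes i: "(1 - l) * i = 1" and g: "l * g = 1" and K: "K = (1 - 2 * l) * (g * i)"
    and z: "z = z1 + z2 + z3" and z1: "z1 = (d + e) * M"
    and z2: "z2 = \<rho> * M + (x * d + y * e + E + K * d * e - l * X) * M^2"
  shows "(- (d + e) * i * M + M^2 * (l * X * i - (d * e + l * E) * (g * i) - i * (d * x + e * y) - i^2 * (d^2 + e^2) * (1/2) + L1))
    - \<rho> * i * M + z * i + z^2 * i^2 * (1/2) = M^2 * L1 + z3 * i + (z2 + z3) * (z1 + z) * i^2 * (1/2)"
proof -
  have k1: "g * i * l = i" using g by (metis mult.assoc mult.commute mult_1)
  have k2: "i * K + i^2 = g * i"
  proof -
    have "i * K + i^2 = g * i * ((1 - 2 * l) * i + l * i)" using k1 unfolding K by (simp add: algebra_simps power2_eq_square)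
    also have "(1 - 2 * l) * i + l * i = 1" using i by (simp add: algebra_simps)
    finally show ?thesis by simp
  qed
  have zz: "z^2 = z1^2 + (z2 + z3) * (z1 + z)" unfolding z by (simp add: power2_eq_square algebra_simps)
  have "(- (d + e) * i * M + M^2 * (l * X * i - (d * e + l * E) * (g * i) - i * (d * x + e * y) - i^2 * (d^2 + e^2) * (1/2) + L1))
    - \<rho> * i * M + z1 * i + z2 * i + z1^2 * i^2 * (1/2) = M^2 * L1 + M^2 * (d * e * ((i * K + i^2) - g * i) + E * (i - g * i * l))"
    unfolding z1 z2 by (simp add: algebra_simps power2_eq_square)
  also have "\<dots> = M^2 * L1" unfolding k1 k2 by simp
  finally show ?thesis unfolding zz by (simp add: z algebra_simps)
qed

definition diag :: "nat \<Rightarrow> (nat \<times> nat) set" where "diag n = {(i,i) | i. i < n}"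

text \<open>The density \<open>l\<close> is not forced to be the average degree divided by \<open>n\<close>: complementation turns
  \<open>\<lambda>\<close> into \<open>1 - \<lambda> - 1/n\<close>, whereas the exponent is wanted at \<open>1 - \<lambda>\<close>. Avoiding \<open>H\<close> corresponds to
  \<open>\<rho> = l\<close> and \<open>B = 1 - p\<close>, containing \<open>H\<close> to \<open>\<rho> = l - 1\<close> and \<open>B = p\<close> for the complementary degrees.\<close>

locale telescope = near_regular +
  fixes \<rho> B :: real
  assumes rho: "\<bar>\<rho>\<bar> \<le> 1" and total_eq: "(\<Sum>a<n. real (s a)) = l * real n ^ 2 + (\<rho> - l) * real n"
    and lnB: "bd 3 (-3) (ln B - (ln (1 - l) - \<rho> * (1 / (1 - l)) * (1 / real n)))"
begin

text \<open>The shift \<open>l - \<rho>\<close> vanishes for \<open>\<rho> = l\<close>, where this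
  is the deviation of the theorem. For the complement, with density \<open>1 - \<lambda>\<close> and
  \<open>\<rho> = - \<lambda>\<close>, it makes \<open>del\<close> equal to
  \<open>x_j - \<delta>_j\<close> in terms of the original degrees.\<close>

definition del :: "(nat \<times> nat) set \<Rightarrow> nat \<Rightarrow> real" where
  "del H j = real (s j) - l * real n + l * xo H j + (l - \<rho>)"
definition et :: "(nat \<times> nat) set \<Rightarrow> nat \<Rightarrow> real" where
  "et H j = real (t j) - l * real n + l * yi H j + (l - \<rho>)"
abbreviation pot where "pot H \<equiv> potential l n (del H) (et H) H"

lemma rw_insert: "(j,k) \<notin> H \<Longrightarrow> finite H \<Longrightarrow> xo (insert (j,k) H) i = xo H i + of_bool (i = j)"
  and cl_insert: "(j,k) \<notin> H \<Longrightarrow> finite H \<Longrightarrow> yi (insert (j,k) H) i = yi H i + of_bool (i = k)"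
proof -
  assume a: "(j,k) \<notin> H" "finite H"
  have fin: "finite (rw H i)" "finite (cl H i)" for i
    using a(2) finite_subset[of "rw H i" "snd ` H"] finite_subset[of "cl H i" "fst ` H"] by force+
  have "rw (insert (j,k) H) i = (if i = j then insert k (rw H i) else rw H i)"
    "cl (insert (j,k) H) i = (if i = k then insert j (cl H i) else cl H i)" by auto
  then show "xo (insert (j,k) H) i = xo H i + of_bool (i = j)" "yi (insert (j,k) H) i = yi H i + of_bool (i = k)"
    using a fin by auto
qed

lemma pot_step:
  assumes "finite H" "(j,k) \<notin> H" "j < n" "k < n"
  shows "pot (insert (j,k) H) - pot H = mform l (real n) 1 (2 * real (card H) + 1)
    ((del H j + l * xo H j + l) + (et H k + l * yi H k + l))
    ((del H j + l) * (et H k + l) + l * ((\<Sum>w\<in>rw H j. et H w) + (\<Sum>b\<in>cl H k. del H b)))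
    ((2 * xo H j + 1) + (2 * yi H k + 1))
     ((3 * xo H j^2 + 3 * xo H j + 1) + (3 * yi H k^2 + 3 * yi H k + 1))
     ((del H j * (2 * xo H j + 1) + l * (xo H j + 1)^2) + (et H k * (2 * yi H k + 1) + l * (yi H k + 1)^2))
     ((del H j^2 + 2 * l * del H j * (xo H j + 1) + l^2 * (xo H j + 1)) + (et H k^2 + 2 * l * et H k * (yi H k + 1) + l^2 * (yi H k + 1)))"
proof -
  let ?H = "insert (j,k) H"
  have x: "xo ?H i = xo H i + of_bool (i = j)" "yi ?H i = yi H i + of_bool (i = k)" for i
    using rw_insert[OF assms(2,1)] cl_insert[OF assms(2,1)] by auto
  have d: "del ?H i = del H i + l * of_bool (i = j)" "et ?H i = et H i + l * of_bool (i = k)" for i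
    by (simp_all only: del_def et_def x) (simp_all add: algebra_simps)
  have ps: "psum n (del ?H) (et ?H) ?H h m - psum n (del H) (et H) H h m
    = ((del H j + l) ^ h * (xo H j + 1) ^ m - del H j ^ h * xo H j ^ m) + ((et H k + l) ^ h * (yi H k + 1) ^ m - et H k ^ h * yi H k ^ m)" for h m
  proof -
    have "(\<Sum>i<n. del ?H i ^ h * xo ?H i ^ m) - (\<Sum>i<n. del H i ^ h * xo H i ^ m)
      = del ?H j ^ h * xo ?H j ^ m - del H j ^ h * xo H j ^ m"
      by (rule sum_diff_single) (use assms in \<open>auto simp: x d\<close>)
    moreover have "(\<Sum>i<n. et ?H i ^ h * yi ?H i ^ m) - (\<Sum>i<n. et H i ^ h * yi H i ^ m)
      = et ?H k ^ h * yi ?H k ^ m - et H k ^ h * yi H k ^ m"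
      by (rule sum_diff_single) (use assms in \<open>auto simp: x d\<close>)
    ultimately show ?thesis by (simp add: psum_def x d)
  qed
  \<comment> \<open>The deviations depend on \<open>H\<close> themselves, so the terms of the older
    arcs out of \<open>j\<close> and into \<open>k\<close> change too.\<close>
  have Y: "(\<Sum>(a,b)\<in>?H. del ?H a * et ?H b) - (\<Sum>(a,b)\<in>H. del H a * et H b)
    = (del H j + l) * (et H k + l) + l * ((\<Sum>w\<in>rw H j. et H w) + (\<Sum>b\<in>cl H k. del H b))"
  proof -
    have 1: "(\<Sum>(a,b)\<in>H. of_bool (a = j) * et H b) = (\<Sum>w\<in>rw H j. et H w)"
    proof -
      have "(\<Sum>(a,b)\<in>H. of_bool (a = j) * et H b) = (\<Sum>(a,b)\<in>{p \<in> H. fst p = j}. et H b)"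
        using assms(1) by (intro sum.mono_neutral_cong_right) (auto split: if_splits)
      also have "\<dots> = (\<Sum>w\<in>rw H j. et H w)"
        by (rule sum.reindex_bij_witness[of _ "\<lambda>w. (j,w)" snd]) auto
      finally show ?thesis .
    qed
    have 2: "(\<Sum>(a,b)\<in>H. of_bool (b = k) * del H a) = (\<Sum>a\<in>cl H k. del H a)"
    proof -
      have "(\<Sum>(a,b)\<in>H. of_bool (b = k) * del H a) = (\<Sum>(a,b)\<in>{p \<in> H. snd p = k}. del H a)"
        using assms(1) by (intro sum.mono_neutral_cong_right) (auto split: if_splits)
      also have "\<dots> = (\<Sum>a\<in>cl H k. del H a)"
        by (rule sum.reindex_bij_witness[of _ "\<lambda>w. (w,k)" fst]) auto
      finally show ?thesis .
    qed
    have "(\<Sum>(a,b)\<in>H. del ?H a * et ?H b) = (\<Sum>(a,b)\<in>H. del H a * et H b + l * (of_bool (a = j) * et H b) + l * (of_bool (b = k) * del H a))"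
      using assms(2) by (intro sum.cong refl) (auto simp: d algebra_simps)
    also have "\<dots> = (\<Sum>(a,b)\<in>H. del H a * et H b) + l * (\<Sum>(a,b)\<in>H. of_bool (a = j) * et H b) + l * (\<Sum>(a,b)\<in>H. of_bool (b = k) * del H a)"
      by (simp only: split_def sum.distrib sum_distrib_left)
    finally have "(\<Sum>(a,b)\<in>H. del ?H a * et ?H b) = (\<Sum>(a,b)\<in>H. del H a * et H b) + l * (\<Sum>w\<in>rw H j. et H w) + l * (\<Sum>a\<in>cl H k. del H a)"
      unfolding 1 2 .
    moreover have "(\<Sum>(a,b)\<in>?H. del ?H a * et ?H b) = del ?H j * et ?H k + (\<Sum>(a,b)\<in>H. del ?H a * et ?H b)"
      using assms by simp
    moreover have "del ?H j * et ?H k = (del H j + l) * (et H k + l)" by (simp add: d)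
    ultimately show ?thesis by (simp add: algebra_simps)
  qed
  have cH: "real (card ?H) = real (card H) + 1" using assms by simp
  show ?thesis unfolding potential_def mform_diff ps Y cH
    by (rule arg_cong[where f = "\<lambda>z. z"], rule cong[OF cong[OF cong[OF cong[OF cong[OF cong[OF cong[OF cong[OF refl]]]]]]]])
      (simp_all add: power2_eq_square power3_eq_cube algebra_simps)
qed

end

section \<open>The increment of the exponent against the probability of one arc\<close>

context telescope begin

definition Fz where "Fz H = diag n \<union> H"

lemma rw_Fz:
  assumes "H \<subseteq> arcs n" "j < n"
  shows "rw (Fz H) j = insert j (rw H j)" "cl (Fz H) j = insert j (cl H j)" "j \<notin> rw H j" "j \<notin> cl H j"
    "finite (rw H j)" "finite (cl H j)"
proof -
  show "rw (Fz H) j = insert j (rw H j)" "cl (Fz H) j = insert j (cl H j)"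
    using assms by (auto simp: Fz_def diag_def)
  show "j \<notin> rw H j" "j \<notin> cl H j" using assms by (auto simp: arcs_def)
  have "H \<subseteq> {..<n} \<times> {..<n}" using assms by (auto simp: arcs_def)
  then show "finite (rw H j)" "finite (cl H j)" by (auto intro: finite_rw finite_cl)
qed

lemma card_Fz:
  assumes "H \<subseteq> arcs n" shows "card (Fz H) = n + card H" "finite H"
proof -
  have "H \<subseteq> {..<n} \<times> {..<n}" using assms by (auto simp: arcs_def)
  then show fin: "finite H" using finite_subset by blast
  have "diag n = (\<lambda>i. (i,i)) ` {..<n}" by (auto simp: diag_def)
  then have d: "finite (diag n)" "card (diag n) = n" by (auto simp: card_image inj_on_def)
  have "diag n \<inter> H = {}" using assms by (auto simp: diag_def arcs_def)
  then show "card (Fz H) = n + card H" unfolding Fz_def using d fin by (simp add: card_Un_disjoint)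
qed

lemma step_bound:
  assumes H: "H \<subseteq> arcs n" and c: "cls 0 (Fz H) {}" and jk: "(j,k) \<in> arcs n" "(j,k) \<notin> H"
  shows "bd 70 (-3) (pot (insert (j,k) H) - pot H + ln B - ln (1 - pr (Fz H) {} j k))"
proof -
  let ?F = "Fz H"
  have k0: "0 \<le> (10::nat)" by simp
  have j: "j < n" "k < n" "j \<noteq> k" using jk by (auto simp: arcs_def)
  have nF: "(j,k) \<notin> ?F" using jk j by (auto simp: Fz_def diag_def)
  define d e x y X where "d = del H j" and "e = et H k" and "x = xo H j" and "y = yi H k" and "X = real (card H)"
  define E1 E2 where "E1 = (\<Sum>w\<in>rw H j. et H w)" and "E2 = (\<Sum>b\<in>cl H k. del H b)"
  define M i g K where "M = 1 / real n" and "i = 1 / (1 - l)" and "g = 1 / l" and "K = kappa"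
  define P where "P = pr ?F {} j k"
  define z where "z = P - l"
  define z1 where "z1 = (d + e) * M"
  define z2 where "z2 = \<rho> * M + (x * d + y * e + (E1 + E2) + K * d * e - l * X) * M^2"
  define z3 where "z3 = z - z1 - z2"
  define L1 where "L1 = low l i g x y d e"
  have M: "bd 0 (-2) M" "M * real n = 1" using bd_n(2) n_ge by (auto simp: M_def)
  have bi: "bd 1 0 i" "bd 1 0 g" "bd 2 0 (g * i)" "bd 2 0 K"
  proof -
    show "bd 1 0 i" "bd 1 0 g" "bd 2 0 K" using bd_l bd_kappa(2) by (simp_all only: i_def g_def K_def)
    have "1 / q = g * i" by (simp add: g_def i_def)
    then show "bd 2 0 (g * i)" using bd_kappa(1) by (simp only:)
  qed
  have brho: "bd 0 0 \<rho>" using rho by (rule bd_one)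
  \<comment> \<open>The diagonal adds one frozen cell to each row and column; its share
    \<open>l\<close> replaces the shift \<open>l - \<rho>\<close> and leaves
    \<open>\<rho>\<close>.\<close>
  have dF: "dd ?F a = del H a + \<rho>" "ee ?F a = et H a + \<rho>" "phi ?F a = xo H a + 1" "psi ?F a = yi H a + 1" if "a < n" for a
    using rw_Fz[OF H that] by (simp_all add: dd_def ee_def del_def et_def algebra_simps)
  have bde: "bd 3 1 (del H a)" "bd 3 1 (et H a)" "bd 3 1 (xo H a)" "bd 3 1 (yi H a)" if "a < n" for a
  proof -
    have "del H a = dd ?F a - \<rho>" "et H a = ee ?F a - \<rho>" "xo H a = phi ?F a - 1" "yi H a = psi ?F a - 1" using dF[OF that] by auto
    moreover have "bd 3 1 (dd ?F a - \<rho>)" by (rule bd_diffI[OF bd_dd(1)[OF c k0 that] brho]) auto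
    moreover have "bd 3 1 (ee ?F a - \<rho>)" by (rule bd_diffI[OF bd_dd(2)[OF c k0 that] brho]) auto
    moreover have "bd 3 1 (phi ?F a - 1)" by (rule bd_diffI[OF bd_rwF(1)[OF c k0 that] bd_const[of 1]]) auto
    moreover have "bd 3 1 (psi ?F a - 1)" by (rule bd_diffI[OF bd_rwF(2)[OF c k0 that] bd_const[of 1]]) auto
    ultimately show "bd 3 1 (del H a)" "bd 3 1 (et H a)" "bd 3 1 (xo H a)" "bd 3 1 (yi H a)" by (simp_all only:)
  qed
  have bdx: "bd 3 1 d" "bd 3 1 e" "bd 3 1 x" "bd 3 1 y" unfolding d_def e_def x_def y_def using bde j by auto
  have sub: "H \<subseteq> {..<n} \<times> {..<n}" using H by (auto simp: arcs_def)
  have bE: "bd 6 2 E1" "bd 6 2 E2"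
  proof -
    show "bd 6 2 E1" unfolding E1_def
      by (rule bd_weaken[OF bd_sum[OF bde(2) bde(3)[OF j(1)]]]) (use rw_subset[OF sub, of j] in auto)
    show "bd 6 2 E2" unfolding E2_def
      by (rule bd_weaken[OF bd_sum[OF bde(1) bde(4)[OF j(2)]]]) (use cl_subset[OF sub, of k] in auto)
  qed
  have bX: "bd 1 2 X"
  proof -
    have "X \<le> \<theta> * real n" using clsD(8)[OF c] card_Fz[OF H] by (simp add: X_def)
    then show ?thesis by (simp add: bd_def X_def rn)
  qed
  have EEF: "EE ?F j = (et H j + \<rho>) + (E1 + \<rho> * x)"
  proof -
    have "EE ?F j = (\<Sum>w\<in>insert j (rw H j). et H w + \<rho>)"
      unfolding EE_def rw_Fz(1)[OF H j(1)] using rw_subset[OF sub, of j] j by (intro sum.cong refl dF(2)) auto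
    then show ?thesis using rw_Fz[OF H j(1)] by (simp add: sum.distrib E1_def x_def algebra_simps)
  qed
  have DCF: "DC ?F k = (del H k + \<rho>) + (E2 + \<rho> * y)"
  proof -
    have "DC ?F k = (\<Sum>w\<in>insert k (cl H k). del H w + \<rho>)"
      unfolding DC_def rw_Fz(2)[OF H j(2)] using cl_subset[OF sub, of k] j by (intro sum.cong refl dF(1)) auto
    then show ?thesis using rw_Fz[OF H j(2)] by (simp add: sum.distrib E2_def y_def algebra_simps)
  qed
  have sigF: "sig ?F = \<rho> * real n + l * X"
    unfolding sig_def total_eq using card_Fz[OF H] by (simp add: X_def algebra_simps)
  have bz: "bd 6 (-1) z" unfolding z_def P_def by (rule pr_rough[OF c k0 j(1,2) nF])
  have bz1: "bd 4 (-1) z1" unfolding z1_def by (rule bd_multI[OF bd_addI[OF bdx(1,2), of 4 1] M(1)]) auto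
  have bz3: "bd 67 (-3) z3"
  proof -
    \<comment> \<open>\<open>Lz\<close> collects what the diagonal and the shift by
      \<open>\<rho>\<close> contribute to the second-order terms. It has order \<open>r\<close> and
      is divided by \<open>n^2\<close>.\<close>
    define Lz where "Lz = ((x * \<rho> + y * \<rho>) + (d + e + \<rho> + \<rho>)) + ((et H j + \<rho> + \<rho> * x) + (del H k + \<rho> + \<rho> * y)) + K * (\<rho> * (d + e + \<rho>))"
    have "bd 66 (-3) (P - (l + (dd ?F j + ee ?F k) * M - sig ?F * M^2 + (phi ?F j * dd ?F j + EE ?F j + psi ?F k * ee ?F k + DC ?F k) * M^2
      + K * dd ?F j * ee ?F k * M^2))" unfolding P_def M_def K_def by (rule pr_second[OF c j(1,2) nF])
    moreover have "P - (l + (dd ?F j + ee ?F k) * M - sig ?F * M^2 + (phi ?F j * dd ?F j + EE ?F j + psi ?F k * ee ?F k + DC ?F k) * M^2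
      + K * dd ?F j * ee ?F k * M^2) = z3 - Lz * M^2"
    proof -
      have nM: "real n * M^2 = M" using M(2) by (simp add: power2_eq_square mult.commute mult.left_commute)
      have s: "sig ?F * M^2 = \<rho> * M + l * X * M^2" unfolding sigF using nM by (simp add: algebra_simps)
      show ?thesis unfolding s EEF DCF dF[OF j(1)] dF[OF j(2)] d_def[symmetric] e_def[symmetric] x_def[symmetric] y_def[symmetric]
        by (simp add: z3_def z_def z1_def z2_def Lz_def algebra_simps)
    qed
    ultimately have 1: "bd 66 (-3) (z3 - Lz * M^2)" by (simp only:)
    have bLz: "bd 9 1 Lz"
    proof -
      have a1: "bd 4 1 (x * \<rho> + y * \<rho>)" by (rule bd_addI[OF bd_mult[OF bdx(3) brho] bd_mult[OF bdx(4) brho]]) auto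
      have a2: "bd 4 1 (d + e)" by (rule bd_addI[OF bdx(1,2)]) auto
      have a3: "bd 5 1 (d + e + \<rho>)" by (rule bd_addI[OF a2 brho]) auto
      have a4: "bd 6 1 (d + e + \<rho> + \<rho>)" by (rule bd_addI[OF a3 brho]) auto
      have a5: "bd 7 1 ((x * \<rho> + y * \<rho>) + (d + e + \<rho> + \<rho>))" by (rule bd_addI[OF a1 a4]) auto
      have a6: "bd 5 1 (et H j + \<rho> + \<rho> * x)"
        by (rule bd_addI[OF bd_addI[OF bde(2)[OF j(1)] brho, of 4 1] bd_mult[OF brho bdx(3)]]) auto
      have a7: "bd 5 1 (del H k + \<rho> + \<rho> * y)"
        by (rule bd_addI[OF bd_addI[OF bde(1)[OF j(2)] brho, of 4 1] bd_mult[OF brho bdx(4)]]) auto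
      have a8: "bd 6 1 ((et H j + \<rho> + \<rho> * x) + (del H k + \<rho> + \<rho> * y))" by (rule bd_addI[OF a6 a7]) auto
      have a9: "bd 7 1 (K * (\<rho> * (d + e + \<rho>)))" by (rule bd_weaken[OF bd_mult[OF bi(4) bd_mult[OF brho a3]]]) auto
      show ?thesis unfolding Lz_def by (rule bd_addI[OF bd_addI[OF a5 a8, of 8 1] a9]) auto
    qed
    have 2: "bd 9 (-3) (Lz * M^2)" by (rule bd_weaken[OF bd_mult[OF bLz bd_power[OF M(1), of 2]]]) auto
    have "bd 67 (-3) ((z3 - Lz * M^2) + Lz * M^2)" by (rule bd_addI[OF 1 2]) auto
    then show ?thesis by simp
  qed
  have bz2: "bd 13 (-2) z2"
  proof -
    have b1: "bd 7 2 (x * d + y * e)" by (rule bd_addI[OF bd_mult[OF bdx(3,1)] bd_mult[OF bdx(4,2)]]) auto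
    have b2: "bd 7 2 (E1 + E2)" by (rule bd_addI[OF bE]) auto
    have b3: "bd 8 2 (x * d + y * e + (E1 + E2))" by (rule bd_addI[OF b1 b2]) auto
    have b4: "bd 8 2 (K * d * e)" by (rule bd_weaken[OF bd_mult[OF bd_mult[OF bi(4) bdx(1)] bdx(2)]]) auto
    have b5: "bd 9 2 (x * d + y * e + (E1 + E2) + K * d * e)" by (rule bd_addI[OF b3 b4]) auto
    have b6: "bd 10 2 (x * d + y * e + (E1 + E2) + K * d * e - l * X)" by (rule bd_diffI[OF b5 bd_mult[OF bd_l(1) bX]]) auto
    show ?thesis unfolding z2_def
      by (rule bd_addI[OF bd_mult[OF brho M(1)] bd_mult[OF b6 bd_power[OF M(1), of 2]]]) auto
  qed
  have bL1: "bd 13 1 L1"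
  proof -
    have h: "bd 0 0 (1/2)" "bd 0 0 (1/6)" by (rule bd_one, simp)+
    have l2: "bd 0 0 (l * l)" "bd 0 0 (l^2)" using bd_mult[OF bd_l(1) bd_l(1)] by (simp_all add: power2_eq_square)
    have i2: "bd 2 0 (i^2)" using bd_power[OF bi(1), of 2] by simp
    have c1: "bd 1 1 (i * l * (1/2))" by (rule bd_weaken[OF bd_mult[OF bd_mult[OF bi(1) bd_l(1)] h(1)]]) auto
    have c2: "bd 5 1 (d * l + e * l + l * l)"
      by (rule bd_addI[OF bd_addI[OF bd_mult[OF bdx(1) bd_l(1)] bd_mult[OF bdx(2) bd_l(1)], of 4 1] l2(1)]) auto
    have c3: "bd 8 1 (i * l * (1/2) - (d * l + e * l + l * l) * (g * i))" by (rule bd_diffI[OF c1 bd_mult[OF c2 bi(3)]]) auto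
    have c4: "bd 6 1 (3 * x + 3 * y + 2)"
      by (rule bd_addI[OF bd_addI[OF bd_mult[OF bd_const[of 3] bdx(3)] bd_mult[OF bd_const[of 3] bdx(4)], of 5 1] bd_const[of 2]]) auto
    have c5: "bd 8 1 (l * (1 - 2 * l) * i^2 * ((3 * x + 3 * y + 2) * (1/6)))"
      by (rule bd_weaken[OF bd_mult[OF bd_mult[OF bd_mult[OF bd_l(1) bd_1_2l] i2] bd_mult[OF c4 h(2)]]]) auto
    have c6: "bd 5 1 (2 * w + 1)" if "bd 3 1 w" for w by (rule bd_addI[OF bd_mult[OF bd_const[of 2] that] bd_const[of 1]]) auto
    have c7: "bd 8 1 (d + l * (2 * x + 1) + e + l * (2 * y + 1))"
      by (rule bd_addI[OF bd_addI[OF bd_addI[OF bdx(1) bd_mult[OF bd_l(1) c6[OF bdx(3)]], of 6 1] bdx(2), of 7 1] bd_mult[OF bd_l(1) c6[OF bdx(4)]]]) auto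
    have c8: "bd 10 1 ((1 - 2 * l) * i^2 * ((d + l * (2 * x + 1) + e + l * (2 * y + 1)) * (1/2)))"
      by (rule bd_weaken[OF bd_mult[OF bd_mult[OF bd_1_2l i2] bd_mult[OF c7 h(1)]]]) auto
    have c9: "bd 4 1 (w + 1)" if "bd 3 1 w" for w by (rule bd_addI[OF that bd_const[of 1]]) auto
    have tl: "bd 1 0 (2 * l)" by (rule bd_weaken[OF bd_mult[OF bd_const[of 2] bd_l(1)]]) auto
    have c10: "bd 7 1 (2 * l * d + l^2 * (x + 1) + 2 * l * e + l^2 * (y + 1))"
      by (rule bd_addI[OF bd_addI[OF bd_addI[OF bd_mult[OF tl bdx(1)] bd_mult[OF l2(2) c9[OF bdx(3)]], of 5 1] bd_mult[OF tl bdx(2)], of 6 1] bd_mult[OF l2(2) c9[OF bdx(4)]]]) auto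
    have c11: "bd 9 1 (i^2 * ((2 * l * d + l^2 * (x + 1) + 2 * l * e + l^2 * (y + 1)) * (1/2)))"
      by (rule bd_weaken[OF bd_mult[OF i2 bd_mult[OF c10 h(1)]]]) auto
    show ?thesis unfolding L1_def low_def
      by (rule bd_diffI[OF bd_addI[OF c3 bd_diffI[OF c5 c8, of 11 1], of 12 1] c11]) auto
  qed
  \<comment> \<open>The relative deviation of the avoidance probability:
    \<open>1 - P = (1 - l) * (1 - w)\<close>.\<close>
  define w where "w = z * i"
  have bw: "bd 7 (-1) w" unfolding w_def by (rule bd_multI[OF bz bi(1)]) auto
  have wle: "\<bar>w\<bar> \<le> 1/2"
  proof -
    have "\<theta> ^ 7 * 100 \<le> \<theta> ^ 7 * \<theta>" using theta_ge by (intro mult_left_mono) auto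
    also have "\<dots> = \<theta> ^ 8" by (simp flip: power_Suc2)
    also have "\<dots> \<le> \<theta> ^ 100" using theta_pos by (intro power_increasing) auto
    also have "\<dots> \<le> r" by (rule r_ge)
    finally have "\<theta> ^ 7 * r powi (-1) \<le> 1/2" using r_pos by (simp add: power_int_minus field_simps)
    then show ?thesis using bdD[OF bw] by linarith
  qed
  define L3 where "L3 = ln (1 - w) + w + w^2 / 2"
  have bL3: "bd 22 (-3) L3"
  proof -
    have "bd 22 (-3) (2 * \<bar>w\<bar> ^ 3)" by (rule bd_weaken[OF bd_mult[OF bd_const[of 2] bd_power[OF bd_abs[OF bw], of 3]]]) auto
    then show ?thesis using ln_cubic_bound[OF wle] unfolding L3_def by (rule bd_le)
  qed
  have ii: "(1 - l) * i = 1" "l * g = 1" using l_bounds by (simp_all add: i_def g_def)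
  have lnP: "ln (1 - P) = ln (1 - l) + (L3 - z * i - z^2 * i^2 * (1/2))"
  proof -
    have "1 - P = (1 - l) * (1 - w)"
    proof -
      have "(1 - l) * (1 - w) = (1 - l) - z * ((1 - l) * i)" by (simp add: w_def algebra_simps)
      then show ?thesis unfolding ii(1) by (simp add: z_def)
    qed
    moreover have "1 - l > 0" "1 - w > 0" using l_bounds wle by auto
    ultimately have "ln (1 - P) = ln (1 - l) + ln (1 - w)" by (simp add: ln_mult)
    then show ?thesis by (simp add: L3_def w_def power_mult_distrib)
  qed
  have dp: "pot (insert (j,k) H) - pot H = - (d + e) * i * M + M^2 * (l * X * i - (d * e + l * (E1 + E2)) * (g * i) - i * (d * x + e * y) - i^2 * (d^2 + e^2) * (1/2) + L1)"
  proof -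
    have ne: "l \<noteq> 0" "1 - l \<noteq> 0" "real n \<noteq> 0" using l_bounds n_ge by auto
    show ?thesis
      unfolding pot_step[OF card_Fz(2)[OF H] jk(2) j(1,2)] d_def[symmetric] e_def[symmetric] x_def[symmetric] y_def[symmetric] X_def[symmetric] E1_def[symmetric] E2_def[symmetric]
      unfolding mform_step[OF ne] M_def i_def g_def L1_def ..
  qed
  define b3 where "b3 = ln B - (ln (1 - l) - \<rho> * i * M)"
  have bb3: "bd 3 (-3) b3" unfolding b3_def i_def M_def by (rule lnB)
  have K: "K = (1 - 2 * l) * (g * i)" by (simp add: K_def g_def i_def)
  have z: "z = z1 + z2 + z3" by (simp add: z3_def)
  have "pot (insert (j,k) H) - pot H + ln B - ln (1 - P)
    = ((pot (insert (j,k) H) - pot H) - \<rho> * i * M + z * i + z^2 * i^2 * (1/2)) + b3 - L3"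
    unfolding lnP b3_def by simp
  \<comment> \<open>Everything above the error cancels here. In the last product
    \<open>z2 + z3\<close> has order \<open>r powi (-2)\<close> and \<open>z1 + z\<close> has order
    \<open>r powi (-1)\<close>.\<close>
  also have "(pot (insert (j,k) H) - pot H) - \<rho> * i * M + z * i + z^2 * i^2 * (1/2) = M^2 * L1 + z3 * i + (z2 + z3) * (z1 + z) * i^2 * (1/2)"
    unfolding dp by (rule step_algebra[OF ii K z z1_def z2_def])
  finally have eq: "pot (insert (j,k) H) - pot H + ln B - ln (1 - P) = M^2 * L1 + z3 * i + (z2 + z3) * (z1 + z) * i^2 * (1/2) + b3 - L3" .
  have f1: "bd 13 (-3) (M^2 * L1)" by (rule bd_weaken[OF bd_mult[OF bd_power[OF M(1), of 2] bL1]]) auto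
  have f2: "bd 68 (-3) (z3 * i)" by (rule bd_multI[OF bz3 bi(1)]) auto
  have f3: "bd 14 (-2) (z2 + z3)"
  proof -
    have "bd 13 (-2) z3" by (rule bd_absorb[OF bz3]) auto
    then show ?thesis by (rule bd_addI[OF bz2]) auto
  qed
  have h: "bd 0 0 (1/2)" by (rule bd_one) simp
  have f4: "bd 23 (-3) ((z2 + z3) * (z1 + z) * i^2 * (1/2))"
    by (rule bd_weaken[OF bd_mult[OF bd_mult[OF bd_mult[OF f3 bd_addI[OF bz1 bz, of 7 "-1"]] bd_power[OF bi(1), of 2]] h]]) auto
  have f5: "bd 69 (-3) (M^2 * L1 + z3 * i + (z2 + z3) * (z1 + z) * i^2 * (1/2))"
  proof -
    have "bd 68 (-3) (M^2 * L1)" by (rule bd_weaken[OF f1]) auto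
    moreover have "\<bar>M^2 * L1 + z3 * i + (z2 + z3) * (z1 + z) * i^2 * (1/2)\<bar> \<le> \<bar>M^2 * L1\<bar> + \<bar>z3 * i\<bar> + \<bar>(z2 + z3) * (z1 + z) * i^2 * (1/2)\<bar>" by linarith
    moreover have "bd 68 (-3) ((z2 + z3) * (z1 + z) * i^2 * (1/2))" by (rule bd_weaken[OF f4]) auto
    ultimately have "\<bar>M^2 * L1 + z3 * i + (z2 + z3) * (z1 + z) * i^2 * (1/2)\<bar> \<le> 3 * (\<theta> ^ 68 * r powi (-3))"
      using f2 unfolding bd_def by linarith
    also have "\<dots> \<le> \<theta> * (\<theta> ^ 68 * r powi (-3))" using theta_ge r_pos by (intro mult_right_mono) auto
    also have "\<dots> = \<theta> ^ 69 * r powi (-3)" by (simp add: mult.assoc[symmetric] flip: power_Suc)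
    finally show ?thesis by (rule bdI)
  qed
  show ?thesis unfolding P_def[symmetric] eq
  proof -
    have "bd 69 (-3) (M^2 * L1 + z3 * i + (z2 + z3) * (z1 + z) * i^2 * (1/2))" by (rule f5)
    moreover have "bd 23 (-3) (b3 - L3)" by (rule bd_diffI[OF bb3 bL3]) auto
    ultimately have "bd 70 (-3) ((M^2 * L1 + z3 * i + (z2 + z3) * (z1 + z) * i^2 * (1/2)) + (b3 - L3))" by (rule bd_addI) auto
    then show "bd 70 (-3) (M^2 * L1 + z3 * i + (z2 + z3) * (z1 + z) * i^2 * (1/2) + b3 - L3)" by (simp add: algebra_simps)
  qed
qed

section \<open>Revealing all arcs of H\<close>

lemma card_Om_excl:
  assumes "(a,v) \<notin> F" "Q \<subseteq> F" "Omega F Q \<noteq> {}"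
  shows "real (card (Omega (insert (a,v) F) Q)) = real (card (Omega F Q)) * (1 - pr F Q a v)"
proof -
  have "card (Omega F Q) > 0" using assms(3) by (simp add: card_gt_0_iff finite_Om)
  then have "real (card (Omega F Q)) * pr F Q a v = (\<Sum>G\<in>Omega F Q. of_bool ((a,v) \<in> G))" by (simp add: avg_def)
  also have "(\<Sum>G\<in>Omega F Q. of_bool ((a,v) \<in> G) :: real) = real (card {G \<in> Omega F Q. (a,v) \<in> G})"
    by (simp add: of_bool_def sum.If_cases finite_Om Int_def)
  finally have "real (card (Omega F Q)) * pr F Q a v = real (card {G \<in> Omega F Q. (a,v) \<in> G})" .
  moreover have "card (Omega F Q) = card {G \<in> Omega F Q. (a,v) \<in> G} + card {G \<in> Omega F Q. (a,v) \<notin> G}"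
    by (subst card_Un_disjoint[symmetric]) (auto simp: finite_Om intro!: arg_cong[of _ _ card])
  ultimately show ?thesis unfolding Om_excl[OF assms(1,2)] right_diff_distrib by simp
qed

lemma telescoping:
  assumes H: "H \<subseteq> arcs n" and ne: "Omega (diag n) {} \<noteq> {}"
    and row: "\<And>a. a < n \<Longrightarrow> xo H a + 1 \<le> \<theta> * r" "\<And>a. a < n \<Longrightarrow> yi H a + 1 \<le> \<theta> * r"
    and tot: "real n + real (card H) \<le> \<theta> * real n"
  shows "Omega (diag n \<union> H) {} \<noteq> {} \<and>
    \<bar>ln (real (card (Omega (diag n \<union> H) {})) / real (card (Omega (diag n) {}))) - real (card H) * ln B - pot H\<bar> \<le> real (card H) * (\<theta> ^ 70 * r powi (-3))"
proof -
  have "finite H" using card_Fz(2)[OF H] .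
  then have "H \<subseteq> arcs n \<and> (\<forall>a<n. xo H a + 1 \<le> \<theta> * r) \<and> (\<forall>a<n. yi H a + 1 \<le> \<theta> * r) \<and> real n + real (card H) \<le> \<theta> * real n \<Longrightarrow> ?thesis"
  proof (induction H rule: finite_induct)
    case empty
    have "pot {} = 0" by (simp add: potential_def mform_def psum_def rw_def cl_def)
    moreover have "card (Omega (diag n) {}) > 0" using ne by (simp add: card_gt_0_iff finite_Om)
    ultimately show ?case using ne by simp
  next
    case (insert p H)
    obtain j k where p: "p = (j,k)" by (cases p)
    have H: "H \<subseteq> arcs n" "(j,k) \<in> arcs n" "(j,k) \<notin> H" using insert p by auto
    have ins: "xo (insert p H) a \<ge> xo H a" "yi (insert p H) a \<ge> yi H a" for a
      using rw_insert[OF H(3) insert.hyps(1), of a] cl_insert[OF H(3) insert.hyps(1), of a] by (auto simp: p)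
    have row: "xo H a + 1 \<le> \<theta> * r" "yi H a + 1 \<le> \<theta> * r" if "a < n" for a
    proof -
      have "xo (insert p H) a + 1 \<le> \<theta> * r" "yi (insert p H) a + 1 \<le> \<theta> * r" using insert.prems that by auto
      then show "xo H a + 1 \<le> \<theta> * r" "yi H a + 1 \<le> \<theta> * r" using ins[of a] by linarith+
    qed
    have cd: "real (card (insert p H)) = real (card H) + 1" using insert.hyps by simp
    have tot: "real n + real (card H) \<le> \<theta> * real n" using insert.prems unfolding cd by linarith
    have IH: "Omega (diag n \<union> H) {} \<noteq> {}"
      "\<bar>ln (real (card (Omega (diag n \<union> H) {})) / real (card (Omega (diag n) {}))) - real (card H) * ln B - pot H\<bar> \<le> real (card H) * (\<theta> ^ 70 * r powi (-3))"
      using insert.IH H row tot by blast+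
    have c: "cls 0 (Fz H) {}"
    proof -
      have "Fz H \<subseteq> {..<n} \<times> {..<n}" using H(1) by (auto simp: Fz_def diag_def arcs_def)
      moreover have "phi (Fz H) a \<le> \<theta> * r" "psi (Fz H) a \<le> \<theta> * r" if "a < n" for a
        using rw_Fz[OF H(1) that] row[OF that] by simp_all
      moreover have "real (card (Fz H)) \<le> \<theta> * real n" using card_Fz[OF H(1)] tot by simp
      ultimately show ?thesis using IH(1) by (simp add: cls_def Fz_def)
    qed
    have j: "j < n" "k < n" "(j,k) \<notin> Fz H" using H by (auto simp: arcs_def Fz_def diag_def)
    have eqF: "diag n \<union> insert p H = insert (j,k) (Fz H)" by (auto simp: Fz_def p)
    have ne': "Omega (diag n \<union> insert p H) {} \<noteq> {}"
      unfolding eqF by (rule clsD(4)[OF cls_insert(2)[OF c _ j]]) simp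
    note pp = pr_pos[OF c _ j]
    let ?A = "real (card (Omega (diag n \<union> H) {}))" and ?A' = "real (card (Omega (diag n \<union> insert p H) {}))" and ?Z = "real (card (Omega (diag n) {}))"
    have pos: "?A > 0" "?A' > 0" "?Z > 0" using IH(1) ne ne' by (simp_all add: card_gt_0_iff finite_Om)
    have A': "?A' = ?A * (1 - pr (Fz H) {} j k)"
      unfolding eqF using card_Om_excl[OF j(3) _ clsD(4)[OF c]] by (simp add: Fz_def)
    have "?A' / ?Z = (?A / ?Z) * (1 - pr (Fz H) {} j k)" by (simp only: A' times_divide_eq_left)
    moreover have "ln ((?A / ?Z) * (1 - pr (Fz H) {} j k)) = ln (?A / ?Z) + ln (1 - pr (Fz H) {} j k)"
      using pos pp by (intro ln_mult_pos divide_pos_pos) auto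
    ultimately have "ln (?A' / ?Z) = ln (?A / ?Z) + ln (1 - pr (Fz H) {} j k)" by (simp only:)
    moreover have "\<bar>pot (insert (j,k) H) - pot H + ln B - ln (1 - pr (Fz H) {} j k)\<bar> \<le> \<theta> ^ 70 * r powi (-3)"
      using bdD[OF step_bound[OF H(1) c H(2,3)]] .
    moreover have "real (card (insert p H)) * ln B = real (card H) * ln B + ln B" unfolding cd by (simp add: algebra_simps)
    moreover have "real (card (insert p H)) * (\<theta> ^ 70 * r powi (-3)) = real (card H) * (\<theta> ^ 70 * r powi (-3)) + \<theta> ^ 70 * r powi (-3)"
      unfolding cd by (simp add: algebra_simps)
    ultimately have "\<bar>ln (?A' / ?Z) - real (card (insert p H)) * ln B - pot (insert p H)\<bar> \<le> real (card (insert p H)) * (\<theta> ^ 70 * r powi (-3))"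
      using IH(2) unfolding p by linarith
    then show ?case using ne' by blast
  qed
  then show ?thesis using assms by blast
qed

end

subsection \<open>Existence of digraphs with given degrees\<close>

lemma exists_le_avg:
  assumes "finite S" "S \<noteq> {}" shows "\<exists>x\<in>S. f x \<le> avg S f"
proof (rule ccontr)
  assume "\<not> ?thesis"
  then have "(\<Sum>x\<in>S. avg S f) < (\<Sum>x\<in>S. f x)" using assms by (intro sum_strict_mono) auto
  moreover have "card S > 0" using assms by (simp add: card_gt_0_iff)
  ultimately show False by (simp add: avg_def)
qed

lemma (in near_regular) cls_diag:
  assumes "Omega (diag n) {} \<noteq> {}"
  shows "cls 0 (diag n) {}"
proof -
  have "rw (diag n) a = {a}" "cl (diag n) a = {a}" if "a < n" for a using that by (auto simp: diag_def)
  moreover have "diag n = (\<lambda>i. (i,i)) ` {..<n}" by (auto simp: diag_def)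
  then have "card (diag n) = n" by (simp add: card_image inj_on_def)
  moreover have "diag n \<subseteq> {..<n} \<times> {..<n}" by (auto simp: diag_def)
  moreover have "real n \<le> \<theta> * real n" using theta_pos by (simp add: mult_le_cancel_right1)
  ultimately show ?thesis using assms theta_r by (simp add: cls_def)
qed

text \<open>Some matrix has a codegree no further from \<open>l^2 * n\<close> than the fourth moment
  allows, and \<open>l^2 * n\<close> lies below the degree of \<open>a\<close> by about
  \<open>q * n\<close>. So row \<open>a\<close> has free entries that row \<open>b\<close>
  lacks.\<close>

lemma (in near_regular) exists_only:
  assumes "Omega (diag n) {} \<noteq> {}" "a < n" "b < n" "a \<noteq> b"
  shows "\<exists>G\<in>Omega (diag n) {}. \<exists>v. v \<in> only n (diag n) a b G"
proof -
  let ?F = "diag n"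
  note c = cls_diag[OF assms(1)]
  obtain G where G: "G \<in> Omega ?F {}" and le: "(cod G a b - l\<^sup>2 * real n) ^ 4 \<le> avg (Omega ?F {}) (\<lambda>G. (cod G a b - l\<^sup>2 * real n) ^ 4)"
    by (rule bexE[OF exists_le_avg[OF finite_Om assms(1), where f = "\<lambda>G. (cod G a b - l\<^sup>2 * real n) ^ 4"]])
  have "\<bar>cod G a b - l\<^sup>2 * real n\<bar> ^ 4 \<le> (\<theta> ^ 2 * r) ^ 4"
  proof -
    have "(cod G a b - l\<^sup>2 * real n) ^ 4 \<le> \<theta> ^ 8 * r ^ 4"
      using le cod_moment[OF c _ assms(2,3)] assms(4) by force
    then show ?thesis by (simp add: power_mult_distrib flip: power_mult)
  qed
  then have "\<bar>cod G a b - l\<^sup>2 * real n\<bar> \<le> \<theta> ^ 2 * r"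
    using theta_pos r_pos by (subst (asm) power_mono_iff) auto
  then have cod: "cod G a b \<le> l\<^sup>2 * real n + \<theta> ^ 2 * r" by linarith
  have Gs: "G \<subseteq> {..<n} \<times> {..<n}" using G by (auto simp: Om_def)
  have fr: "frozen2 ?F a b = {a, b}" using assms by (auto simp: diag_def)
  have "card (rw G a \<inter> frozen2 ?F a b) \<le> card {a,b}" unfolding fr by (intro card_mono) auto
  also have "\<dots> \<le> 2" by (simp add: card_insert_if)
  finally have 1: "real (card (rw G a \<inter> frozen2 ?F a b)) \<le> 2" by simp
  have 2: "real (card (rw G a \<inter> rw G b \<inter> free2 n ?F a b)) \<le> cod G a b"
    using finite_rw[OF Gs] by (auto intro!: card_mono)
  have "real (card (only n ?F a b G)) \<ge> (l * real n - \<theta> * r) - 2 - (l\<^sup>2 * real n + \<theta> ^ 2 * r)"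
    using card_only[OF G assms(2), of ?F b] 1 2 cod s_dev[OF assms(2)] by linarith
  moreover have "(l * real n - \<theta> * r) - 2 - (l\<^sup>2 * real n + \<theta> ^ 2 * r) > 0"
  proof -
    have "l * real n - l\<^sup>2 * real n = q * real n" by (simp add: power2_eq_square algebra_simps)
    moreover have "q * real n \<ge> real n / \<theta> / 2" using D0_ge by simp
    moreover have "4 * \<theta> ^ 2 * r < real n / \<theta> / 2"
    proof -
      have "8 * \<theta> ^ 3 < \<theta> * \<theta> ^ 3" using theta_ge by (intro mult_strict_right_mono) auto
      also have "\<dots> \<le> \<theta> ^ 100" using power_increasing[of 4 100 \<theta>] theta_pos by (simp flip: power_Suc)
      finally have "8 * \<theta> ^ 3 < r" using r_ge by linarith
      then have "8 * \<theta> ^ 3 * r < r * r" using r_pos by simp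
      then show ?thesis using theta_pos by (simp add: rn field_simps power2_eq_square power3_eq_cube)
    qed
    moreover have "\<theta> * r \<le> \<theta> ^ 2 * r" using theta_pos r_pos by (simp add: power2_eq_square mult_le_cancel_right1)
    moreover have "2 \<le> \<theta> * r" using theta_r by linarith
    ultimately show ?thesis by linarith
  qed
  ultimately have "card (only n ?F a b G) > 0" by linarith
  then have "only n ?F a b G \<noteq> {}" by auto
  then show ?thesis using G by blast
qed

lemma move_arc:
  assumes G: "G \<in> Om n s t F {}" and v: "v \<in> only n F a b G" and ab: "a < n" "b < n" "a \<noteq> b"
  shows "insert (b,v) (G - {(a,v)}) \<in> Om n (s(a := s a - 1, b := s b + 1)) t F {}"
proof -
  let ?G = "insert (b,v) (G - {(a,v)})"
  have h: "v < n" "(a,v) \<in> G" "(b,v) \<notin> G" "(b,v) \<notin> F" using v by (auto simp: only_def free2_def)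
  have sub: "G \<subseteq> {..<n} \<times> {..<n}" using G by (simp add: Om_def)
  have r: "rw ?G a = rw G a - {v}" "rw ?G b = insert v (rw G b)" "c \<noteq> a \<Longrightarrow> c \<noteq> b \<Longrightarrow> rw ?G c = rw G c" for c
    using ab by auto
  have c: "cl ?G v = insert b (cl G v - {a})" "c \<noteq> v \<Longrightarrow> cl ?G c = cl G c" for c by (auto simp: ab)
  have "card (rw ?G c) = (s(a := s a - 1, b := s b + 1)) c" if "c < n" for c
  proof -
    have "card (rw G c) = s c" "card (rw G a) = s a" "card (rw G b) = s b" using G that ab by (auto simp: Om_def)
    then show ?thesis using r h finite_rw[OF sub] ab by (cases "c = a"; cases "c = b") auto
  qed
  moreover have "card (cl ?G c) = t c" if "c < n" for c
  proof (cases "c = v")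
    case True
    have "card (cl G v) = t v" using G h by (auto simp: Om_def)
    moreover have "card (insert b (cl G v - {a})) = card (cl G v)"
      using h finite_cl[OF sub, of v] card_Suc_Diff1[of "cl G v" a] by (simp add: card.insert_remove)
    ultimately show ?thesis using True c by simp
  next
    case False then show ?thesis using c G that by (auto simp: Om_def)
  qed
  moreover have "?G \<subseteq> {..<n} \<times> {..<n}" using sub ab h by auto
  moreover have "?G \<inter> F = {}" using G h by (auto simp: Om_def)
  ultimately show ?thesis by (simp add: Om_def)
qed

lemma Om_cong:
  assumes "\<And>a. a < n \<Longrightarrow> s a = s' a" shows "Om n s t F Q = Om n s' t F Q"
  using assms by (simp add: Om_def)

lemma Om_converse: "G \<in> Om n s t (diag n) {} \<Longrightarrow> G\<inverse> \<in> Om n t s (diag n) {}"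
proof -
  assume G: "G \<in> Om n s t (diag n) {}"
  have "rw (G\<inverse>) a = cl G a" "cl (G\<inverse>) a = rw G a" for a by auto
  moreover have "G\<inverse> \<inter> diag n = {}" using G by (auto simp: Om_def diag_def)
  ultimately show ?thesis using G by (auto simp: Om_def)
qed

text \<open>Induction on the distance between the degree sequences. One unit is moved so as to come
  closer to \<open>s0\<close>; the resulting sequence is realised by induction, and
  \<open>exists_only\<close> applied to it finds an arc whose move restores
  \<open>s\<close>.\<close>

lemma row_path:
  assumes "scale \<theta> r" "real n = r ^ 2" "1 / \<theta> \<le> l" "l \<le> 1 - 1 / \<theta>"
    and t: "\<And>a. a < n \<Longrightarrow> \<bar>real (t a) - l * real n\<bar> \<le> \<theta> * r"
    and tot: "\<bar>(\<Sum>a<n. real (t a)) - l * real n ^ 2\<bar> \<le> \<theta> * real n"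
    and s0: "\<And>a. a < n \<Longrightarrow> \<bar>real (s0 a) - l * real n\<bar> \<le> \<theta> * r" "(\<Sum>a<n. s0 a) = (\<Sum>a<n. t a)" "Om n s0 t (diag n) {} \<noteq> {}"
    and s: "\<And>a. a < n \<Longrightarrow> \<bar>real (s a) - l * real n\<bar> \<le> \<theta> * r" "(\<Sum>a<n. s a) = (\<Sum>a<n. t a)"
  shows "Om n s t (diag n) {} \<noteq> {}"
  using s
proof (induction "\<Sum>a<n. nat \<bar>int (s a) - int (s0 a)\<bar>" arbitrary: s rule: less_induct)
  case less
  show ?case
  proof (cases "\<forall>a<n. s a = s0 a")
    case True
    then show ?thesis using s0(3) Om_cong[of n s s0] by auto
  next
    case False
    have sums: "(\<Sum>a<n. s a) = (\<Sum>a<n. s0 a)" using less.prems s0 by simp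
    have "\<exists>a<n. s a < s0 a"
    proof (rule ccontr)
      assume c: "\<not> ?thesis"
      then have c': "s0 a \<le> s a" if "a < n" for a using that by (meson not_le)
      obtain b where "b < n" "s b > s0 b" using False c by (metis linorder_neqE_nat)
      then have "(\<Sum>a<n. s0 a) < (\<Sum>a<n. s a)" using c' by (intro sum_strict_mono_ex1) auto
      then show False using sums by simp
    qed
    then obtain a where a: "a < n" "s a < s0 a" by blast
    have "\<exists>b<n. s b > s0 b"
    proof (rule ccontr)
      assume "\<not> ?thesis"
      then have "s c \<le> s0 c" if "c < n" for c using that by (meson not_le)
      then have "(\<Sum>a<n. s a) < (\<Sum>a<n. s0 a)" using a by (intro sum_strict_mono_ex1) auto
      then show False using sums by simp
    qed
    then obtain b where b: "b < n" "s b > s0 b" by blast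
    have ab: "a \<noteq> b" using a b by auto
    define s' where "s' = s(a := s a + 1, b := s b - 1)"
    have s'v: "s' a = s a + 1" "s' b = s b - 1" "c \<noteq> a \<Longrightarrow> c \<noteq> b \<Longrightarrow> s' c = s c" for c using ab by (auto simp: s'_def)
    have split: "(\<Sum>c<n. f c) = f a + f b + (\<Sum>c\<in>{..<n}-{a,b}. f c)" for f :: "nat \<Rightarrow> nat"
    proof -
      have "(\<Sum>c<n. f c) = f a + (\<Sum>c\<in>{..<n}-{a}. f c)" using a by (simp add: sum.remove)
      also have "(\<Sum>c\<in>{..<n}-{a}. f c) = f b + (\<Sum>c\<in>{..<n}-{a}-{b}. f c)" using b ab by (intro sum.remove) auto
      also have "{..<n}-{a}-{b} = {..<n}-{a,b}" by auto
      finally show ?thesis by simp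
    qed
    have rest: "(\<Sum>c\<in>{..<n}-{a,b}. f (s' c) c) = (\<Sum>c\<in>{..<n}-{a,b}. f (s c) c)" for f :: "nat \<Rightarrow> nat \<Rightarrow> nat"
      by (intro sum.cong) (auto simp: s'v)
    have sum': "(\<Sum>c<n. s' c) = (\<Sum>c<n. t c)"
      using split[of s'] split[of s] rest[of "\<lambda>x c. x"] less.prems(2) b by (simp add: s'v)
    have dec: "(\<Sum>c<n. nat \<bar>int (s' c) - int (s0 c)\<bar>) < (\<Sum>c<n. nat \<bar>int (s c) - int (s0 c)\<bar>)"
      using split[of "\<lambda>c. nat \<bar>int (s' c) - int (s0 c)\<bar>"] split[of "\<lambda>c. nat \<bar>int (s c) - int (s0 c)\<bar>"]
        rest[of "\<lambda>x c. nat \<bar>int x - int (s0 c)\<bar>"] a b by (simp add: s'v)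
    \<comment> \<open>A changed value stays between its old value and that of \<open>s0\<close>, so
      the path never leaves the window around \<open>l * n\<close>.\<close>
    have dev': "\<bar>real (s' c) - l * real n\<bar> \<le> \<theta> * r" if "c < n" for c
    proof -
      consider "c = a" | "c = b" | "c \<noteq> a" "c \<noteq> b" by blast
      then show ?thesis
      proof cases
        case 1
        have "real (s' c) \<ge> real (s a)" "real (s' c) \<le> real (s0 a)" using a 1 by (auto simp: s'v)
        then show ?thesis using less.prems(1)[OF a(1)] s0(1)[OF a(1)] by linarith
      next
        case 2
        have "real (s' c) \<le> real (s b)" "real (s' c) \<ge> real (s0 b)" using b 2 by (auto simp: s'v)
        then show ?thesis using less.prems(1)[OF b(1)] s0(1)[OF b(1)] by linarith
      next
        case 3 then show ?thesis using less.prems(1)[OF that] by (simp add: s'v)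
      qed
    qed
    have ne: "Om n s' t (diag n) {} \<noteq> {}" using less.hyps[OF dec dev' sum'] .
    have tot': "\<bar>(\<Sum>a<n. real (s' a)) - l * real n ^ 2\<bar> \<le> \<theta> * real n"
      using tot sum' by (simp flip: of_nat_sum)
    have nr: "near_regular \<theta> r n s' t l"
      using assms(1-4) t dev' tot' sum' by (auto simp: near_regular_def near_regular_axioms_def)
    obtain G v where G: "G \<in> Om n s' t (diag n) {}" "v \<in> only n (diag n) a b G"
      using near_regular.exists_only[OF nr ne a(1) b(1) ab] by blast
    have "insert (b,v) (G - {(a,v)}) \<in> Om n (s'(a := s' a - 1, b := s' b + 1)) t (diag n) {}"
      by (rule move_arc[OF G a(1) b(1) ab])
    moreover have "s'(a := s' a - 1, b := s' b + 1) = s" using a b ab by (auto simp: s'_def)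
    ultimately show ?thesis by auto
  qed
qed

text \<open>If two rows differed by at least 2, moving an arc from the larger to the smaller within
  its column would lower the sum of squares and leave the column sums unchanged.\<close>

lemma balanced_rows:
  assumes G: "G \<subseteq> arcs n"
    and min: "\<And>G'. G' \<subseteq> arcs n \<Longrightarrow> card G' = card G \<Longrightarrow>
      (\<Sum>a<n. card (rw G a) ^ 2) + (\<Sum>a<n. card (cl G a) ^ 2) \<le> (\<Sum>a<n. card (rw G' a) ^ 2) + (\<Sum>a<n. card (cl G' a) ^ 2)"
    and ab: "a < n" "b < n"
  shows "card (rw G a) \<le> card (rw G b) + 1"
proof (rule ccontr)
  assume gt: "\<not> ?thesis"
  then have ab': "a \<noteq> b" by auto
  have sub: "G \<subseteq> {..<n} \<times> {..<n}" using G by (auto simp: arcs_def)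
  have fin: "finite (rw G c)" "finite (cl G c)" "finite G" for c
    using finite_rw[OF sub] finite_cl[OF sub] finite_subset[OF sub] by auto
  \<comment> \<open>The head \<open>b\<close> is excluded because the moved arc must not become a
    loop; a gap of two leaves an arc to move even so.\<close>
  have "card (insert b (rw G b)) \<le> card (rw G b) + 1" using fin by (simp add: card_insert_if)
  then have "card (insert b (rw G b)) < card (rw G a)" using gt by linarith
  then have "\<not> rw G a \<subseteq> insert b (rw G b)" using card_mono[of "insert b (rw G b)" "rw G a"] fin by auto
  then obtain v where "v \<in> rw G a" "v \<notin> insert b (rw G b)" by blast
  then have v: "(a,v) \<in> G" "(b,v) \<notin> G" "v \<noteq> b" by auto
  define G' where "G' = insert (b,v) (G - {(a,v)})"
  have vn: "v < n" using v sub by auto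
  have G's: "G' \<subseteq> arcs n" using G ab v vn by (auto simp: G'_def arcs_def)
  have cG: "card G' = card G" using v fin ab' card_Suc_Diff1[of G "(a,v)"] by (simp add: G'_def card.insert_remove)
  have r: "rw G' a = rw G a - {v}" "rw G' b = insert v (rw G b)" "c \<noteq> a \<Longrightarrow> c \<noteq> b \<Longrightarrow> rw G' c = rw G c" for c
    using ab' by (auto simp: G'_def)
  have c: "card (cl G' c) = card (cl G c)" for c
  proof (cases "c = v")
    case True
    have "cl G' c = insert b (cl G c - {a})" using ab' True by (auto simp: G'_def)
    moreover have "card (insert b (cl G v - {a})) = card (cl G v)"
      using v fin(2)[of v] card_Suc_Diff1[of "cl G v" a] by (simp add: card.insert_remove)
    ultimately show ?thesis using True by simp
  next
    case False
    then have "cl G' c = cl G c" by (auto simp: G'_def)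
    then show ?thesis by simp
  qed
  have split: "(\<Sum>c<n. f c) = f a + f b + (\<Sum>c\<in>{..<n}-{a,b}. f c)" for f :: "nat \<Rightarrow> nat"
  proof -
    have "(\<Sum>c<n. f c) = f a + (\<Sum>c\<in>{..<n}-{a}. f c)" using ab by (simp add: sum.remove)
    also have "(\<Sum>c\<in>{..<n}-{a}. f c) = f b + (\<Sum>c\<in>{..<n}-{a}-{b}. f c)" using ab ab' by (intro sum.remove) auto
    also have "{..<n}-{a}-{b} = {..<n}-{a,b}" by auto
    finally show ?thesis by simp
  qed
  have rest: "(\<Sum>c\<in>{..<n}-{a,b}. card (rw G' c) ^ 2) = (\<Sum>c\<in>{..<n}-{a,b}. card (rw G c) ^ 2)"
    by (intro sum.cong) (auto simp: r)
  obtain m where m: "card (rw G a) = card (rw G b) + 2 + m" using gt by (metis add.assoc le_Suc_ex not_less_eq_eq one_add_one plus_1_eq_Suc add.commute)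
  have "card (rw G' a) = card (rw G b) + 1 + m" "card (rw G' b) = card (rw G b) + 1"
    using r v fin m by auto
  then have "card (rw G' a) ^ 2 + card (rw G' b) ^ 2 < card (rw G a) ^ 2 + card (rw G b) ^ 2"
    unfolding m by (simp add: power2_eq_square algebra_simps)
  then have "(\<Sum>c<n. card (rw G' c) ^ 2) < (\<Sum>c<n. card (rw G c) ^ 2)"
    using split[of "\<lambda>c. card (rw G' c) ^ 2"] split[of "\<lambda>c. card (rw G c) ^ 2"] rest by simp
  then show False using min[OF G's cG] c by simp
qed

lemma balanced_digraph:
  assumes "D \<le> card (arcs n)"
  shows "\<exists>G. G \<subseteq> arcs n \<and> card G = D \<and> (\<forall>a<n. \<forall>b<n. card (rw G a) \<le> card (rw G b) + 1 \<and> card (cl G a) \<le> card (cl G b) + 1)"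
proof -
  have finA: "finite (arcs n)" by (rule finite_subset[of _ "{..<n} \<times> {..<n}"]) (auto simp: arcs_def)
  define f where "f G = (\<Sum>a<n. card (rw G a) ^ 2) + (\<Sum>a<n. card (cl G a) ^ 2)" for G
  define C where "C G \<longleftrightarrow> G \<subseteq> arcs n \<and> card G = D" for G
  obtain G0 where "G0 \<subseteq> arcs n" "card G0 = D" using assms obtain_subset_with_card_n by metis
  then have "C G0" by (simp add: C_def)
  then have "\<exists>G. C G \<and> (\<forall>G'. C G' \<longrightarrow> f G \<le> f G')" by (rule ex_has_least_nat)
  then obtain G where CG: "C G" and least: "\<forall>G'. C G' \<longrightarrow> f G \<le> f G'" by (elim exE conjE)
  have G: "G \<subseteq> arcs n" "card G = D" using CG by (auto simp: C_def)
  have min: "f G \<le> f G'" if "G' \<subseteq> arcs n" "card G' = D" for G' using least that by (simp add: C_def)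
  have 1: "card (rw G a) \<le> card (rw G b) + 1" if "a < n" "b < n" for a b
    using balanced_rows[OF G(1) _ that] min G(2) by (simp add: f_def)
  have 2: "card (cl G a) \<le> card (cl G b) + 1" if "a < n" "b < n" for a b
  proof -
    have conv: "rw (K\<inverse>) c = cl K c" "cl (K\<inverse>) c = rw K c" for K c by auto
    have "G\<inverse> \<subseteq> arcs n" using G(1) by (auto simp: arcs_def)
    then have "card (rw (G\<inverse>) a) \<le> card (rw (G\<inverse>) b) + 1"
    proof (rule balanced_rows[OF _ _ that])
      fix G' assume G': "G' \<subseteq> arcs n" "card G' = card (G\<inverse>)"
      have "G'\<inverse> \<subseteq> arcs n" "card (G'\<inverse>) = D" using G' G(2) by (auto simp: arcs_def)
      then have "f G \<le> f (G'\<inverse>)" by (rule min)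
      then show "(\<Sum>a<n. card (rw (G\<inverse>) a) ^ 2) + (\<Sum>a<n. card (cl (G\<inverse>) a) ^ 2) \<le> (\<Sum>a<n. card (rw G' a) ^ 2) + (\<Sum>a<n. card (cl G' a) ^ 2)"
        unfolding f_def conv by simp
    qed
    then show ?thesis by (simp add: conv)
  qed
  show ?thesis using G 1 2 by blast
qed

text \<open>A balanced digraph with the right number of arcs lies in the window around
  \<open>l * n\<close>. Its row sums are led to \<open>s\<close> with the columns fixed, then, after
  transposition, its column sums to \<open>t\<close>.\<close>

lemma (in near_regular) Omega_nonempty: "Omega (diag n) {} \<noteq> {}"
proof -
  define D where "D = (\<Sum>a<n. s a)"
  have npos: "real n > 0" using n_ge by linarith
  have Dr: "real D = (\<Sum>a<n. real (s a))" by (simp add: D_def)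
  have cA: "real (card (arcs n)) = real n * real n - real n"
  proof -
    have "arcs n = {..<n} \<times> {..<n} - diag n" by (auto simp: arcs_def diag_def)
    moreover have "diag n = (\<lambda>i. (i,i)) ` {..<n}" by (auto simp: diag_def)
    then have "card (diag n) = n" "finite (diag n)" by (auto simp: card_image inj_on_def)
    moreover have "diag n \<subseteq> {..<n} \<times> {..<n}" by (auto simp: diag_def)
    ultimately have "card (arcs n) = n * n - n" by (simp add: card_Diff_subset)
    then show ?thesis by (simp add: of_nat_diff)
  qed
  have tn: "2 * \<theta> ^ 2 \<le> real n"
  proof -
    have "2 * \<theta> ^ 2 \<le> \<theta> * \<theta> ^ 2" using theta_ge by (intro mult_right_mono) auto
    also have "\<dots> \<le> \<theta> ^ 100" using power_increasing[of 3 100 \<theta>] theta_pos by (simp flip: power_Suc)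
    also have "\<dots> \<le> r" by (rule r_ge)
    finally show ?thesis using n_ge r_pos by linarith
  qed
  have "real D \<le> real (card (arcs n))"
  proof -
    have "real D \<le> l * real n ^ 2 + \<theta> * real n" using total Dr by linarith
    also have "\<dots> \<le> (1 - 1 / \<theta>) * real n ^ 2 + \<theta> * real n" using l_le by (intro add_right_mono mult_right_mono) auto
    also have "\<dots> \<le> real n * real n - real n"
    proof -
      have "(\<theta> + 1) * \<theta> \<le> 2 * \<theta> ^ 2" using theta_pos by (simp add: power2_eq_square algebra_simps)
      then have "(\<theta> + 1) * \<theta> \<le> real n" using tn by linarith
      then have "\<theta> + 1 \<le> real n / \<theta>" using theta_pos by (simp add: field_simps)
      then have "(\<theta> + 1) * real n \<le> real n / \<theta> * real n" by (intro mult_right_mono) auto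
      then show ?thesis by (simp add: power2_eq_square algebra_simps)
    qed
    finally show ?thesis unfolding cA .
  qed
  then have "D \<le> card (arcs n)" by simp
  from balanced_digraph[OF this] obtain G0 where G0: "G0 \<subseteq> arcs n" "card G0 = D"
    "\<And>a b. a < n \<Longrightarrow> b < n \<Longrightarrow> card (rw G0 a) \<le> card (rw G0 b) + 1 \<and> card (cl G0 a) \<le> card (cl G0 b) + 1" by blast
  have sub: "G0 \<subseteq> {..<n} \<times> {..<n}" using G0 by (auto simp: arcs_def)
  define s0 t0 where "s0 a = card (rw G0 a)" and "t0 a = card (cl G0 a)" for a
  \<comment> \<open>Values that differ by at most 1 lie within 1 of their mean, and by
    \<open>total\<close> the mean lies within \<open>\<theta>\<close> of
    \<open>l * n\<close>.\<close>
  have dev: "\<bar>real (f a) - l * real n\<bar> \<le> \<theta> * r"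
    if f: "\<And>a b. a < n \<Longrightarrow> b < n \<Longrightarrow> f a \<le> f b + 1" and fs: "(\<Sum>a<n. f a) = D" and a: "a < n" for f :: "nat \<Rightarrow> nat" and a
  proof -
    have "real n * real (f a) \<le> real D + real n"
    proof -
      have "(\<Sum>b<n. f a) \<le> (\<Sum>b<n. f b + 1)" using f a by (intro sum_mono) auto
      moreover have "(\<Sum>b<n. f b + 1) = D + n" unfolding sum.distrib using fs by simp
      ultimately have "n * f a \<le> D + n" by simp
      then show ?thesis by (metis of_nat_add of_nat_le_iff of_nat_mult)
    qed
    moreover have "real D \<le> real n * real (f a) + real n"
    proof -
      have "(\<Sum>b<n. f b) \<le> (\<Sum>b<n. f a + 1)" using f a by (intro sum_mono) auto
      then have "D \<le> n * f a + n" using fs by simp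
      then show ?thesis by (metis of_nat_add of_nat_le_iff of_nat_mult)
    qed
    ultimately have "\<bar>real n * real (f a) - l * real n ^ 2\<bar> \<le> (\<theta> + 1) * real n"
      using total Dr by (simp add: distrib_right)
    moreover have "real n * real (f a) - l * real n ^ 2 = real n * (real (f a) - l * real n)" by (simp add: power2_eq_square algebra_simps)
    ultimately have "real n * \<bar>real (f a) - l * real n\<bar> \<le> real n * (\<theta> + 1)" by (simp add: abs_mult mult.commute)
    then have "\<bar>real (f a) - l * real n\<bar> \<le> \<theta> + 1" using npos by simp
    also have "\<theta> + 1 \<le> \<theta> * r"
    proof -
      have "\<theta> * 2 \<le> \<theta> * r" using theta_r theta_pos by (intro mult_left_mono) auto
      then show ?thesis using theta_ge by linarith
    qed
    finally show ?thesis .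
  qed
  have sums: "(\<Sum>a<n. s0 a) = D" "(\<Sum>a<n. t0 a) = D" "(\<Sum>a<n. t a) = D"
    using sum_card_rw[OF sub] sum_card_cl[OF sub] G0(2) sum_eq by (simp_all add: s0_def t0_def D_def)
  have s0: "\<bar>real (s0 a) - l * real n\<bar> \<le> \<theta> * r" and t0: "\<bar>real (t0 a) - l * real n\<bar> \<le> \<theta> * r" if "a < n" for a
    using dev[of s0, OF _ sums(1) that] dev[of t0, OF _ sums(2) that] G0(3) by (auto simp: s0_def t0_def)
  have sc: "scale \<theta> r" by unfold_locales
  have base: "Om n s0 t0 (diag n) {} \<noteq> {}"
  proof -
    have "G0 \<inter> diag n = {}" using G0 by (auto simp: arcs_def diag_def)
    then have "G0 \<in> Om n s0 t0 (diag n) {}" using sub by (simp add: Om_def s0_def t0_def)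
    then show ?thesis by blast
  qed
  have rt: "\<bar>(\<Sum>a<n. real (f a)) - l * real n ^ 2\<bar> \<le> \<theta> * real n" if "(\<Sum>a<n. f a) = D" for f :: "nat \<Rightarrow> nat"
    using total Dr that by (simp flip: of_nat_sum)
  have D: "(\<Sum>a<n. s a) = D" by (simp add: D_def)
  have 1: "Om n s t0 (diag n) {} \<noteq> {}"
    by (rule row_path[OF sc rn l_ge l_le t0 rt[OF sums(2)] s0 _ base s_dev]) (use sums D in auto)
  then have "Om n t0 s (diag n) {} \<noteq> {}" using Om_converse by blast
  then have "Om n t s (diag n) {} \<noteq> {}"
    by (intro row_path[OF sc rn l_ge l_le s_dev rt[OF D] t0 _ _ t_dev]) (use sums D in auto)
  then show ?thesis using Om_converse by blast
qed

subsection \<open>The theorem\<close>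

lemma digraphs_deg_eq: "digraphs_deg n s t = Om n s t (diag n) {}"
proof -
  have "G \<subseteq> arcs n \<longleftrightarrow> G \<subseteq> {..<n} \<times> {..<n} \<and> G \<inter> diag n = {}" for G
    by (auto simp: arcs_def diag_def)
  then show ?thesis
    by (auto simp: digraphs_deg_def Om_def outdeg_def indeg_def rw_def cl_def)
qed

lemma avoiding_eq: "{G \<in> digraphs_deg n s t. G \<inter> H = {}} = Om n s t (diag n \<union> H) {}"
  unfolding digraphs_deg_eq by (auto simp: Om_def)

lemma outdeg_rw: "outdeg G j = card (rw G j)" and indeg_cl: "indeg G j = card (cl G j)"
  by (simp_all add: outdeg_def indeg_def rw_def cl_def)

lemma Xarcs_card:
  assumes "H \<subseteq> arcs n" shows "Xarcs n H = real (card H)"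
proof -
  have "H \<subseteq> {..<n} \<times> {..<n}" using assms by (auto simp: arcs_def)
  then show ?thesis unfolding Xarcs_def outdeg_rw using sum_card_rw[of H n] by (simp flip: of_nat_sum)
qed

lemma ln_one_minus_bound:
  fixes w :: real
  assumes "0 \<le> w" "w \<le> 1/2" shows "\<bar>ln (1 - w) + w\<bar> \<le> 2 * w\<^sup>2"
proof -
  have "\<bar>ln (1 - w) + w + w\<^sup>2 / 2\<bar> \<le> 2 * \<bar>w\<bar> ^ 3" using assms by (intro ln_cubic_bound) auto
  moreover have "2 * \<bar>w\<bar> ^ 3 \<le> w\<^sup>2"
  proof -
    have "2 * w * w\<^sup>2 \<le> 1 * w\<^sup>2" using assms by (intro mult_right_mono) auto
    then show ?thesis using assms by (simp add: power3_eq_cube power2_eq_square)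
  qed
  moreover have "w\<^sup>2 \<ge> 0" by simp
  ultimately show ?thesis by linarith
qed

lemma (in telescope) prob_estimate:
  assumes H: "H \<subseteq> arcs n" and B: "B > 0"
    and row: "\<And>a. a < n \<Longrightarrow> xo H a + 1 \<le> \<theta> * r" "\<And>a. a < n \<Longrightarrow> yi H a + 1 \<le> \<theta> * r"
    and tot: "real n + real (card H) \<le> \<theta> * real n"
  shows "\<exists>d. \<bar>d\<bar> \<le> real (card H) * (\<theta> ^ 70 * r powi (-3)) \<and>
    prob_D n s t (\<lambda>G. G \<inter> H = {}) = B powr real (card H) * exp (pot H + d)"
proof -
  let ?A = "real (card (Omega (diag n \<union> H) {}))" and ?Z = "real (card (Omega (diag n) {}))"
  note tel = telescoping[OF H Omega_nonempty row tot]
  define d where "d = ln (?A / ?Z) - real (card H) * ln B - pot H"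
  have pos: "?A > 0" "?Z > 0" using tel Omega_nonempty by (simp_all add: card_gt_0_iff finite_Om)
  have "prob_D n s t (\<lambda>G. G \<inter> H = {}) = ?A / ?Z"
    unfolding prob_D_def avoiding_eq unfolding digraphs_deg_eq ..
  also have "\<dots> = exp (ln (?A / ?Z))" using pos by simp
  also have "ln (?A / ?Z) = real (card H) * ln B + (pot H + d)" by (simp add: d_def)
  also have "exp \<dots> = B powr real (card H) * exp (pot H + d)" using B by (simp add: powr_def exp_add)
  finally show ?thesis using tel unfolding d_def by blast
qed

section \<open>The two exponents as values of the potential\<close>

lemma potential_Mexp:
  assumes "H \<subseteq> arcs n"
  shows "potential (lam n s) n (dlt n s H) (eta n s t H) H = Mexp n s t H"
  unfolding potential_def mform_def psum_def Mexp_def Let_def Xarcs_card[OF assms] Rs_def Cs_def outdeg_rw indeg_cl Ysum_def ..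

text \<open>Complementation turns \<open>\<delta>_j\<close> into \<open>x_j - \<delta>_j\<close> and
  the density into \<open>1 - \<lambda>\<close>. Expanding the powers of the differences turns the
  first exponent into the second; the sums \<open>Y01\<close>, \<open>Y10\<close>,
  \<open>Y11\<close> come from the product of two differences.\<close>

lemma potential_Texp:
  assumes "H \<subseteq> arcs n" and l: "lam n s \<noteq> 0" "lam n s \<noteq> 1" and n: "n > 0"
  shows "potential (1 - lam n s) n (\<lambda>j. xo H j - dlt n s H j) (\<lambda>j. yi H j - eta n s t H j) H = Texp n s t H"
proof -
  define l where "l = lam n s"
  define R where "R = Rs n s H"
  define C where "C = Cs n s t H"
  let ?d = "\<lambda>j. xo H j - dlt n s H j" and ?e = "\<lambda>j. yi H j - eta n s t H j"
  have p11: "psum n ?d ?e H 1 1 = (R 0 2 + C 0 2) - (R 1 1 + C 1 1)"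
    by (simp add: psum_def R_def C_def Rs_def Cs_def outdeg_rw indeg_cl sum_subtractf power2_eq_square algebra_simps)
  have p02: "psum n ?d ?e H 0 2 = R 0 2 + C 0 2" "psum n ?d ?e H 0 3 = R 0 3 + C 0 3"
    by (simp_all add: psum_def R_def C_def Rs_def Cs_def outdeg_rw indeg_cl)
  have p12: "psum n ?d ?e H 1 2 = (R 0 3 + C 0 3) - (R 1 2 + C 1 2)"
    by (simp add: psum_def R_def C_def Rs_def Cs_def outdeg_rw indeg_cl sum_subtractf power2_eq_square power3_eq_cube algebra_simps)
  have p21: "psum n ?d ?e H 2 1 = (R 0 3 + C 0 3) - 2 * (R 1 2 + C 1 2) + (R 2 1 + C 2 1)"
    by (simp add: psum_def R_def C_def Rs_def Cs_def outdeg_rw indeg_cl sum_subtractf sum.distrib sum_distrib_left power2_eq_square power3_eq_cube algebra_simps)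
  have Y: "(\<Sum>(j,k)\<in>H. ?d j * ?e k) = Ysum n s t H - Y01 n s H - Y10 n s t H + Y11 H"
    unfolding Ysum_def Y01_def Y10_def Y11_def outdeg_rw indeg_cl sum_subtractf[symmetric] sum.distrib[symmetric]
    by (intro sum.cong refl) (auto simp: algebra_simps)
  have alg: "mform (1 - l) N X X2 (R02 - R11) Z R02 R03 (R03 - R12) (R03 - 2 * R12 + R21)
     = (1 - l) * X / (l * N) + (1 - l) * X2 / (2 * l * N^2) + R11 / (l * N) - R21 / (2 * l^2 * N^2)
      - (1 + l) * R02 / (2 * l * N) + (1 + 2*l) * R12 / (2 * l^2 * N^2)
      - (1 + l) * (1 + 2*l) * R03 / (6 * l^2 * N^2) - Z / (l * (1 - l) * N^2)"
    if "N > 0" for N X X2 R11 Z R02 R03 R12 R21 :: real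
  proof -
    define g i M where "g = 1 / l" and "i = 1 / (1 - l)" and "M = 1 / N"
    have mf: "mform (1 - l) N A B D E F G J K = (1 - l) * A * g * M + (1 - l) * B * (1/2) * g * M^2 - D * g * M - E * (g * i) * M^2
      + (1 - l) * F * (1/2) * g * M + (1 - l) * (1 - 2 * (1 - l)) * G * (1/6) * g^2 * M^2
      - (1 - 2 * (1 - l)) * J * (1/2) * g^2 * M^2 - K * (1/2) * g^2 * M^2" for A B D E F G J K
      by (simp add: mform_def g_def i_def M_def power_divide mult.commute)
    have "mform (1 - l) N X X2 (R02 - R11) Z R02 R03 (R03 - R12) (R03 - 2 * R12 + R21)
      = (1 - l) * X * g * M + (1 - l) * X2 * (1/2) * g * M^2 + R11 * g * M - R21 * (1/2) * g^2 * M^2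
      - (1 + l) * R02 * (1/2) * g * M + (1 + 2*l) * R12 * (1/2) * g^2 * M^2
      - (1 + l) * (1 + 2*l) * R03 * (1/6) * g^2 * M^2 - Z * (g * i) * M^2"
      unfolding mf by (simp add: algebra_simps power2_eq_square add_divide_distrib diff_divide_distrib)
    then show ?thesis by (simp add: g_def i_def M_def power_divide)
  qed
  show ?thesis
    unfolding potential_def p11 p02 p12 p21 Y Texp_def Let_def Xarcs_card[OF assms(1)] l_def[symmetric] R_def[symmetric] C_def[symmetric]
    by (rule alg) (use n in simp)
qed

lemma complement_digraphs:
  assumes H: "H \<subseteq> arcs n" and s: "\<And>j. j < n \<Longrightarrow> s j \<le> n - 1" "\<And>j. j < n \<Longrightarrow> t j \<le> n - 1"
  shows "prob_D n s t (\<lambda>G. H \<subseteq> G) = prob_D n (\<lambda>j. n - 1 - s j) (\<lambda>j. n - 1 - t j) (\<lambda>G. G \<inter> H = {})"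
proof -
  let ?s = "\<lambda>j. n - 1 - s j" and ?t = "\<lambda>j. n - 1 - t j"
  let ?c = "\<lambda>G. arcs n - G"
  have deg: "card (rw (?c G) j) = n - 1 - card (rw G j)" "card (cl (?c G) j) = n - 1 - card (cl G j)" if G: "G \<subseteq> arcs n" and j: "j < n" for G j
  proof -
    have "rw (?c G) j = ({..<n} - {j}) - rw G j" "cl (?c G) j = ({..<n} - {j}) - cl G j"
      using G j by (auto simp: arcs_def)
    moreover have sub: "rw G j \<subseteq> {..<n} - {j}" "cl G j \<subseteq> {..<n} - {j}" using G j by (auto simp: arcs_def)
    moreover have "finite (rw G j)" "finite (cl G j)" using sub finite_subset by blast+
    ultimately show "card (rw (?c G) j) = n - 1 - card (rw G j)" "card (cl (?c G) j) = n - 1 - card (cl G j)"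
      using j by (simp_all add: card_Diff_subset)
  qed
  have mem: "?c G \<in> digraphs_deg n ?s ?t" if "G \<in> digraphs_deg n s t" for G
    using that deg[of G] by (simp add: digraphs_deg_def outdeg_rw indeg_cl)
  have ss: "n - 1 - (n - 1 - s j) = s j" "n - 1 - (n - 1 - t j) = t j" if "j < n" for j
    using s[OF that] by simp_all
  have mem': "?c G \<in> digraphs_deg n s t" if "G \<in> digraphs_deg n ?s ?t" for G
  proof -
    have G: "G \<subseteq> arcs n" "\<And>j. j < n \<Longrightarrow> card (rw G j) = n - 1 - s j" "\<And>j. j < n \<Longrightarrow> card (cl G j) = n - 1 - t j"
      using that by (simp_all add: digraphs_deg_def outdeg_rw indeg_cl)
    have "card (rw (?c G) j) = s j" "card (cl (?c G) j) = t j" if "j < n" for j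
      unfolding deg[OF G(1) that] G(2,3)[OF that] ss[OF that] by (rule refl)+
    then show ?thesis by (simp add: digraphs_deg_def outdeg_rw indeg_cl)
  qed
  have cc: "?c (?c G) = G" if "G \<in> digraphs_deg n s' t'" for G s' t' using that by (auto simp: digraphs_deg_def)
  have "bij_betw ?c (digraphs_deg n s t) (digraphs_deg n ?s ?t)"
    by (rule bij_betw_byWitness[where f' = ?c]) (use mem mem' cc in auto)
  then have 1: "card (digraphs_deg n s t) = card (digraphs_deg n ?s ?t)" by (rule bij_betw_same_card)
  have HG: "H \<subseteq> G \<longleftrightarrow> ?c G \<inter> H = {}" for G using H by auto
  have HG': "H \<subseteq> ?c G \<longleftrightarrow> G \<inter> H = {}" for G using H by auto
  have "bij_betw ?c {G \<in> digraphs_deg n s t. H \<subseteq> G} {G \<in> digraphs_deg n ?s ?t. G \<inter> H = {}}"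
  proof (rule bij_betw_byWitness[where f' = ?c])
    show "?c ` {G \<in> digraphs_deg n s t. H \<subseteq> G} \<subseteq> {G \<in> digraphs_deg n ?s ?t. G \<inter> H = {}}"
    proof (rule image_subsetI)
      fix G assume "G \<in> {G \<in> digraphs_deg n s t. H \<subseteq> G}"
      then have G: "G \<in> digraphs_deg n s t" "H \<subseteq> G" by simp_all
      show "?c G \<in> {G \<in> digraphs_deg n ?s ?t. G \<inter> H = {}}"
        by (intro CollectI conjI mem[OF G(1)] iffD1[OF HG G(2)])
    qed
    show "?c ` {G \<in> digraphs_deg n ?s ?t. G \<inter> H = {}} \<subseteq> {G \<in> digraphs_deg n s t. H \<subseteq> G}"
    proof (rule image_subsetI)
      fix G assume "G \<in> {G \<in> digraphs_deg n ?s ?t. G \<inter> H = {}}"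
      then have G: "G \<in> digraphs_deg n ?s ?t" "G \<inter> H = {}" by simp_all
      show "?c G \<in> {G \<in> digraphs_deg n s t. H \<subseteq> G}"
        by (intro CollectI conjI mem'[OF G(1)] iffD2[OF HG' G(2)])
    qed
  qed (use cc in auto)
  then have "card {G \<in> digraphs_deg n s t. H \<subseteq> G} = card {G \<in> digraphs_deg n ?s ?t. G \<inter> H = {}}" by (rule bij_betw_same_card)
  then show ?thesis unfolding prob_D_def using 1 by simp
qed

lemma prob_estimates:
  fixes n :: nat and s t :: "nat \<Rightarrow> nat" and H :: "(nat \<times> nat) set" and \<theta> :: real
  defines "lm \<equiv> lam n s" and "r \<equiv> sqrt (real n)" and "p \<equiv> sbar n s / (real n - 1)"
  assumes sc: "scale \<theta> r" and l: "1 / \<theta> \<le> lm" "lm \<le> 1 - 1 / \<theta>"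
    and dev: "\<And>j. j < n \<Longrightarrow> \<bar>real (s j) - sbar n s\<bar> + 1 \<le> \<theta> * r" "\<And>j. j < n \<Longrightarrow> \<bar>real (t j) - sbar n s\<bar> + 1 \<le> \<theta> * r"
    and deg: "\<And>j. j < n \<Longrightarrow> real (outdeg H j) + 1 \<le> \<theta> * r" "\<And>j. j < n \<Longrightarrow> real (indeg H j) + 1 \<le> \<theta> * r"
    and H: "H \<subseteq> arcs n" and sums: "(\<Sum>j<n. s j) = (\<Sum>j<n. t j)" and tot: "real n + Xarcs n H \<le> \<theta> * real n"
  shows "\<exists>d. \<bar>d\<bar> \<le> Xarcs n H * (\<theta> ^ 70 * r powi (-3)) \<and> prob_D n s t (\<lambda>G. G \<inter> H = {}) = (1 - p) powr Xarcs n H * exp (Mexp n s t H + d)"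
    "\<exists>d. \<bar>d\<bar> \<le> Xarcs n H * (\<theta> ^ 70 * r powi (-3)) \<and> prob_D n s t (\<lambda>G. H \<subseteq> G) = p powr Xarcs n H * exp (Texp n s t H + d)"
proof -
  interpret S: scale \<theta> r by (rule sc)
  have rn: "real n = r ^ 2" by (simp add: r_def)
  have r4: "r \<ge> \<theta> ^ 4 * 100"
  proof -
    have "\<theta> ^ 4 * 100 \<le> \<theta> ^ 4 * \<theta>" using S.theta_ge by (intro mult_left_mono) auto
    also have "\<dots> \<le> \<theta> ^ 100" using power_increasing[of 5 100 \<theta>] S.theta_pos by (simp flip: power_Suc2)
    finally show ?thesis using S.r_ge by linarith
  qed
  have r10: "r \<ge> 10000"
  proof -
    have "100 ^ 4 \<le> \<theta> ^ 4" using S.theta_ge by (intro power_mono) auto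
    then have "\<theta> ^ 4 \<ge> 10000" by simp
    then show ?thesis using r4 by linarith
  qed
  have "r * r \<ge> 10000 * r" using r10 by (intro mult_right_mono) auto
  then have nr: "real n \<ge> 10000 * r" by (simp add: rn power2_eq_square)
  have n10: "real n \<ge> 10000" using nr r10 by linarith
  have npos: "real n > 0" "real n \<noteq> 0" "n > 0" using n10 by auto
  have lam: "sbar n s = lm * real n" using npos by (simp add: lm_def lam_def)
  have tot0: "(\<Sum>a<n. real (s a)) = lm * real n ^ 2" using lam npos by (simp add: sbar_def field_simps power2_eq_square)
  have th: "1 / \<theta> > 0" "\<theta> \<ge> 100" using S.theta_pos S.theta_ge by auto
  have l01: "0 < lm" "lm < 1" using l th by linarith+
  have inv: "1 / lm \<le> \<theta>" "1 / (1 - lm) \<le> \<theta>"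
  proof -
    have "1 \<le> lm * \<theta>" "1 \<le> (1 - lm) * \<theta>" using l S.theta_pos by (simp_all add: field_simps)
    then show "1 / lm \<le> \<theta>" "1 / (1 - lm) \<le> \<theta>" using l01 by (simp_all add: field_simps)
  qed
  have n1: "real n - 1 > 0" "real n \<le> 2 * (real n - 1)" using n10 by auto
  have p: "p = lm * real n / (real n - 1)" by (simp add: p_def lam)
  have X: "Xarcs n H = real (card H)" by (rule Xarcs_card[OF H])
  have small: "10 * \<theta> ^ 2 / real n ^ 2 \<le> \<theta> ^ 3 * r powi (-3)"
  proof -
    have "10 * \<theta> ^ 2 \<le> \<theta> * \<theta> ^ 2" using S.theta_ge by (intro mult_right_mono) auto
    also have "\<dots> \<le> \<theta> ^ 3 * r" using S.theta_pos S.r_pos by (simp add: power2_eq_square power3_eq_cube)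
    finally have "10 * \<theta> ^ 2 / real n ^ 2 \<le> \<theta> ^ 3 * r / real n ^ 2" by (rule divide_right_mono) simp
    also have "\<dots> = \<theta> ^ 3 * r powi (-3)"
      using S.r_pos by (simp add: rn power_int_minus divide_simps numeral_eq_Suc)
    finally show ?thesis .
  qed
  have near: "near_regular \<theta> r n s t lm"
  proof (unfold_locales)
    show "\<bar>(\<Sum>a<n. real (s a)) - lm * real n ^ 2\<bar> \<le> \<theta> * real n" using tot0 S.theta_pos by simp
    show "real n = r ^ 2" "1 / \<theta> \<le> lm" "lm \<le> 1 - 1 / \<theta>" "(\<Sum>a<n. s a) = (\<Sum>a<n. t a)" using rn l sums by auto
    show "\<bar>real (s a) - lm * real n\<bar> \<le> \<theta> * r" "\<bar>real (t a) - lm * real n\<bar> \<le> \<theta> * r" if "a < n" for a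
      using dev[OF that] lam by auto
  qed
  have lnM: "\<bar>ln (1 - p) - (ln (1 - lm) - lm * (1 / (1 - lm)) * (1 / real n))\<bar> \<le> \<theta> ^ 3 * r powi (-3)" and pM: "1 - p > 0"
  proof -
    \<comment> \<open>From \<open>p = lm * n / (n - 1)\<close> one gets
      \<open>1 - p = (1 - lm) * (1 - w)\<close>. The logarithm is then \<open>- w\<close> to first
      order, and replacing \<open>n - 1\<close> by \<open>n\<close> costs order
      \<open>1 / n^2\<close>.\<close>
    define w where "w = lm * (1 / (1 - lm)) * (1 / (real n - 1))"
    have li: "0 \<le> lm * (1 / (1 - lm))" "lm * (1 / (1 - lm)) \<le> \<theta>"
      using l01 inv mult_mono[of lm 1 "1 / (1 - lm)" \<theta>] by auto
    have in1: "1 / (real n - 1) \<le> 2 / real n" using n1 npos by (simp add: field_simps)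
    have w: "0 \<le> w" "w \<le> \<theta> * (2 / real n)"
    proof -
      show "0 \<le> w" unfolding w_def using li n1 l01 by (intro mult_nonneg_nonneg) auto
      show "w \<le> \<theta> * (2 / real n)" unfolding w_def using li in1 n1 l01 S.theta_pos by (intro mult_mono) auto
    qed
    have "\<theta> * 4 \<le> real n"
    proof -
      have "\<theta> \<le> \<theta> ^ 4" using S.theta_pos power_increasing[of 1 4 \<theta>] by simp
      then have "\<theta> * 4 \<le> r" using r4 S.theta_pos by linarith
      then show ?thesis using nr r10 by linarith
    qed
    then have "\<theta> * (2 / real n) \<le> 1/2" using npos by (simp add: field_simps)
    then have w2: "w \<le> 1/2" using w by linarith
    have eq: "1 - p = (1 - lm) * (1 - w)"
    proof -
      have ne: "1 - lm \<noteq> 0" "real n - 1 \<noteq> 0" using l01 n1 by auto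
      have "(1 - lm) * w = lm * (1 / (real n - 1))" using ne(1) by (simp add: w_def)
      moreover have "p = lm + lm * (1 / (real n - 1))" unfolding p using ne(2) by (simp add: field_simps)
      ultimately show ?thesis by (simp add: right_diff_distrib)
    qed
    show "1 - p > 0" unfolding eq using l01 w2 by simp
    have "ln (1 - p) = ln (1 - lm) + ln (1 - w)" unfolding eq using l01 w2 by (intro ln_mult_pos) auto
    then have "ln (1 - p) - (ln (1 - lm) - lm * (1 / (1 - lm)) * (1 / real n)) = (ln (1 - w) + w) - lm * (1 / (1 - lm)) * (1 / (real n - 1) - 1 / real n)"
      by (simp add: w_def algebra_simps)
    moreover have "\<bar>ln (1 - w) + w\<bar> \<le> 2 * (\<theta> * (2 / real n))\<^sup>2"
    proof -
      have "w\<^sup>2 \<le> (\<theta> * (2 / real n))\<^sup>2" using w by (intro power_mono) auto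
      then show ?thesis using ln_one_minus_bound[OF w(1) w2] by linarith
    qed
    moreover have "\<bar>lm * (1 / (1 - lm)) * (1 / (real n - 1) - 1 / real n)\<bar> \<le> \<theta> * (2 / real n ^ 2)"
    proof -
      have e: "1 / (real n - 1) - 1 / real n = (1 / (real n - 1)) * (1 / real n)" using n1 npos by (simp add: field_simps)
      have "(1 / (real n - 1)) * (1 / real n) \<le> (2 / real n) * (1 / real n)" using in1 by (intro mult_right_mono) auto
      then have "lm * (1 / (1 - lm)) * (1 / (real n - 1) - 1 / real n) \<le> \<theta> * (2 / real n ^ 2)"
        unfolding e using li n1 l01 S.theta_pos by (intro mult_mono) (auto simp: power2_eq_square)
      moreover have "0 \<le> lm * (1 / (1 - lm)) * (1 / (real n - 1) - 1 / real n)" unfolding e using li n1 l01 by (intro mult_nonneg_nonneg) auto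
      ultimately show ?thesis by linarith
    qed
    ultimately have "\<bar>ln (1 - p) - (ln (1 - lm) - lm * (1 / (1 - lm)) * (1 / real n))\<bar> \<le> 2 * (\<theta> * (2 / real n))\<^sup>2 + \<theta> * (2 / real n ^ 2)" by linarith
    also have "\<dots> \<le> 10 * \<theta> ^ 2 / real n ^ 2"
    proof -
      have "2 * \<theta> \<le> 2 * \<theta> ^ 2" using S.theta_pos by (simp add: power2_eq_square)
      then have "(8 * \<theta> ^ 2 + 2 * \<theta>) / real n ^ 2 \<le> (10 * \<theta> ^ 2) / real n ^ 2" by (intro divide_right_mono) auto
      then show ?thesis by (simp add: power_mult_distrib power_divide add_divide_distrib mult.commute)
    qed
    also note small
    finally show "\<bar>ln (1 - p) - (ln (1 - lm) - lm * (1 / (1 - lm)) * (1 / real n))\<bar> \<le> \<theta> ^ 3 * r powi (-3)" .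
  qed
  show "\<exists>d. \<bar>d\<bar> \<le> Xarcs n H * (\<theta> ^ 70 * r powi (-3)) \<and> prob_D n s t (\<lambda>G. G \<inter> H = {}) = (1 - p) powr Xarcs n H * exp (Mexp n s t H + d)"
  proof -
    interpret N: near_regular \<theta> r n s t lm by (rule near)
    interpret T: telescope \<theta> r n s t lm lm "1 - p"
    proof unfold_locales
      show "\<bar>lm\<bar> \<le> 1" using l01 by simp
      show "(\<Sum>a<n. real (s a)) = lm * real n ^ 2 + (lm - lm) * real n" using tot0 by simp
      show "S.bd 3 (-3) (ln (1 - p) - (ln (1 - lm) - lm * (1 / (1 - lm)) * (1 / real n)))"
        using lnM by (simp add: S.bd_def)
    qed
    have "T.del H = dlt n s H" "T.et H = eta n s t H"
      by (auto simp: T.del_def T.et_def dlt_def eta_def outdeg_rw indeg_cl lam lm_def[symmetric])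
    then have "T.pot H = Mexp n s t H" using potential_Mexp[OF H, of s t] by (simp add: lm_def)
    then show ?thesis using T.prob_estimate[OF H pM] deg tot unfolding outdeg_rw indeg_cl X by simp
  qed
  \<comment> \<open>Complementary degrees are formed by truncated subtraction, so this bound has to
    be known first; it follows from the density bound.\<close>
  have snle: "s j \<le> n - 1" "t j \<le> n - 1" if "j < n" for j
  proof -
    have "\<theta> * r + 1 \<le> real n / \<theta>"
    proof -
      have a: "\<theta> ^ 4 * 100 * r \<le> r * r" using r4 S.r_pos by (intro mult_right_mono) auto
      have "\<theta> * (\<theta> * r + 1) \<le> \<theta> ^ 2 * r * 2"
      proof -
        have "\<theta> \<le> \<theta> ^ 2 * r" using mult_mono[of \<theta> "\<theta>^2" 1 r] S.theta_pos S.r_pos by (simp add: power2_eq_square)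
        then show ?thesis by (simp add: power2_eq_square algebra_simps)
      qed
      also have "\<dots> \<le> \<theta> ^ 4 * 100 * r"
      proof -
        have "\<theta> ^ 2 \<le> \<theta> ^ 4" using S.theta_pos by (intro power_increasing) auto
        moreover have "\<theta> ^ 4 \<ge> 0" by simp
        ultimately have "\<theta> ^ 2 * 2 \<le> \<theta> ^ 4 * 100" by linarith
        then have "(\<theta> ^ 2 * 2) * r \<le> (\<theta> ^ 4 * 100) * r" using S.r_pos by (intro mult_right_mono) auto
        moreover have "\<theta> ^ 2 * r * 2 = (\<theta> ^ 2 * 2) * r" by simp
        ultimately show ?thesis by (simp only:)
      qed
      also note a
      finally show ?thesis using S.theta_pos by (simp add: rn power2_eq_square field_simps)
    qed
    moreover have "lm * real n \<le> real n - real n / \<theta>"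
      using mult_right_mono[OF l(2), of "real n"] by (simp add: left_diff_distrib)
    ultimately have "real (s j) \<le> real n - 1" "real (t j) \<le> real n - 1" using dev[OF that] lam by linarith+
    then show "s j \<le> n - 1" "t j \<le> n - 1" by linarith+
  qed
  show "\<exists>d. \<bar>d\<bar> \<le> Xarcs n H * (\<theta> ^ 70 * r powi (-3)) \<and> prob_D n s t (\<lambda>G. H \<subseteq> G) = p powr Xarcs n H * exp (Texp n s t H + d)"
  proof -
    define s' t' where "s' j = n - 1 - s j" and "t' j = n - 1 - t j" for j
    have s': "real (s' j) = real n - 1 - real (s j)" "real (t' j) = real n - 1 - real (t j)" if "j < n" for j
      using snle[OF that] npos by (auto simp: s'_def t'_def of_nat_diff)
    have sums': "(\<Sum>a<n. real (s' a)) = real n * (real n - 1) - lm * real n ^ 2"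
      "(\<Sum>a<n. real (t' a)) = real n * (real n - 1) - lm * real n ^ 2"
    proof -
      have st: "(\<Sum>a<n. real (t a)) = (\<Sum>a<n. real (s a))" using sums by (simp flip: of_nat_sum)
      have "(\<Sum>a<n. real (s' a)) = (\<Sum>a<n. real n - 1 - real (s a))" "(\<Sum>a<n. real (t' a)) = (\<Sum>a<n. real n - 1 - real (t a))"
        by (intro sum.cong refl; simp add: s')+
      then show "(\<Sum>a<n. real (s' a)) = real n * (real n - 1) - lm * real n ^ 2"
        "(\<Sum>a<n. real (t' a)) = real n * (real n - 1) - lm * real n ^ 2" using tot0 st by (simp_all add: sum_subtractf)
    qed
    have ppos: "p > 0" using l01 n1 npos by (simp add: p)
    have lnT: "\<bar>ln p - (ln (1 - (1 - lm)) - (- lm) * (1 / (1 - (1 - lm))) * (1 / real n))\<bar> \<le> \<theta> ^ 3 * r powi (-3)"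
    proof -
      define w where "w = 1 / real n"
      have w: "0 \<le> w" "w \<le> 1/2" using n10 by (simp_all add: w_def)
      \<comment> \<open>Since \<open>lm = p * (1 - 1 / n)\<close> exactly, the correction to
        \<open>ln lm\<close> is \<open>- ln (1 - 1 / n)\<close>, which is \<open>1 / n\<close> to
        first order.\<close>
      have "p * (1 - w) = lm" using n1 npos by (simp add: p w_def field_simps)
      then have "ln lm = ln p + ln (1 - w)" using ln_mult_pos[of p "1 - w"] ppos w by simp
      then have "ln p - (ln (1 - (1 - lm)) - (- lm) * (1 / (1 - (1 - lm))) * (1 / real n)) = - (ln (1 - w) + w)"
        using l01 by (simp add: w_def)
      moreover have "\<bar>ln (1 - w) + w\<bar> \<le> 2 * w\<^sup>2" by (rule ln_one_minus_bound[OF w])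
      moreover have "2 * w\<^sup>2 \<le> 10 * \<theta> ^ 2 / real n ^ 2"
      proof -
        have "1 \<le> \<theta> ^ 2" using S.theta_pos by (intro one_le_power) auto
        then have "2 / real n ^ 2 \<le> 10 * \<theta> ^ 2 / real n ^ 2" by (intro divide_right_mono) auto
        then show ?thesis by (simp add: w_def power_divide)
      qed
      ultimately show ?thesis using small by linarith
    qed
    have near': "near_regular \<theta> r n s' t' (1 - lm)"
    proof (unfold_locales)
      have "(\<Sum>a<n. real (s' a)) - (1 - lm) * real n ^ 2 = - real n" unfolding sums' by (simp add: power2_eq_square algebra_simps)
      moreover have "real n \<le> \<theta> * real n" using S.theta_pos by (simp add: mult_le_cancel_right1)
      ultimately show "\<bar>(\<Sum>a<n. real (s' a)) - (1 - lm) * real n ^ 2\<bar> \<le> \<theta> * real n" by simp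
      show "real n = r ^ 2" "1 / \<theta> \<le> 1 - lm" "1 - lm \<le> 1 - 1 / \<theta>" using rn l by auto
      have "(\<Sum>a<n. real (s' a)) = (\<Sum>a<n. real (t' a))" unfolding sums' ..
      then show "(\<Sum>a<n. s' a) = (\<Sum>a<n. t' a)" by (simp flip: of_nat_sum)
      show "\<bar>real (s' a) - (1 - lm) * real n\<bar> \<le> \<theta> * r" "\<bar>real (t' a) - (1 - lm) * real n\<bar> \<le> \<theta> * r" if "a < n" for a
        using dev[OF that] lam s'[OF that] by (auto simp: algebra_simps)
    qed
    interpret N: near_regular \<theta> r n s' t' "1 - lm" by (rule near')
    interpret T: telescope \<theta> r n s' t' "1 - lm" "- lm" p
    proof unfold_locales
      show "\<bar>- lm\<bar> \<le> 1" using l01 by simp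
      show "(\<Sum>a<n. real (s' a)) = (1 - lm) * real n ^ 2 + (- lm - (1 - lm)) * real n"
        unfolding sums' by (simp add: power2_eq_square algebra_simps)
      show "S.bd 3 (-3) (ln p - (ln (1 - (1 - lm)) - (- lm) * (1 / (1 - (1 - lm))) * (1 / real n)))"
        using lnT by (simp only: S.bd_def)
    qed
    have del: "T.del H j = xo H j - dlt n s H j" "T.et H j = yi H j - eta n s t H j" if "j < n" for j
      using s'[OF that] by (simp_all add: T.del_def T.et_def dlt_def eta_def outdeg_rw indeg_cl lam lm_def[symmetric] algebra_simps)
    have "T.pot H = potential (1 - lm) n (\<lambda>j. xo H j - dlt n s H j) (\<lambda>j. yi H j - eta n s t H j) H"
    proof -
      have ps: "psum n (T.del H) (T.et H) H h k = psum n (\<lambda>j. xo H j - dlt n s H j) (\<lambda>j. yi H j - eta n s t H j) H h k" for h k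
        unfolding psum_def by (intro arg_cong2[of _ _ _ _ "(+)"] sum.cong refl) (auto simp: del)
      have "(\<Sum>(j,k)\<in>H. T.del H j * T.et H k) = (\<Sum>(j,k)\<in>H. (xo H j - dlt n s H j) * (yi H k - eta n s t H k))"
        using H by (intro sum.cong refl) (auto simp: del arcs_def)
      then show ?thesis unfolding potential_def ps by simp
    qed
    also have "\<dots> = Texp n s t H" unfolding lm_def using l01 npos by (intro potential_Texp[OF H]) (auto simp: lm_def)
    finally have pot: "T.pot H = Texp n s t H" .
    have "prob_D n s t (\<lambda>G. H \<subseteq> G) = prob_D n s' t' (\<lambda>G. G \<inter> H = {})"
      unfolding s'_def t'_def by (rule complement_digraphs[OF H snle])
    then show ?thesis using T.prob_estimate[OF H ppos] deg tot pot unfolding outdeg_rw indeg_cl X by simp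
  qed
qed

text \<open>With \<open>u = n powr \<epsilon>\<close> one has \<open>\<theta> = u ^ 4\<close>. The
  hypotheses cost at most \<open>K * u\<close> or \<open>K * u^2\<close>, and
  \<open>ln n \<le> u / \<epsilon>\<close>; since \<open>u\<close> exceeds \<open>K\<close> and
  \<open>3 * a / \<epsilon>\<close>, the fourth power covers all of them. The condition
  \<open>\<theta> ^ 100 \<le> sqrt n\<close> is where \<open>\<epsilon> \<le> 1/1000\<close> enters,
  since \<open>\<theta> ^ 100 = n powr (400 * \<epsilon>)\<close>.\<close>

lemma parameter_bounds:
  fixes \<epsilon> K a :: real and n :: nat
  assumes "0 < \<epsilon>" "\<epsilon> \<le> 1/1000" "K > 0" "a > 0" and n: "real n powr \<epsilon> \<ge> 100 + 2 * K + 3 * a / \<epsilon>" "n \<ge> 1"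
  defines "\<theta> \<equiv> real n powr (4 * \<epsilon>)"
  shows "scale \<theta> (sqrt (real n))" "K * real n powr (1/2 + \<epsilon>) + 1 \<le> \<theta> * sqrt (real n)"
    "real n + K * real n powr (1 + 2 * \<epsilon>) \<le> \<theta> * real n" "3 * a * ln (real n) + 8 \<le> \<theta>"
proof -
  define u where "u = real n powr \<epsilon>"
  have n1: "real n \<ge> 1" using n by simp
  have th: "\<theta> = u ^ 4" unfolding \<theta>_def u_def by (subst powr_power) (use n1 in \<open>auto simp: mult.commute\<close>)
  have ae: "3 * a / \<epsilon> > 0" using assms by simp
  have u: "u \<ge> 100" "u \<ge> K" "u \<ge> 3 * a / \<epsilon>" using n ae assms(3) unfolding u_def[symmetric] by linarith+
  have r1: "sqrt (real n) \<ge> 1" using n1 by simp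
  have u2: "u ^ 2 * 100 \<le> u ^ 3" "u ^ 3 * 100 \<le> u ^ 4" "100 * u \<le> u ^ 2" "u ^ 2 > 0" "u ^ 3 > 0"
    using u by (simp_all add: power2_eq_square power3_eq_cube power4_eq_xxxx mult_left_mono mult.assoc)
  show "scale \<theta> (sqrt (real n))"
  proof
    show "\<theta> \<ge> 100" unfolding th using u u2 by linarith
    have "\<theta> ^ 100 = real n powr (400 * \<epsilon>)" unfolding \<theta>_def by (subst powr_power) (use n1 in auto)
    also have "\<dots> \<le> real n powr (1/2)" using assms n1 by (intro powr_mono) auto
    finally show "\<theta> ^ 100 \<le> sqrt (real n)" using n1 by (simp add: powr_half_sqrt)
  qed
  have "K * real n powr (1/2 + \<epsilon>) = K * u * sqrt (real n)"
    using n1 by (simp add: powr_add powr_half_sqrt u_def)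
  also have "\<dots> + 1 \<le> u ^ 2 * sqrt (real n) + u ^ 2 * sqrt (real n)"
  proof (intro add_mono)
    show "K * u * sqrt (real n) \<le> u ^ 2 * sqrt (real n)"
      using u by (intro mult_right_mono) (auto simp: power2_eq_square)
    show "1 \<le> u ^ 2 * sqrt (real n)" using mult_mono[of 1 "u ^ 2" 1 "sqrt (real n)"] u u2 r1 by simp
  qed
  also have "\<dots> = (2 * u ^ 2) * sqrt (real n)" by simp
  also have "\<dots> \<le> \<theta> * sqrt (real n)" unfolding th using u2 by (intro mult_right_mono) auto
  finally show "K * real n powr (1/2 + \<epsilon>) + 1 \<le> \<theta> * sqrt (real n)" .
  have "K * real n powr (1 + 2 * \<epsilon>) = K * u ^ 2 * real n"
  proof -
    have "u ^ 2 = real n powr (2 * \<epsilon>)" unfolding u_def by (subst powr_power) (use n1 in \<open>auto simp: mult.commute\<close>)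
    then show ?thesis using n1 by (simp add: powr_add)
  qed
  also have "real n + \<dots> = (1 + K * u ^ 2) * real n" by (simp add: algebra_simps)
  also have "\<dots> \<le> \<theta> * real n"
  proof (intro mult_right_mono)
    have "K * u ^ 2 \<le> u * u ^ 2" using u by (intro mult_right_mono) auto
    moreover have "u * u ^ 2 = u ^ 3" by (simp add: power2_eq_square power3_eq_cube)
    ultimately show "1 + K * u ^ 2 \<le> \<theta>" unfolding th using u u2 by linarith
  qed auto
  finally show "real n + K * real n powr (1 + 2 * \<epsilon>) \<le> \<theta> * real n" .
  have "ln (real n) \<le> u / \<epsilon>" unfolding u_def using n1 assms by (intro ln_powr_bound) auto
  then have "3 * a * ln (real n) \<le> 3 * a * (u / \<epsilon>)" using assms by (intro mult_left_mono) auto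
  also have "\<dots> = (3 * a / \<epsilon>) * u" by simp
  also have "\<dots> \<le> u * u" using u by (intro mult_right_mono) auto
  finally have "3 * a * ln (real n) \<le> u ^ 2" by (simp add: power2_eq_square)
  then show "3 * a * ln (real n) + 8 \<le> \<theta>" unfolding th using u u2 by linarith
qed

text \<open>As \<open>(1 - 2 * l)^2 = 1 - 4 * l * (1 - l)\<close>, the second hypothesis is really a
  lower bound \<open>2 / (3 * L + 8)\<close> for \<open>l * (1 - l)\<close>, and both factors are at
  most 1.\<close>

lemma density_bounds:
  fixes l a L \<theta> :: real
  assumes A: "l * (1 - l) / 2 > 0" and le: "(1 - 2 * l)^2 / (3 * (l * (1 - l) / 2)) \<le> L" and \<theta>: "3 * L + 8 \<le> \<theta>"
  shows "1 / \<theta> \<le> l" "l \<le> 1 - 1 / \<theta>"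
proof -
  have q: "l * (1 - l) > 0" using A by simp
  then have l: "0 < l" "l < 1" by (auto simp: zero_less_mult_iff)
  have "(1 - 2 * l)^2 = 1 - 4 * (l * (1 - l))" by (simp add: power2_eq_square algebra_simps)
  then have "2 * (1 - 4 * (l * (1 - l))) \<le> 3 * L * (l * (1 - l))"
    using le q by (simp add: divide_le_eq algebra_simps)
  then have "2 \<le> (3 * L + 8) * (l * (1 - l))" by (simp add: algebra_simps)
  also have "\<dots> \<le> \<theta> * (l * (1 - l))" using \<theta> q by (intro mult_right_mono) auto
  finally have 2: "2 \<le> \<theta> * (l * (1 - l))" .
  then have pos: "\<theta> > 0" using q by (metis less_le_trans zero_less_mult_pos2 zero_less_numeral)
  have "l * (1 - l) \<le> l" "l * (1 - l) \<le> 1 - l" using l by (simp_all add: mult_left_le mult_left_le_one_le)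
  then have "2 \<le> \<theta> * l" "2 \<le> \<theta> * (1 - l)" using 2 mult_left_mono[of "l * (1 - l)" _ \<theta>] pos by (meson less_imp_le order_trans)+
  then show "1 / \<theta> \<le> l" "l \<le> 1 - 1 / \<theta>" using pos by (simp_all add: field_simps)
qed

theorem theorem3p2:
  fixes a b :: real
  assumes "a > 0" and "b > 0" and "a + b < 1/2"
  shows "\<exists>\<epsilon>0>0. \<forall>\<epsilon>::real. 0 < \<epsilon> \<and> \<epsilon> < \<epsilon>0 \<longrightarrow>
    (\<forall>K>0. \<exists>Cc::real. \<exists>N0::nat. \<forall>n (s::nat \<Rightarrow> nat) (t::nat \<Rightarrow> nat) (H::(nat \<times> nat) set).
      n \<ge> N0
      \<and> (\<forall>j<n. s j \<ge> 1 \<and> t j \<ge> 1)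
      \<and> (\<Sum>j<n. s j) = (\<Sum>j<n. t j)
      \<and> H \<subseteq> arcs n
      \<and> (\<forall>j<n. \<bar>real (s j) - sbar n s\<bar> \<le> K * real n powr (1/2 + \<epsilon>)
             \<and> \<bar>real (t j) - sbar n s\<bar> \<le> K * real n powr (1/2 + \<epsilon>)
             \<and> real (outdeg H j) \<le> K * real n powr (1/2 + \<epsilon>)
             \<and> real (indeg H j) \<le> K * real n powr (1/2 + \<epsilon>))
      \<and> Xarcs n H \<le> K * real n powr (1 + 2 * \<epsilon>)
      \<and> Acst n s > 0
      \<and> (1 - 2 * lam n s)^2 / (3 * Acst n s) \<le> a * ln (real n)
      \<longrightarrow>
      (let p = sbar n s / (real n - 1); X = Xarcs n H in
        (\<exists>d. \<bar>d\<bar> \<le> Cc * real n powr (-b) \<and>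
           prob_D n s t (\<lambda>G. G \<inter> H = {}) = (1 - p) powr X * exp (Mexp n s t H + d))
      \<and> (\<exists>d. \<bar>d\<bar> \<le> Cc * real n powr (-b) \<and>
           prob_D n s t (\<lambda>G. H \<subseteq> G) = p powr X * exp (Texp n s t H + d))))"
  (is "\<exists>\<epsilon>0>0. \<forall>\<epsilon>. _ \<and> _ \<longrightarrow> (\<forall>K>0. ?P \<epsilon> K)")
proof -
  \<comment> \<open>The total error is at most \<open>\<theta> * n\<close> steps of size
    \<open>\<theta> ^ 70 * n powr (-3/2)\<close>, that is
    \<open>n powr (284 * \<epsilon> - 1/2)\<close> with \<open>284 = 4 * 71\<close>. It has to stay
    below \<open>n powr (- b)\<close>.\<close>
  define \<epsilon>0 where "\<epsilon>0 = min (1/1000) ((1/2 - b) / 284)"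
  have e0: "\<epsilon>0 > 0" using assms by (simp add: \<epsilon>0_def)
  have main: "?P \<epsilon> K"
    if eps: "0 < \<epsilon>" "\<epsilon> < \<epsilon>0" and K: "K > 0" for \<epsilon> K
  proof -
    have eps': "\<epsilon> \<le> 1/1000" "284 * \<epsilon> \<le> 1/2 - b" using eps by (simp_all add: \<epsilon>0_def)
    define c where "c = 100 + 2 * K + 3 * a / \<epsilon>"
    have c: "c > 0" using K assms eps by (simp add: c_def add_pos_pos)
    \<comment> \<open>From here on \<open>n powr \<epsilon>\<close> is at least \<open>c\<close>, as
      \<open>parameter_bounds\<close> requires.\<close>
    define N0 where "N0 = nat \<lceil>c powr (1 / \<epsilon>)\<rceil> + 1"
    show ?thesis
    \<comment> \<open>The constant 1 suffices for the error, since \<open>\<theta>\<close> has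
      absorbed \<open>K\<close> and all numerical constants.\<close>
    proof (rule exI[of _ 1], rule exI[of _ N0], intro allI impI, elim conjE)
      fix n :: nat and s t :: "nat \<Rightarrow> nat" and H
      assume n: "N0 \<le> n" and sums: "(\<Sum>j<n. s j) = (\<Sum>j<n. t j)" and H: "H \<subseteq> arcs n"
        and dev: "\<forall>j<n. \<bar>real (s j) - sbar n s\<bar> \<le> K * real n powr (1/2 + \<epsilon>)
             \<and> \<bar>real (t j) - sbar n s\<bar> \<le> K * real n powr (1/2 + \<epsilon>)
             \<and> real (outdeg H j) \<le> K * real n powr (1/2 + \<epsilon>)
             \<and> real (indeg H j) \<le> K * real n powr (1/2 + \<epsilon>)"
        and X: "Xarcs n H \<le> K * real n powr (1 + 2 * \<epsilon>)" and A: "0 < Acst n s"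
        and lam: "(1 - 2 * lam n s)^2 / (3 * Acst n s) \<le> a * ln (real n)"
      have n1: "n \<ge> 1" using n by (simp add: N0_def)
      have "c powr (1 / \<epsilon>) \<le> real n" using n unfolding N0_def by linarith
      then have "(c powr (1 / \<epsilon>)) powr \<epsilon> \<le> real n powr \<epsilon>" using eps by (intro powr_mono2) auto
      then have nc: "real n powr \<epsilon> \<ge> 100 + 2 * K + 3 * a / \<epsilon>" using eps c by (simp add: powr_powr c_def)
      define \<theta> where "\<theta> = real n powr (4 * \<epsilon>)"
      let ?r = "sqrt (real n)"
      note pb = parameter_bounds[OF eps(1) eps'(1) K assms(1) nc n1, folded \<theta>_def]
      have "3 * (a * ln (real n)) + 8 \<le> \<theta>" using pb(4) by simp
      note l = density_bounds[OF A[unfolded Acst_def] lam[unfolded Acst_def] this]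
      have tot: "real n + Xarcs n H \<le> \<theta> * real n" using X pb(3) by linarith
      have b: "\<bar>real (s j) - sbar n s\<bar> + 1 \<le> \<theta> * ?r" "\<bar>real (t j) - sbar n s\<bar> + 1 \<le> \<theta> * ?r"
        "real (outdeg H j) + 1 \<le> \<theta> * ?r" "real (indeg H j) + 1 \<le> \<theta> * ?r" if "j < n" for j
      proof -
        have "\<bar>real (s j) - sbar n s\<bar> \<le> K * real n powr (1/2 + \<epsilon>)" "\<bar>real (t j) - sbar n s\<bar> \<le> K * real n powr (1/2 + \<epsilon>)"
          "real (outdeg H j) \<le> K * real n powr (1/2 + \<epsilon>)" "real (indeg H j) \<le> K * real n powr (1/2 + \<epsilon>)"
          using dev that by blast+
        then show "\<bar>real (s j) - sbar n s\<bar> + 1 \<le> \<theta> * ?r" "\<bar>real (t j) - sbar n s\<bar> + 1 \<le> \<theta> * ?r"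
          "real (outdeg H j) + 1 \<le> \<theta> * ?r" "real (indeg H j) + 1 \<le> \<theta> * ?r" using pb(2) by linarith+
      qed
      have err: "Xarcs n H * (\<theta> ^ 70 * ?r powi (-3)) \<le> 1 * real n powr (- b)"
      proof -
        have n1': "real n \<ge> 1" using n1 by simp
        have r3: "?r powi (-3) = real n powr (- 3/2)"
        proof -
          have "?r powi (-3) = inverse (?r ^ 3)" by (simp add: power_int_minus)
          also have "?r ^ 3 = real n powr (3/2)" using n1' by (simp add: powr_half_sqrt[symmetric] powr_power)
          finally show ?thesis by (simp add: powr_minus)
        qed
        have "Xarcs n H \<le> \<theta> * real n" using tot by linarith
        then have "Xarcs n H * (\<theta> ^ 70 * ?r powi (-3)) \<le> (\<theta> * real n) * (\<theta> ^ 70 * ?r powi (-3))"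
          by (intro mult_right_mono) (auto simp: \<theta>_def)
        also have "\<dots> = (\<theta> * \<theta> ^ 70) * (real n powr 1 * real n powr (- 3/2))" using n1' unfolding r3 by simp
        also have "\<theta> * \<theta> ^ 70 = \<theta> ^ 71" by (simp flip: power_Suc)
        also have "\<theta> ^ 71 = real n powr (284 * \<epsilon>)" unfolding \<theta>_def by (subst powr_power) (use n1' in auto)
        also have "real n powr (284 * \<epsilon>) * (real n powr 1 * real n powr (- 3/2)) = real n powr (284 * \<epsilon> - 1/2)"
          unfolding powr_add[symmetric] by simp
        also have "\<dots> \<le> real n powr (- b)" using eps'(2) n1' by (intro powr_mono) auto
        finally show ?thesis by simp
      qed
      note est = prob_estimates[OF pb(1) l b(1) b(2) b(3) b(4) H sums tot]
      show "let p = sbar n s / (real n - 1); X = Xarcs n H in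
        (\<exists>d. \<bar>d\<bar> \<le> 1 * real n powr (-b) \<and>
           prob_D n s t (\<lambda>G. G \<inter> H = {}) = (1 - p) powr X * exp (Mexp n s t H + d))
        \<and> (\<exists>d. \<bar>d\<bar> \<le> 1 * real n powr (-b) \<and>
           prob_D n s t (\<lambda>G. H \<subseteq> G) = p powr X * exp (Texp n s t H + d))"
        unfolding Let_def using est err by (meson order_trans)
    qed
  qed
  show ?thesis using e0 main by blast
qed

end
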